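(* Let $H$ be any fixed hypergraph with at least one edge. There exist $C>0$ and $n_0\in\mathbb N$ depending only on $H$ such that for all $n\ge n_0$ and all $\boldsymbol p=(p_1,\dots,p_n)\in(0,1)^n$, $$d_W(\widetilde Z_H^n,\mathcal N)\le C\Bigg[\Big(\min_{F\subseteq H:\,e_F\ge1}P_F\,n^{v_F}\Big)^{-1/4}+\sum_{e\in E(H)}\Bigg(\frac{n^{-|e|}(1-p_{|e|})}{\max_{F\subseteq H:\,e_F\ge1}n^{-v_F}Q_F/P_F}\wedge\frac{1}{(1-p_{|e|})n^{|e|}}\Bigg)^{1/2}\Bigg]$$ and $$d_K(\widetilde Z_H^n,\mathcal N)\le C\Bigg[\Big(\min_{F\subseteq H:\,e_F\ge1}P_F\,n^{v_F}\Big)^{-1/5}+\sum_{e\in E(H)}\Bigg\{\Bigg(\frac{n^{-|e|}(1-p_{|e|})}{\max_{F\subseteq H:\,e_F\ge1}n^{-v_F}Q_F/P_F}\Bigg)^{1/3}\wedge\Bigg(\frac{1}{(1-p_{|e|})n^{|e|}}\Bigg)^{1/2}\Bigg\}\Bigg].$$ Additionally, for every $c\in(0,1)$ there exist $C'>0$ and $n_0'\in\mathbb N$ depending only on $H$ and $c$ such that for all $n\ge n_0'$ and all $\boldsymbol p\in(0,1)^n$ satisfying $p_{|e|}<c$ for all $e\in E(H)$, $$d_{W/K}(\widetilde Z_H^n,\mathcal N)\le C'\Big(\min_{F\subseteq H:\,e_F\ge1}P_F\,n^{v_F}\Big)^{-1/2}.$$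
   Context: A hypergraph $H$ consists of a finite vertex set $V(H)$ and a set $E(H)$ of non-empty subsets of $V(H)$ (edges, of arbitrary sizes; size $1$ is allowed). $v_H=|V(H)|$, $e_H=|E(H)|$, and $|e|$ is the size of the edge $e$. $F\subseteq H$ means $V(F)\subseteq V(H)$ and $E(F)\subseteq E(H)$; $\simeq$ denotes hypergraph isomorphism. $[n]=\{1,\dots,n\}$ and $K_n^*=([n],2^{[n]}\setminus\{\emptyset\})$ is the complete hypergraph on $[n]$. For $\boldsymbol p=(p_1,\dots,p_n)\in(0,1)^n$, the random hypergraph $\mathbb H(n,\boldsymbol p)$ has vertex set $[n]$, and each non-empty $e\subseteq[n]$ is an edge independently with probability $p_{|e|}$. $Z_H^n$ is the number of hypergraphs $H'\subseteq K_n^*$ with $H'\simeq H$ and $H'\subseteq\mathbb H(n,\boldsymbol p)$, and $\widetilde Z_H^n=(Z_H^n-\mathbf E[Z_H^n])/\sqrt{\mathrm{Var}[Z_H^n]}$ (defined for $n\ge v_H$). For a hypergraph $F$, $P_F=\prod_{e\in E(F)}p_{|e|}$ and $Q_F=\prod_{e\in E(F)}(1-p_{|e|})$. $\mathcal N$ is a standard normal random variable. $d_W(X,\mathcal N)=\sup_{\mathrm{Lip}(h)\le1}|\mathbf E[h(X)-h(\mathcal N)]|$ (supremum over $h:\mathbb R\to\mathbb R$ with Lipschitz constant at most $1$), $d_K(X,\mathcal N)=\sup_{t\in\mathbb R}|\mathbf P(X\le t)-\mathbf P(\mathcal N\le t)|$, $d_{W/K}=\max\{d_W,d_K\}$. $a\wedge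 b=\min\{a,b\}$. *)

theory Defs
  imports "HOL-Probability.Probability"
begin

section \<open>Hypergraphs\<close>

record 'a hypergraph =
  verts :: "'a set"
  edges :: "'a set set"

definition hypergraph :: "'a hypergraph \<Rightarrow> bool" where
  "hypergraph H \<longleftrightarrow> finite (verts H) \<and> edges H \<subseteq> Pow (verts H) - {{}}"

definition subhypergraph :: "'a hypergraph \<Rightarrow> 'a hypergraph \<Rightarrow> bool" where
  "subhypergraph F H \<longleftrightarrow> hypergraph F \<and> verts F \<subseteq> verts H \<and> edges F \<subseteq> edges H"

definition hypergraph_iso :: "'a hypergraph \<Rightarrow> 'b hypergraph \<Rightarrow> bool" where
  "hypergraph_iso G H \<longleftrightarrow>
     (\<exists>f. bij_betw f (verts G) (verts H) \<and> edges H = (\<lambda>e. f ` e) ` edges G)"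

definition complete_hypergraph :: "nat \<Rightarrow> nat hypergraph" where
  "complete_hypergraph n = \<lparr>verts = {1..n}, edges = Pow {1..n} - {{}}\<rparr>"

section \<open>The random hypergraph and the normalised subhypergraph count\<close>

text \<open>Only the values of \<open>p\<close> on \<open>{1..n}\<close> matter.\<close>

definition random_hypergraph :: "nat \<Rightarrow> (nat \<Rightarrow> real) \<Rightarrow> nat hypergraph pmf" where
  "random_hypergraph n p =
     map_pmf (\<lambda>I. \<lparr>verts = {1..n}, edges = {e \<in> edges (complete_hypergraph n). I e}\<rparr>)
       (Pi_pmf (edges (complete_hypergraph n)) False (\<lambda>e. bernoulli_pmf (p (card e))))"

text \<open>\<open>copy_count H n G\<close> is \<open>Z_H^n\<close> evaluated at the outcome \<open>G\<close> of the random hypergraph.\<close>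

definition copy_count :: "'a hypergraph \<Rightarrow> nat \<Rightarrow> nat hypergraph \<Rightarrow> real" where
  "copy_count H n G =
     real (card {H'. subhypergraph H' (complete_hypergraph n) \<and> hypergraph_iso H' H
                     \<and> subhypergraph H' G})"

definition normalised_copy_count ::
    "'a hypergraph \<Rightarrow> nat \<Rightarrow> (nat \<Rightarrow> real) \<Rightarrow> nat hypergraph \<Rightarrow> real" where
  "normalised_copy_count H n p G =
     (copy_count H n G - measure_pmf.expectation (random_hypergraph n p) (copy_count H n))
       / sqrt (measure_pmf.variance (random_hypergraph n p) (copy_count H n))"

definition copy_law :: "'a hypergraph \<Rightarrow> nat \<Rightarrow> (nat \<Rightarrow> real) \<Rightarrow> real measure" where
  "copy_law H n p =
     distr (measure_pmf (random_hypergraph n p)) borel (normalised_copy_count H n p)"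

section \<open>Distances between probability distributions on the real line\<close>

text \<open>
  The distances depend on random variables only through their laws. They take values in the
  extended reals so that the suprema are genuine suprema without any boundedness side condition.
\<close>

definition wasserstein_dist :: "real measure \<Rightarrow> real measure \<Rightarrow> ereal" where
  "wasserstein_dist M N =
     (SUP h\<in>{h :: real \<Rightarrow> real. 1-lipschitz_on UNIV h}. ereal \<bar>(\<integral>x. h x \<partial>M) - (\<integral>x. h x \<partial>N)\<bar>)"

definition kolmogorov_dist :: "real measure \<Rightarrow> real measure \<Rightarrow> ereal" where
  "kolmogorov_dist M N = (SUP t. ereal \<bar>cdf M t - cdf N t\<bar>)"

definition wk_dist :: "real measure \<Rightarrow> real measure \<Rightarrow> ereal" where
  "wk_dist M N = max (wasserstein_dist M N) (kolmogorov_dist M N)"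

section \<open>Quantities appearing in the bounds\<close>

definition edge_prob_prod :: "(nat \<Rightarrow> real) \<Rightarrow> 'a hypergraph \<Rightarrow> real" where
  "edge_prob_prod p F = (\<Prod>e\<in>edges F. p (card e))"

definition nonedge_prob_prod :: "(nat \<Rightarrow> real) \<Rightarrow> 'a hypergraph \<Rightarrow> real" where
  "nonedge_prob_prod p F = (\<Prod>e\<in>edges F. 1 - p (card e))"

definition nonempty_subs :: "'a hypergraph \<Rightarrow> 'a hypergraph set" where
  "nonempty_subs H = {F. subhypergraph F H \<and> card (edges F) \<ge> 1}"

definition min_PF :: "'a hypergraph \<Rightarrow> nat \<Rightarrow> (nat \<Rightarrow> real) \<Rightarrow> real" where
  "min_PF H n p =
     Min ((\<lambda>F. edge_prob_prod p F * real n ^ card (verts F)) ` nonempty_subs H)"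

definition max_QF_PF :: "'a hypergraph \<Rightarrow> nat \<Rightarrow> (nat \<Rightarrow> real) \<Rightarrow> real" where
  "max_QF_PF H n p =
     Max ((\<lambda>F. real n powi (- int (card (verts F))) * nonedge_prob_prod p F / edge_prob_prod p F)
            ` nonempty_subs H)"

definition edge_ratio :: "'a hypergraph \<Rightarrow> nat \<Rightarrow> (nat \<Rightarrow> real) \<Rightarrow> 'a set \<Rightarrow> real" where
  "edge_ratio H n p e =
     real n powi (- int (card e)) * (1 - p (card e)) / max_QF_PF H n p"

text \<open>\<open>Min\<close> and \<open>Max\<close> above range over finite sets, nonempty as soon as \<open>H\<close> has an edge.\<close>

lemma finite_nonempty_subs:
  assumes "hypergraph H"
  shows "finite (nonempty_subs H)"
proof -
  have "finite (verts H)" "finite (edges H)"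
    using assms finite_subset[of "edges H" "Pow (verts H)"] by (auto simp: hypergraph_def)
  then have "finite ((\<lambda>(V, E). \<lparr>verts = V, edges = E\<rparr>) ` (Pow (verts H) \<times> Pow (edges H)))"
    by blast
  moreover have "nonempty_subs H
      \<subseteq> (\<lambda>(V, E). \<lparr>verts = V, edges = E\<rparr>) ` (Pow (verts H) \<times> Pow (edges H))"
  proof
    fix F assume "F \<in> nonempty_subs H"
    then have "(verts F, edges F) \<in> Pow (verts H) \<times> Pow (edges H)"
      by (auto simp: nonempty_subs_def subhypergraph_def)
    then show "F \<in> (\<lambda>(V, E). \<lparr>verts = V, edges = E\<rparr>) ` (Pow (verts H) \<times> Pow (edges H))"
      by (intro image_eqI[where x = "(verts F, edges F)"]) auto
  qed
  ultimately show ?thesis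
    using finite_subset by blast
qed

lemma self_in_nonempty_subs:
  assumes "hypergraph H" and "edges H \<noteq> {}"
  shows "H \<in> nonempty_subs H"
proof -
  have "finite (edges H)"
    using assms finite_subset[of "edges H" "Pow (verts H)"] by (auto simp: hypergraph_def)
  with assms have "card (edges H) \<ge> 1"
    by (simp add: Suc_le_eq card_gt_0_iff)
  with assms show ?thesis
    by (simp add: nonempty_subs_def subhypergraph_def)
qed

end

theory Submission
  imports Defs
begin

text \<open>
  The number of copies of \<open>H\<close> is a polynomial in independent Bernoulli variables: writing \<open>I e\<close>
  for the indicator of the potential edge \<open>e\<close>, it is the sum over the copies \<open>\<alpha>\<close> of the products of
  \<open>I e\<close> over the edges of \<open>\<alpha>\<close>. The proof is an instance of Stein's method in which all quantities
  are again polynomials with nonnegative coefficients, so that their moments can be computed by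
  counting copies.
  
  Telescoping every product along its edges writes the centred and scaled count as
  \<open>W = (\<Sum>e. (I e - p e) * U e)\<close> with \<open>U e \<ge> 0\<close> not depending on \<open>I e\<close> (locale \<open>clark_ocone\<close>). Since
  \<open>E ((I e - p e) * F) = p e * (1 - p e) * E (D e F)\<close>, where \<open>D e\<close> is the difference between switching
  \<open>e\<close> on and off, \<open>E (W * f W)\<close> is the sum of \<open>p e * (1 - p e) * E (U e * D e (f W))\<close>. The difference
  \<open>D e (f W)\<close> compares \<open>f\<close> at the two ends of an interval of length \<open>V e = D e W \<ge> 0\<close>. For a solution
  \<open>f\<close> of the Stein equation it equals \<open>V e * k W\<close>, with \<open>k\<close> playing the role of \<open>f'\<close>, up to at most
  \<open>V e * D e (l W)\<close> with an increasing function \<open>l\<close>: for half-lines \<open>f'\<close> is the sum of the increasing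
  function \<open>w * f w\<close> and a decreasing step, and both are bounded; for Lipschitz test functions \<open>f'\<close> is
  itself Lipschitz and \<open>l\<close> is linear. This is the predicate \<open>stein_triple\<close>. Integrating by parts
  backwards, the accumulated error is at most \<open>E (S * l W)\<close> with
  \<open>S = (\<Sum>e. (I e - p e) * U e * V e)\<close>. Hence both distances are bounded by \<open>E \<bar>1 - T\<bar>\<close>, where
  \<open>T = (\<Sum>e. p e * (1 - p e) * U e * V e)\<close> has expectation \<open>E W\<^sup>2\<close>, and by the second moment of \<open>S\<close>
  (\<open>kolmogorov_bound\<close>, \<open>wasserstein_bound\<close>).
  
  The variance of \<open>T\<close> and the second moment of \<open>S\<close> are sums over quadruples of overlapping copies of
  the probability that all four are present. Adding the copies one after the other, each new copy
  through a prescribed edge \<open>e\<close> costs a factor \<open>\<Lambda> * y (card e)\<close>, where \<open>\<Lambda>\<close> is of the order of the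
  expected number of copies and \<open>y k\<close> is at most \<open>1 / m\<close> and at most \<open>n\<^sup>-\<^sup>k + 2\<^sup>s * M\<close>; here \<open>m\<close> is the
  minimum of \<open>P_F * n ^ v_F\<close>, \<open>M\<close> is the maximum of \<open>Q_F / (P_F * n ^ v_F)\<close> and \<open>s\<close> is the number of
  edges of \<open>H\<close> (\<open>copies_extension_le\<close>). The
  variance of the count is at least of order \<open>\<Lambda>\<^sup>2 * M\<close> (\<open>variance_ge\<close>). Together these give
  \<open>Var T = O(1 / m)\<close> and \<open>E S\<^sup>2 = O(1 / m + (\<Sum>e. 1 / ((1 - p e) * n ^ card e)))\<close>.
  
  The last sum is useless for edge sizes with few missing edges. For such a size the indicators are
  replaced by their probabilities. This is a conditional expectation which removes a fraction of
  the variance of order \<open>edge_ratio + (1 - p)\<close>; it moves the count by the square root of this fraction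
  in the Wasserstein distance, and by its cube root in the Kolmogorov distance. Every size is treated
  in the cheaper way, where sizes with \<open>1 - p\<close> above a threshold are never replaced. Balancing the
  threshold \<open>\<theta>\<close> between the cost \<open>\<theta> powr (1 / 2)\<close> or \<open>\<theta> powr (1 / 3)\<close> of replacing and the cost
  \<open>(\<theta> * m) powr (- 1 / 2)\<close> of keeping gives \<open>\<theta> = m powr (- 1 / 2)\<close> or \<open>\<theta> = m powr (- 3 / 5)\<close>, and this is
  where the exponents \<open>1 / 4\<close> and \<open>1 / 5\<close> come from. If \<open>p\<close> stays away from \<open>1\<close>, all sizes are kept
  and the rate is \<open>m powr (- 1 / 2)\<close>.
\<close>

section \<open>Gaussian tail estimates\<close>

lemma std_normal_density_deriv:
  "(std_normal_density has_real_derivative - x * std_normal_density x) (at x)"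
  unfolding std_normal_density_def
  by (rule derivative_eq_intros refl | simp)+

lemma std_normal_density_pos: "std_normal_density x > 0"
  by (simp add: normal_density_pos)

lemma std_normal_density_even: "std_normal_density (- x) = std_normal_density x"
  by (simp add: std_normal_density_def)

lemma std_normal_density_tendsto: "(std_normal_density \<longlongrightarrow> 0) at_top"
  unfolding std_normal_density_def by real_asymp

lemma mult_std_normal_density_tendsto: "((\<lambda>x. x * std_normal_density x) \<longlongrightarrow> 0) at_top"
  unfolding std_normal_density_def by real_asymp

lemma nonneg_of_antimono_tendsto_zero:
  fixes k :: "real \<Rightarrow> real"
  assumes d: "\<And>x. x \<ge> a \<Longrightarrow> (k has_real_derivative k' x) (at x)"
    and le: "\<And>x. x \<ge> a \<Longrightarrow> k' x \<le> 0"
    and lim: "(k \<longlongrightarrow> 0) at_top" and "a \<le> w"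
  shows "0 \<le> k w"
proof (rule tendsto_upperbound[OF lim])
  show "\<forall>\<^sub>F x in at_top. k x \<le> k w"
    using eventually_ge_at_top[of w]
  proof eventually_elim
    case (elim x)
    show ?case
      using DERIV_nonpos_imp_nonincreasing[of w x k] elim d le \<open>a \<le> w\<close>
      by (meson order.trans)
  qed
qed simp

text \<open>
  Comparison with \<open>v w = (2 * a / (1 + w) + b) * std_normal_density w\<close>: both \<open>u\<close> and \<open>v\<close> vanish at
  infinity and \<open>v' \<le> - \<bar>u'\<bar>\<close>, so \<open>v - u\<close> and \<open>v + u\<close> decrease to \<open>0\<close>. Unlike Mills' bound with \<open>a / w\<close>, this
  majorant stays finite at \<open>w = 0\<close>, so one estimate serves the whole half-line.
\<close>

lemma gaussian_tail_bound:
  fixes u :: "real \<Rightarrow> real"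
  assumes d: "\<And>x. x \<ge> 0 \<Longrightarrow> (u has_real_derivative r x * std_normal_density x) (at x)"
    and r: "\<And>x. x \<ge> 0 \<Longrightarrow> \<bar>r x\<bar> \<le> a + b * x"
    and ab: "0 \<le> a" "0 \<le> b"
    and lim: "(u \<longlongrightarrow> 0) at_top" and w: "0 \<le> w"
  shows "\<bar>u w\<bar> \<le> (2 * a / (1 + w) + b) * std_normal_density w"
proof -
  define v where "v x = (2 * a / (1 + x) + b) * std_normal_density x" for x :: real
  define v' where "v' x = (- 2 * a / (1 + x)\<^sup>2 - x * (2 * a / (1 + x) + b)) * std_normal_density x"
    for x :: real
  have dv: "(v has_real_derivative v' x) (at x)" if "x \<ge> 0" for x
  proof -
    have "((\<lambda>x. 2 * a / (1 + x) + b) has_real_derivative - 2 * a / (1 + x)\<^sup>2) (at x)"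
      using that by (auto intro!: derivative_eq_intros simp: power2_eq_square)
    from DERIV_mult[OF this std_normal_density_deriv] show ?thesis
      unfolding v_def v'_def by (rule DERIV_cong) (simp add: algebra_simps)
  qed
  \<comment> \<open>The constant \<open>2\<close> in \<open>v\<close> is chosen such that \<open>2 / (1 + x)\<^sup>2 + 2 * x / (1 + x) \<ge> 1\<close>.\<close>
  have v'_le: "v' x \<le> - (a + b * x) * std_normal_density x" if "x \<ge> 0" for x
  proof -
    have "1 \<le> 2 / (1 + x)\<^sup>2 + x * 2 / (1 + x)"
      using that by (simp add: divide_simps power2_eq_square) (simp add: algebra_simps)
    from mult_left_mono[OF this \<open>0 \<le> a\<close>]
    have "a + b * x \<le> 2 * a / (1 + x)\<^sup>2 + x * (2 * a / (1 + x) + b)"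
      by (simp add: algebra_simps)
    then have "- 2 * a / (1 + x)\<^sup>2 - x * (2 * a / (1 + x) + b) \<le> - (a + b * x)"
      by simp
    then show ?thesis
      unfolding v'_def by (intro mult_right_mono) auto
  qed
  have limv: "(v \<longlongrightarrow> 0) at_top"
  proof -
    have "((\<lambda>x::real. 2 * a / (1 + x) + b) \<longlongrightarrow> b) at_top"
      by real_asymp
    from tendsto_mult[OF this std_normal_density_tendsto] show ?thesis
      unfolding v_def by simp
  qed
  have "0 \<le> v w - s * u w" if s: "\<bar>s\<bar> = 1" for s
  proof (rule nonneg_of_antimono_tendsto_zero[where a = 0 and w = w
        and k = "\<lambda>x. v x - s * u x" and k' = "\<lambda>x. v' x - s * (r x * std_normal_density x)"])
    fix x :: real assume x: "x \<ge> 0"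
    show "((\<lambda>x. v x - s * u x) has_real_derivative v' x - s * (r x * std_normal_density x)) (at x)"
      by (intro derivative_intros dv d DERIV_cmult x)
    have "\<bar>s * r x\<bar> \<le> a + b * x" using r[OF x] s by (simp add: abs_mult)
    then have "- (a + b * x) * std_normal_density x \<le> (s * r x) * std_normal_density x"
      by (intro mult_right_mono) auto
    with v'_le[OF x] show "v' x - s * (r x * std_normal_density x) \<le> 0"
      by (simp add: algebra_simps)
  next
    show "((\<lambda>x. v x - s * u x) \<longlongrightarrow> 0) at_top"
      using tendsto_diff[OF limv tendsto_mult[OF tendsto_const lim, of s]] by simp
  qed (use w in auto)
  from this[of 1] this[of "-1"] show ?thesis by (simp add: v_def)
qed

text \<open>
  The estimate on the negative half-line is the previous one for the reflected function.
\<close>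

lemma gaussian_tail_bound_two_sided:
  fixes u :: "real \<Rightarrow> real"
  assumes d: "\<And>x. (u has_real_derivative r x * std_normal_density x) (at x)"
    and r: "\<And>x. \<bar>r x\<bar> \<le> a + b * \<bar>x\<bar>" and ab: "0 \<le> a" "0 \<le> b"
    and lim: "(u \<longlongrightarrow> 0) at_top" "((\<lambda>x. u (- x)) \<longlongrightarrow> 0) at_top"
  shows "\<bar>u w\<bar> \<le> (2 * a / (1 + \<bar>w\<bar>) + b) * std_normal_density w"
proof (cases "w \<ge> 0")
  case True
  have "\<bar>r x\<bar> \<le> a + b * x" if "x \<ge> 0" for x using r[of x] that by simp
  from gaussian_tail_bound[OF d this ab lim(1) True] True show ?thesis by simp
next
  case False
  have "((\<lambda>x. u (- x)) has_real_derivative - r (- x) * std_normal_density x) (at x)" for x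
  proof -
    have "((\<lambda>x. u (- x)) has_real_derivative (r (- x) * std_normal_density (- x)) * (- 1)) (at x)"
      by (rule DERIV_chain2[OF d]) (auto intro!: derivative_eq_intros)
    then show ?thesis by (simp add: std_normal_density_even)
  qed
  moreover have "\<bar>- r (- x)\<bar> \<le> a + b * x" if "x \<ge> 0" for x using r[of "- x"] that by simp
  ultimately have "\<bar>u (- (- w))\<bar> \<le> (2 * a / (1 + - w) + b) * std_normal_density (- w)"
    using False by (intro gaussian_tail_bound[where r = "\<lambda>x. - r (- x)", OF _ _ ab lim(2)]) auto
  with False show ?thesis by (simp add: std_normal_density_even)
qed

lemma has_derivative_integral_atMost:
  fixes k :: "real \<Rightarrow> real"
  assumes k: "continuous_on UNIV k" and i: "integrable lborel k"
  shows "((\<lambda>w. \<integral>x. indicator {..w} x * k x \<partial>lborel) has_real_derivative k w) (at w)"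
proof -
  define F where "F w = (\<integral>x. indicator {..w} x * k x \<partial>lborel)" for w
  have ii: "set_integrable lborel A k" if "A \<in> sets borel" for A
    using integrable_mult_indicator[OF _ i, of A] that by (simp add: set_integrable_def)
  have eq: "F u = F (w - 1) + (LBINT y=w-1..u. k y)" if "w - 1 \<le> u" for u
  proof -
    have "F u = (\<integral>x. indicator {..w-1} x * k x + indicator {w-1<..u} x * k x \<partial>lborel)"
      unfolding F_def using that by (intro Bochner_Integration.integral_cong) (auto simp: indicator_def)
    also have "\<dots> = F (w - 1) + (\<integral>x. indicator {w-1<..u} x * k x \<partial>lborel)"
      unfolding F_def using ii[of "{..w-1}"] ii[of "{w-1<..u}"]
      by (intro Bochner_Integration.integral_add) (auto simp: set_integrable_def)
    also have "(\<integral>x. indicator {w-1<..u} x * k x \<partial>lborel) = (LBINT y=w-1..u. k y)"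
      using that by (subst interval_integral_Ioc) (auto simp: set_lebesgue_integral_def)
    finally show ?thesis .
  qed
  have "((\<lambda>u. LBINT y=w-1..u. k y) has_vector_derivative k w) (at w within {w-1..w+1})"
    by (rule interval_integral_FTC2) (use continuous_on_subset[OF k] in auto)
  then have "((\<lambda>u. LBINT y=w-1..u. k y) has_real_derivative k w) (at w)"
    by (simp add: has_real_derivative_iff_has_vector_derivative at_within_Icc_at)
  then have "((\<lambda>u. F (w - 1) + (LBINT y=w-1..u. k y)) has_real_derivative k w) (at w)"
    by (auto intro!: derivative_eq_intros)
  then have "(F has_real_derivative k w) (at w)"
  proof (rule DERIV_cong_ev[THEN iffD1, rotated -1])
    show "\<forall>\<^sub>F x in nhds w. F (w - 1) + (LBINT y=w-1..x. k y) = F x"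
      using eventually_nhds_in_open[of "{w-1<..<w+1}" w, simplified]
    proof eventually_elim
      case (elim x)
      then show ?case by (intro eq[symmetric]) auto
    qed
  qed auto
  then show ?thesis unfolding F_def .
qed

lemma integral_atMost_tendsto:
  fixes k :: "real \<Rightarrow> real"
  assumes i: "integrable lborel k"
  shows "((\<lambda>w. \<integral>x. indicator {..w} x * k x \<partial>lborel) \<longlongrightarrow> (\<integral>x. k x \<partial>lborel)) at_top"
    and "((\<lambda>w. \<integral>x. indicator {..-w} x * k x \<partial>lborel) \<longlongrightarrow> 0) at_top"
proof -
  have top: "((\<lambda>w. \<integral>x. indicator {..w} x * k x \<partial>lborel) \<longlongrightarrow> (\<integral>x. k x \<partial>lborel)) at_top"
    if "integrable lborel k" for k :: "real \<Rightarrow> real"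
    using tendsto_integral_at_top[of lborel k] that by simp
  show "((\<lambda>w. \<integral>x. indicator {..w} x * k x \<partial>lborel) \<longlongrightarrow> (\<integral>x. k x \<partial>lborel)) at_top"
    by (rule top[OF i])
  have i': "integrable lborel (\<lambda>x. k (- x))"
    using lborel_integrable_real_affine_iff[of "-1" k 0] i by simp
  have eq: "(\<integral>x. indicator {..-w} x * k x \<partial>lborel) =
      (\<integral>x. k x \<partial>lborel) - (\<integral>x. indicator {..w} x * k (- x) \<partial>lborel)" for w
  proof -
    have "(\<integral>x. indicator {..w} x * k (- x) \<partial>lborel) = (\<integral>x. indicator {-w..} x * k x \<partial>lborel)"
      using lborel_integral_real_affine[of "-1" "\<lambda>x. indicator {-w..} x * k x" 0]
      by (simp add: indicator_def minus_le_iff)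
    also have "\<dots> = (\<integral>x. indicator {-w<..} x * k x \<partial>lborel)"
    proof (rule integral_cong_AE)
      show "AE x in lborel. indicator {-w..} x * k x = indicator {-w<..} x * k x"
        using AE_lborel_singleton[of "-w"] by eventually_elim (auto simp: indicator_def)
    qed (use i in auto)
    also have "(\<integral>x. indicator {..-w} x * k x \<partial>lborel) + \<dots> =
        (\<integral>x. indicator {..-w} x * k x + indicator {-w<..} x * k x \<partial>lborel)"
      using integrable_mult_indicator[OF _ i, of "{..-w}"] integrable_mult_indicator[OF _ i, of "{-w<..}"]
      by (intro Bochner_Integration.integral_add[symmetric]) auto
    also have "\<dots> = (\<integral>x. k x \<partial>lborel)"
      by (intro Bochner_Integration.integral_cong) (auto simp: indicator_def)
    finally show ?thesis by simp
  qed
  have "(\<integral>x. k (- x) \<partial>lborel) = (\<integral>x. k x \<partial>lborel)"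
    using lborel_integral_real_affine[of "-1" k 0] by simp
  then show "((\<lambda>w. \<integral>x. indicator {..-w} x * k x \<partial>lborel) \<longlongrightarrow> 0) at_top"
    unfolding eq using tendsto_diff[OF tendsto_const top[OF i'], of "\<integral>x. k x \<partial>lborel"] by simp
qed

section \<open>The Stein equation for half-lines\<close>

abbreviation normal_cdf :: "real \<Rightarrow> real" where
  "normal_cdf \<equiv> cdf std_normal_distribution"

definition normal_tail :: "real \<Rightarrow> real" where
  "normal_tail w = 1 - normal_cdf w"

definition mills_ratio :: "real \<Rightarrow> real" where
  "mills_ratio w = normal_tail w / std_normal_density w"

lemma normal_cdf_eq: "normal_cdf w = (\<integral>x. indicator {..w} x * std_normal_density x \<partial>lborel)"
proof -
  interpret real_distribution std_normal_distribution by (rule real_dist_normal_dist)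
  have "normal_cdf w = (\<integral>x. indicator {..w} x \<partial>std_normal_distribution)"
    by (simp add: cdf_def)
  also have "\<dots> = (\<integral>x. std_normal_density x *\<^sub>R indicator {..w} x \<partial>lborel)"
    by (rule integral_density) auto
  finally show ?thesis by (simp add: mult.commute)
qed

lemma normal_cdf_deriv: "(normal_cdf has_real_derivative std_normal_density w) (at w)"
proof -
  have "continuous_on UNIV std_normal_density"
    unfolding std_normal_density_def by (intro continuous_intros) auto
  from has_derivative_integral_atMost[OF this, of w] show ?thesis
    by (simp add: normal_cdf_eq[abs_def])
qed

lemma normal_cdf_bounds: "0 \<le> normal_cdf w" "normal_cdf w \<le> 1"
proof -
  interpret real_distribution std_normal_distribution by (rule real_dist_normal_dist)
  show "0 \<le> normal_cdf w" "normal_cdf w \<le> 1" by (simp_all add: cdf_nonneg cdf_bounded_prob)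
qed

lemma normal_tail_bounds: "0 \<le> normal_tail w" "normal_tail w \<le> 1"
  using normal_cdf_bounds[of w] by (auto simp: normal_tail_def)

lemma normal_cdf_mono: "a \<le> b \<Longrightarrow> normal_cdf a \<le> normal_cdf b"
proof -
  interpret real_distribution std_normal_distribution by (rule real_dist_normal_dist)
  show "a \<le> b \<Longrightarrow> ?thesis" by (rule cdf_nondecreasing)
qed

lemma normal_tail_deriv: "(normal_tail has_real_derivative - std_normal_density w) (at w)"
  unfolding normal_tail_def by (auto intro!: derivative_eq_intros normal_cdf_deriv)

lemma normal_tail_tendsto: "(normal_tail \<longlongrightarrow> 0) at_top"
proof -
  have "(normal_cdf \<longlongrightarrow> 1) at_top"
    using integral_atMost_tendsto(1)[of std_normal_density] by (simp add: normal_cdf_eq[abs_def])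
  from tendsto_diff[OF tendsto_const this, of 1] show ?thesis
    unfolding normal_tail_def by simp
qed

lemma normal_cdf_minus: "normal_cdf (- w) = normal_tail w"
proof -
  let ?d = "\<lambda>w. normal_cdf (- w) - normal_tail w"
  have d: "(?d has_real_derivative 0) (at x)" for x
  proof -
    have "((\<lambda>w. normal_cdf (- w)) has_real_derivative std_normal_density (- x) * (- 1)) (at x)"
      by (rule DERIV_chain2[OF normal_cdf_deriv]) (auto intro!: derivative_eq_intros)
    from DERIV_diff[OF this normal_tail_deriv] show ?thesis
      by (simp add: std_normal_density_even)
  qed
  have "((\<lambda>w. normal_cdf (- w)) \<longlongrightarrow> 0) at_top"
    using integral_atMost_tendsto(2)[of std_normal_density] by (simp add: normal_cdf_eq)
  from tendsto_diff[OF this normal_tail_tendsto] have lim: "(?d \<longlongrightarrow> 0) at_top" by simp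
  have "0 \<le> s * ?d w" for s
  proof (rule nonneg_of_antimono_tendsto_zero[where a = w and w = w
        and k = "\<lambda>w. s * ?d w" and k' = "\<lambda>_. 0"])
    show "((\<lambda>w. s * ?d w) \<longlongrightarrow> 0) at_top"
      using tendsto_mult[OF tendsto_const lim, of s] by simp
  qed (use DERIV_cmult[OF d] in auto)
  from this[of 1] this[of "-1"] show ?thesis by simp
qed

lemma normal_tail_minus: "normal_tail (- w) = normal_cdf w"
  using normal_cdf_minus[of "-w"] by simp

lemma normal_tail_le: "w \<ge> 0 \<Longrightarrow> normal_tail w \<le> 2 / (1 + w) * std_normal_density w"
  using gaussian_tail_bound[of normal_tail "\<lambda>_. -1" 1 0 w] normal_tail_deriv normal_tail_tendsto
  by simp

text \<open>
  The difference of the two sides has derivative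
  \<open>- 2 * std_normal_density w / (1 + w\<^sup>2)\<^sup>2\<close> and tends to \<open>0\<close>. This lower bound is exactly what makes
  \<open>w * mills_ratio w\<close> increasing.
\<close>

lemma normal_tail_ge: "w * std_normal_density w / (1 + w\<^sup>2) \<le> normal_tail w"
proof -
  define k' where "k' x = - 2 * std_normal_density x / (1 + x\<^sup>2)\<^sup>2" for x :: real
  have nz: "1 + x\<^sup>2 \<noteq> 0" for x :: real by (smt (verit) zero_le_power2)
  have dq: "((\<lambda>x. x / (1 + x\<^sup>2)) has_real_derivative (1 - x\<^sup>2) / (1 + x\<^sup>2)\<^sup>2) (at x)" for x :: real
    using nz[of x] by (auto intro!: derivative_eq_intros simp: field_simps power2_eq_square)
  have d: "((\<lambda>x. normal_tail x - x / (1 + x\<^sup>2) * std_normal_density x) has_real_derivative k' x) (at x)" for x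
  proof -
    have "1 + (1 - x\<^sup>2) / (1 + x\<^sup>2)\<^sup>2 - x * (x / (1 + x\<^sup>2)) = 2 / (1 + x\<^sup>2)\<^sup>2"
      using nz[of x] by (simp add: divide_simps) (simp add: power2_eq_square algebra_simps)
    then have "(- 1 - (1 - x\<^sup>2) / (1 + x\<^sup>2)\<^sup>2 + x * (x / (1 + x\<^sup>2))) * std_normal_density x
        = - (2 / (1 + x\<^sup>2)\<^sup>2) * std_normal_density x" by (intro arg_cong2[where f = "(*)"]) auto
    with DERIV_diff[OF normal_tail_deriv DERIV_mult[OF dq std_normal_density_deriv], of x]
    show ?thesis unfolding k'_def by (elim DERIV_cong) (simp add: algebra_simps)
  qed
  have "((\<lambda>x::real. x / (1 + x\<^sup>2)) \<longlongrightarrow> 0) at_top" by real_asymp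
  from tendsto_diff[OF normal_tail_tendsto tendsto_mult[OF this std_normal_density_tendsto]]
  have lim: "((\<lambda>x. normal_tail x - x / (1 + x\<^sup>2) * std_normal_density x) \<longlongrightarrow> 0) at_top" by simp
  have "0 \<le> normal_tail w - w / (1 + w\<^sup>2) * std_normal_density w"
    by (rule nonneg_of_antimono_tendsto_zero[OF d _ lim order_refl])
       (auto simp: k'_def)
  then show ?thesis by simp
qed

lemma mills_ratio_deriv: "(mills_ratio has_real_derivative w * mills_ratio w - 1) (at w)"
  unfolding mills_ratio_def[abs_def] using std_normal_density_pos[of w]
  by (auto intro!: derivative_eq_intros normal_tail_deriv std_normal_density_deriv
      simp: field_simps power2_eq_square)

lemma mills_ratio_nonneg: "0 \<le> mills_ratio w"
  by (simp add: mills_ratio_def normal_tail_bounds)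

lemma mult_mills_ratio_mono: "mono (\<lambda>w. w * mills_ratio w)"
proof (rule monoI)
  fix a b :: real assume "a \<le> b"
  show "a * mills_ratio a \<le> b * mills_ratio b"
  proof (rule DERIV_nonneg_imp_nondecreasing[OF \<open>a \<le> b\<close>])
    fix w :: real
    have "w \<le> (1 + w\<^sup>2) * mills_ratio w"
      using normal_tail_ge[of w] std_normal_density_pos[of w]
      by (simp add: mills_ratio_def field_simps add_pos_nonneg)
    moreover have "((\<lambda>w. w * mills_ratio w) has_real_derivative (1 + w\<^sup>2) * mills_ratio w - w) (at w)"
      by (auto intro!: derivative_eq_intros mills_ratio_deriv simp: power2_eq_square algebra_simps)
    ultimately show "\<exists>y. ((\<lambda>w. w * mills_ratio w) has_real_derivative y) (at w) \<and> 0 \<le> y"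
      by (intro exI[of _ "(1 + w\<^sup>2) * mills_ratio w - w"]) simp
  qed
qed

lemma mult_mills_ratio_le: "w * mills_ratio w \<le> 2"
proof (cases "w \<ge> 0")
  case True
  then have "w * mills_ratio w \<le> w * (2 / (1 + w))"
    using normal_tail_le[OF True] std_normal_density_pos[of w]
    by (intro mult_left_mono) (auto simp: mills_ratio_def field_simps)
  also have "\<dots> \<le> 2" using True by (simp add: field_simps)
  finally show ?thesis .
next
  case False
  then have "w * mills_ratio w \<le> 0" using mills_ratio_nonneg[of w] by (simp add: mult_le_0_iff)
  then show ?thesis by simp
qed

text \<open>
  The increments of \<open>f\<close> are compared with \<open>k\<close> at either end of the interval, and the error is measured
  by the increment of \<open>l\<close>. For a random variable \<open>W\<close> taking the values \<open>a\<close> and \<open>b\<close> when a Bernoulli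
  variable is switched off and on, \<open>k c\<close> with \<open>c \<in> {a, b}\<close> is then \<open>k W\<close> whatever the state of the
  variable.
\<close>

definition stein_triple :: "(real \<Rightarrow> real) \<Rightarrow> (real \<Rightarrow> real) \<Rightarrow> (real \<Rightarrow> real) \<Rightarrow> bool" where
  "stein_triple f k l \<longleftrightarrow>
     (\<forall>a b. a \<le> b \<longrightarrow> (\<forall>c\<in>{a, b}. \<bar>f b - f a - (b - a) * k c\<bar> \<le> (b - a) * (l b - l a)))"

lemma increment_bounds_of_mono_deriv:
  fixes f g :: "real \<Rightarrow> real"
  assumes "a \<le> b" and d: "\<And>x. (f has_real_derivative g x + s) (at x)" and m: "mono g"
  shows "(b - a) * (g a + s) \<le> f b - f a" "f b - f a \<le> (b - a) * (g b + s)"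
proof -
  have "(b - a) * (g a + s) \<le> f b - f a \<and> f b - f a \<le> (b - a) * (g b + s)"
  proof (cases "a = b")
    case False
    with \<open>a \<le> b\<close> have "a < b" by simp
    from MVT2[OF this, of f "\<lambda>x. g x + s"] d obtain z where
      z: "a < z" "z < b" "f b - f a = (b - a) * (g z + s)" by auto
    then have "g a \<le> g z" "g z \<le> g b" using m by (auto simp: mono_def)
    with z show ?thesis by (auto intro!: mult_left_mono)
  qed simp
  then show "(b - a) * (g a + s) \<le> f b - f a" "f b - f a \<le> (b - a) * (g b + s)" by auto
qed

text \<open>
  The solution is a multiple of \<open>mills_ratio (- w)\<close> to the left of \<open>x\<close> and of \<open>mills_ratio w\<close> to the
  right. Away from \<open>x\<close> its derivative is \<open>g w + of_bool (w \<le> x) - normal_cdf x\<close> where \<open>g w = w * f w\<close>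
  is increasing. So on an interval the derivative lies between the value formed with \<open>g\<close> at the left
  and the step at the right end, and the value formed with \<open>g\<close> at the right and the step at the left
  end; the gap between these two is the increment of \<open>l w = g w - of_bool (w \<le> x)\<close>.
\<close>

lemma stein_solution_halfline:
  obtains f k l where
    "\<And>w. k w - w * f w = of_bool (w \<le> x) - normal_cdf x"
    "\<And>w. \<bar>k w\<bar> \<le> 3" "\<And>w. \<bar>l w\<bar> \<le> 3" "stein_triple f k l"
proof -
  define f1 where "f1 w = normal_tail x * mills_ratio (- w)" for w
  define f2 where "f2 w = normal_cdf x * mills_ratio w" for w
  define g1 where "g1 w = w * f1 w" for w
  define g2 where "g2 w = w * f2 w" for w
  define f where "f w = (if w \<le> x then f1 w else f2 w)" for w
  define g where "g w = w * f w" for w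
  define k where "k w = g w + of_bool (w \<le> x) - normal_cdf x" for w
  define l where "l w = g w - of_bool (w \<le> x)" for w
  have m1: "mono g1"
  proof (rule monoI)
    fix a b :: real assume "a \<le> b"
    then have "- b * mills_ratio (- b) \<le> - a * mills_ratio (- a)"
      using monoD[OF mult_mills_ratio_mono, of "- b" "- a"] by simp
    from mult_left_mono[OF this normal_tail_bounds(1)[of x]]
    show "g1 a \<le> g1 b" by (simp add: g1_def f1_def algebra_simps)
  qed
  have m2: "mono g2"
  proof (rule monoI)
    fix a b :: real assume "a \<le> b"
    then have "a * mills_ratio a \<le> b * mills_ratio b"
      using mult_mills_ratio_mono by (auto simp: mono_def)
    from mult_left_mono[OF this normal_cdf_bounds(1)[of x]]
    show "g2 a \<le> g2 b" by (simp add: g2_def f2_def algebra_simps)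
  qed
  have d1: "(f1 has_real_derivative g1 w + (1 - normal_cdf x)) (at w)" for w
  proof -
    have "((\<lambda>w. mills_ratio (- w)) has_real_derivative (- w * mills_ratio (- w) - 1) * (- 1)) (at w)"
      by (rule DERIV_chain2[OF mills_ratio_deriv]) (auto intro!: derivative_eq_intros)
    from DERIV_cmult[OF this, of "normal_tail x"] show ?thesis
      unfolding f1_def[abs_def] g1_def by (elim DERIV_cong) (simp add: normal_tail_def algebra_simps)
  qed
  have d2: "(f2 has_real_derivative g2 w + (- normal_cdf x)) (at w)" for w
    using DERIV_cmult[OF mills_ratio_deriv, of "normal_cdf x" w]
    unfolding f2_def[abs_def] g2_def by (elim DERIV_cong) (simp add: algebra_simps)
  have fx: "f1 x = f2 x"
    by (simp add: f1_def f2_def mills_ratio_def normal_tail_minus std_normal_density_even)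
  have g1: "g w = g1 w" if "w \<le> x" for w using that by (simp add: g_def f_def g1_def)
  have g2: "g w = g2 w" if "x \<le> w" for w
    using that fx by (cases "w = x") (simp_all add: g_def f_def g1_def g2_def)
  have f2: "f w = f2 w" if "x \<le> w" for w
    using that fx by (cases "w = x") (simp_all add: f_def)
  have f1: "f w = f1 w" if "w \<le> x" for w using that by (simp add: f_def)
  have mg: "g a \<le> g b" if "a \<le> b" for a b
  proof -
    consider "b \<le> x" | "x \<le> a" | "a \<le> x" "x \<le> b" by linarith
    then show ?thesis
    proof cases
      case 3
      have "g1 a \<le> g1 x" "g2 x \<le> g2 b" using 3 m1 m2 by (auto simp: mono_def)
      with g1[of a] g1[of x] g2[of x] g2[of b] 3 show ?thesis by simp
    qed (use that g1 g2 m1 m2 in \<open>auto simp: mono_def\<close>)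
  qed
  have gb: "\<bar>g w\<bar> \<le> 2" for w
  proof -
    consider "w \<le> x" "w \<le> 0" | "x \<le> w" "0 \<le> w" | "w \<le> x" "0 \<le> w" | "x \<le> w" "w \<le> 0" by linarith
    then show ?thesis
    proof cases
      case 1
      have "\<bar>g w\<bar> = normal_tail x * (- w * mills_ratio (- w))"
        using 1 normal_tail_bounds[of x] mills_ratio_nonneg[of "-w"]
        by (simp add: g_def f_def f1_def abs_mult)
      also have "\<dots> \<le> 1 * 2" using normal_tail_bounds[of x] mult_mills_ratio_le[of "-w"] 1 mills_ratio_nonneg[of "-w"]
        by (intro mult_mono) (auto simp: mult_nonpos_nonneg)
      finally show ?thesis by simp
    next
      case 2
      have "\<bar>g w\<bar> = normal_cdf x * (w * mills_ratio w)"
        using 2 normal_cdf_bounds[of x] mills_ratio_nonneg[of w]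
        by (simp add: g2 g2_def f2_def abs_mult)
      also have "\<dots> \<le> 1 * 2" using normal_cdf_bounds[of x] mult_mills_ratio_le[of "w"] 2 mills_ratio_nonneg[of w]
        by (intro mult_mono) auto
      finally show ?thesis by simp
    next
      case 3
      have "\<bar>g w\<bar> = w * normal_cdf w * normal_tail x / std_normal_density w"
        using 3 normal_cdf_bounds[of w] normal_tail_bounds[of x]
        by (simp add: g_def f_def f1_def abs_mult mills_ratio_def std_normal_density_even normal_tail_minus)
      also have "\<dots> \<le> w * 1 * normal_tail w / std_normal_density w"
        using 3 normal_cdf_bounds[of w] normal_tail_bounds[of x] normal_cdf_mono[of w x]
        by (intro divide_right_mono mult_mono mult_nonneg_nonneg) (auto simp: normal_tail_def)
      also have "\<dots> \<le> 2" using mult_mills_ratio_le[of w] by (simp add: mills_ratio_def)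
      finally show ?thesis .
    next
      case 4
      have "\<bar>g w\<bar> = - w * normal_tail w * normal_cdf x / std_normal_density w"
        using 4 normal_cdf_bounds[of x] normal_tail_bounds[of w]
        by (simp add: g2 g2_def f2_def abs_mult mills_ratio_def)
      also have "\<dots> \<le> - w * 1 * normal_cdf w / std_normal_density w"
        using 4 normal_cdf_bounds[of x] normal_tail_bounds[of w] normal_cdf_mono[of x w]
        by (intro divide_right_mono mult_mono mult_nonneg_nonneg) auto
      also have "\<dots> \<le> 2" using mult_mills_ratio_le[of "-w"]
        by (simp add: mills_ratio_def normal_tail_minus std_normal_density_even)
      finally show ?thesis .
    qed
  qed
  have key: "(b - a) * (g a + of_bool (b \<le> x) - normal_cdf x) \<le> f b - f a"
      "f b - f a \<le> (b - a) * (g b + of_bool (a \<le> x) - normal_cdf x)" if "a \<le> b" for a b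
  proof -
    have "(b - a) * (g a + of_bool (b \<le> x) - normal_cdf x) \<le> f b - f a \<and>
      f b - f a \<le> (b - a) * (g b + of_bool (a \<le> x) - normal_cdf x)"
    proof -
      consider "b \<le> x" | "x < a" | "a \<le> x" "x < b" by linarith
      then show ?thesis
      proof cases
        case 1
        then show ?thesis
          using increment_bounds_of_mono_deriv[OF that d1 m1] that
          by (simp add: f1 g1 algebra_simps)
      next
        case 2
        then show ?thesis
          using increment_bounds_of_mono_deriv[OF that d2 m2] that
          by (simp add: f2 g2 algebra_simps)
      next
        \<comment> \<open>The step lies inside the interval, which is split at \<open>x\<close>.\<close>
        case 3
        have A: "(x - a) * (g a + (1 - normal_cdf x)) \<le> f x - f a"
            "f x - f a \<le> (x - a) * (g x + (1 - normal_cdf x))"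
          using increment_bounds_of_mono_deriv[OF _ d1 m1, of a x] 3 by (simp_all add: f1 g1)
        have B: "(b - x) * (g x + (- normal_cdf x)) \<le> f b - f x"
            "f b - f x \<le> (b - x) * (g b + (- normal_cdf x))"
          using increment_bounds_of_mono_deriv[OF _ d2 m2, of x b] 3 by (simp_all add: f2 g2)
        have "(x - a) * g x \<le> (x - a) * g b" "(b - x) * g a \<le> (b - x) * g x"
          using 3 mg by (auto intro!: mult_left_mono)
        with A B 3 show ?thesis by (auto simp: algebra_simps)
      qed
    qed
    then show "(b - a) * (g a + of_bool (b \<le> x) - normal_cdf x) \<le> f b - f a"
      "f b - f a \<le> (b - a) * (g b + of_bool (a \<le> x) - normal_cdf x)" by auto
  qed
  have "stein_triple f k l"
    unfolding stein_triple_def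
  proof (intro allI impI ballI)
    fix a b c :: real assume ab: "a \<le> b" and c: "c \<in> {a, b}"
    have "g a + of_bool (b \<le> x) - normal_cdf x \<le> k c" "k c \<le> g b + of_bool (a \<le> x) - normal_cdf x"
      using c mg[OF ab] ab by (auto simp: k_def)
    from this[THEN mult_left_mono[of _ _ "b - a"]] ab
    have "(b - a) * (g a + of_bool (b \<le> x) - normal_cdf x) \<le> (b - a) * k c"
        "(b - a) * k c \<le> (b - a) * (g b + of_bool (a \<le> x) - normal_cdf x)" by auto
    with key[OF ab] show "\<bar>f b - f a - (b - a) * k c\<bar> \<le> (b - a) * (l b - l a)"
      by (simp add: l_def algebra_simps abs_le_iff)
  qed
  moreover have "\<bar>k w\<bar> \<le> 3" "\<bar>l w\<bar> \<le> 3" for w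
    using gb[of w] normal_cdf_bounds[of x] by (auto simp: k_def l_def abs_le_iff)
  moreover have "k w - w * f w = of_bool (w \<le> x) - normal_cdf x" for w
    by (simp add: k_def g_def)
  ultimately show ?thesis using that by blast
qed

section \<open>The Stein equation for Lipschitz functions\<close>

lemma integrable_std_normal_lipschitz:
  fixes h :: "real \<Rightarrow> real"
  assumes h: "1-lipschitz_on UNIV h"
  shows "integrable std_normal_distribution h"
    and "\<bar>h x - (\<integral>y. h y \<partial>std_normal_distribution)\<bar> \<le> \<bar>x\<bar> + 1"
proof -
  interpret real_distribution std_normal_distribution by (rule real_dist_normal_dist)
  have lip: "\<bar>h x - h y\<bar> \<le> \<bar>x - y\<bar>" for x y
    using lipschitz_onD[OF h, of x y] by (simp add: dist_real_def)
  have cont: "continuous_on UNIV h" using h by (rule lipschitz_on_continuous_on)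
  have i1: "integrable std_normal_distribution (\<lambda>x. \<bar>x\<bar>)"
    using integrable_std_normal_distribution_moment[of 1] by simp
  have meas: "h \<in> borel_measurable std_normal_distribution"
    using borel_measurable_continuous_onI[OF cont] by simp
  have i2: "integrable std_normal_distribution (\<lambda>x. h x - h 0)"
    using i1 by (rule Bochner_Integration.integrable_bound) (use meas lip[of _ 0] in auto)
  from Bochner_Integration.integrable_add[OF i2 integrable_const[of "h 0"]]
  show ih: "integrable std_normal_distribution h" by simp
  have "(\<integral>y. h y \<partial>std_normal_distribution) - h 0 = (\<integral>y. h y - h 0 \<partial>std_normal_distribution)"
    using ih prob_space by simp
  also have "\<bar>\<dots>\<bar> \<le> (\<integral>y. \<bar>y\<bar> \<partial>std_normal_distribution)"
    using lip[of _ 0] by (intro integral_abs_bound_integral i2 i1) auto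
  also have "\<dots> = sqrt (2 / pi)"
    using std_normal_distribution_odd_moments_abs[of 0] by simp
  also have "\<dots> \<le> 1" using pi_gt3 by (simp add: real_sqrt_le_1_iff)
  finally show "\<bar>h x - (\<integral>y. h y \<partial>std_normal_distribution)\<bar> \<le> \<bar>x\<bar> + 1"
    using lip[of x 0] by linarith
qed

text \<open>
  The approximation is the average of \<open>h\<close> over \<open>{x..x + e}\<close>. Its derivative is a difference quotient
  of \<open>h\<close>, hence bounded by \<open>1\<close>.
\<close>

lemma smooth_lipschitz_approximation:
  fixes h :: "real \<Rightarrow> real"
  assumes h: "1-lipschitz_on UNIV h" and e: "e > 0"
  obtains s s' where "\<And>x. (s has_real_derivative s' x) (at x)" "\<And>x. \<bar>s' x\<bar> \<le> 1"
    "\<And>x. \<bar>s x - h x\<bar> \<le> e"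
proof -
  have lip: "\<bar>h x - h y\<bar> \<le> \<bar>x - y\<bar>" for x y
    using lipschitz_onD[OF h, of x y] by (simp add: dist_real_def)
  have cont: "continuous_on UNIV h" using h by (rule lipschitz_on_continuous_on)
  define G where "G x = (LBINT y=0..x. h y)" for x :: real
  have dG: "(G has_real_derivative h x) (at x)" for x
  proof -
    define N where "N = \<bar>x\<bar> + 1"
    have "((\<lambda>u. LBINT y=0..u. h y) has_vector_derivative h x) (at x within {-N..N})"
      using interval_integral_FTC2[of "-N" 0 N h x] continuous_on_subset[OF cont]
      by (auto simp: N_def zero_ereal_def)
    moreover have "at x within {-N..N} = at x"
      by (rule at_within_Icc_at) (auto simp: N_def)
    ultimately show ?thesis
      unfolding G_def[abs_def] by (simp add: has_real_derivative_iff_has_vector_derivative)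
  qed
  define s where "s x = (G (x + e) - G x) / e" for x
  have ds: "(s has_real_derivative (h (x + e) - h x) / e) (at x)" for x
  proof -
    have "((\<lambda>x. G (x + e)) has_real_derivative h (x + e) * 1) (at x)"
      by (rule DERIV_chain2[OF dG]) (auto intro!: derivative_eq_intros)
    from DERIV_cdivide[OF DERIV_diff[OF this dG], of e] show ?thesis
      unfolding s_def[abs_def] by simp
  qed
  have "\<bar>(h (x + e) - h x) / e\<bar> \<le> 1" for x
    using lip[of "x + e" x] e by (simp add: abs_divide)
  moreover have "\<bar>s x - h x\<bar> \<le> e" for x
  proof -
    obtain z where z: "x < z" "z < x + e" "G (x + e) - G x = (x + e - x) * h z"
      using MVT2[of x "x + e" G h] dG e by auto
    then have "s x = h z" using e by (simp add: s_def)
    then show ?thesis using lip[of z x] z by simp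
  qed
  ultimately show ?thesis using that[OF ds] by blast
qed

text \<open>
  Write the solution as \<open>f = F / std_normal_density\<close>, where \<open>F\<close> is the integral of
  \<open>(h - c) * std_normal_density\<close> up to \<open>w\<close>. The derivative \<open>k = f'\<close> is \<open>u / std_normal_density\<close> with
  \<open>u' = (f + h') * std_normal_density\<close>. Thus the tail bound for \<open>F\<close> bounds \<open>f\<close>, the tail bound for \<open>u\<close>
  then bounds both \<open>k\<close> and \<open>w * k w\<close>, and \<open>k' = f + w * k + h'\<close> is bounded as well.
\<close>

lemma stein_solution_smooth_lipschitz:
  fixes h h' :: "real \<Rightarrow> real"
  assumes dh: "\<And>x. (h has_real_derivative h' x) (at x)" and h': "\<And>x. \<bar>h' x\<bar> \<le> 1"
  defines "c \<equiv> \<integral>x. h x \<partial>std_normal_distribution"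
  obtains f k where "\<And>w. k w - w * f w = h w - c" "\<And>w. \<bar>k w\<bar> \<le> 8"
    "stein_triple f k (\<lambda>w. 12 * w)"
proof -
  interpret real_distribution std_normal_distribution by (rule real_dist_normal_dist)
  have incr: "\<bar>h x - h y\<bar> \<le> \<bar>x - y\<bar>" for x y
    using field_differentiable_bound[of UNIV h h' 1 x y] dh h'
    by (simp add: DERIV_subset)
  then have lip: "1-lipschitz_on UNIV h"
    by (intro lipschitz_onI) (auto simp: dist_real_def)
  note ih = integrable_std_normal_lipschitz(1)[OF lip]
  have hc: "\<bar>h x - c\<bar> \<le> \<bar>x\<bar> + 1" for x
    unfolding c_def by (rule integrable_std_normal_lipschitz(2)[OF lip])
  define r where "r x = h x - c" for x
  have dr: "(r has_real_derivative h' x) (at x)" for x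
    unfolding r_def[abs_def] using dh by (auto intro!: derivative_eq_intros)
  have meas: "r \<in> borel_measurable lborel"
    using borel_measurable_continuous_onI[OF lipschitz_on_continuous_on[OF lip]]
    by (simp add: r_def[abs_def])
  have ir: "integrable std_normal_distribution r"
    unfolding r_def[abs_def] using ih by simp
  have r0: "(\<integral>x. r x \<partial>std_normal_distribution) = 0"
    unfolding r_def[abs_def] using ih prob_space by (simp add: c_def)
  define q where "q x = r x * std_normal_density x" for x
  have iq: "integrable lborel q"
    using ir meas unfolding q_def[abs_def]
    by (subst (asm) integrable_density) (auto simp: mult.commute)
  have q0: "(\<integral>x. q x \<partial>lborel) = 0"
    using r0 meas unfolding q_def[abs_def]
    by (subst (asm) integral_density) (auto simp: mult.commute)
  have contq: "continuous_on UNIV q"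
    unfolding q_def[abs_def]
    by (intro continuous_on_mult DERIV_continuous_on[OF DERIV_subset[OF dr]]
        DERIV_continuous_on[OF DERIV_subset[OF std_normal_density_deriv]]) auto
  define F where "F w = (\<integral>x. indicator {..w} x * q x \<partial>lborel)" for w
  have dF: "(F has_real_derivative r w * std_normal_density w) (at w)" for w
    using has_derivative_integral_atMost[OF contq iq, of w] unfolding F_def[abs_def] q_def .
  have limF: "(F \<longlongrightarrow> 0) at_top" and limFm: "((\<lambda>w. F (- w)) \<longlongrightarrow> 0) at_top"
    using integral_atMost_tendsto[OF iq] q0 unfolding F_def[abs_def] by simp_all
  have rb: "\<bar>r x\<bar> \<le> \<bar>x\<bar> + 1" for x using hc by (simp add: r_def)
  have "\<bar>F w\<bar> \<le> (2 * 1 / (1 + \<bar>w\<bar>) + 1) * std_normal_density w" for w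
    by (rule gaussian_tail_bound_two_sided[OF dF _ _ _ limF limFm]) (use rb in \<open>simp_all add: add.commute\<close>)
  then have Fb: "\<bar>F w\<bar> \<le> (2 / (1 + \<bar>w\<bar>) + 1) * std_normal_density w" for w by simp
  define f where "f w = F w / std_normal_density w" for w
  have fb: "\<bar>f w\<bar> \<le> 3" for w
  proof -
    have "\<bar>f w\<bar> \<le> 2 / (1 + \<bar>w\<bar>) + 1"
      using Fb[of w] std_normal_density_pos[of w] by (simp add: f_def abs_divide divide_le_eq)
    also have "\<dots> \<le> 3" by (simp add: divide_le_eq)
    finally show ?thesis .
  qed
  define u where "u w = w * F w + r w * std_normal_density w" for w
  have du: "(u has_real_derivative (f w + h' w) * std_normal_density w) (at w)" for w
  proof -
    have "f w * std_normal_density w = F w"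
      using std_normal_density_pos[of w] by (simp add: f_def)
    then show ?thesis
      unfolding u_def[abs_def]
      by (auto intro!: derivative_eq_intros dF dr std_normal_density_deriv simp: algebra_simps)
  qed
  have ubd: "\<bar>u w\<bar> \<le> (2 * \<bar>w\<bar> + 3) * std_normal_density w" for w
  proof -
    have "\<bar>u w\<bar> \<le> \<bar>w\<bar> * \<bar>F w\<bar> + \<bar>r w\<bar> * std_normal_density w"
      unfolding u_def by (rule order.trans[OF abs_triangle_ineq]) (simp add: abs_mult)
    also have "\<dots> \<le> \<bar>w\<bar> * ((2 / (1 + \<bar>w\<bar>) + 1) * std_normal_density w) + (\<bar>w\<bar> + 1) * std_normal_density w"
      using Fb rb by (intro add_mono mult_left_mono mult_right_mono) auto
    also have "\<dots> = (\<bar>w\<bar> * (2 / (1 + \<bar>w\<bar>)) + 2 * \<bar>w\<bar> + 1) * std_normal_density w"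
      by (simp add: algebra_simps)
    also have "\<dots> \<le> (2 * \<bar>w\<bar> + 3) * std_normal_density w"
    proof (intro mult_right_mono)
      have "\<bar>w\<bar> * (2 / (1 + \<bar>w\<bar>)) \<le> 2" by (simp add: divide_le_eq)
      then show "\<bar>w\<bar> * (2 / (1 + \<bar>w\<bar>)) + 2 * \<bar>w\<bar> + 1 \<le> 2 * \<bar>w\<bar> + 3" by simp
    qed auto
    finally show ?thesis .
  qed
  have lim: "((\<lambda>w. (2 * w + 3) * std_normal_density w) \<longlongrightarrow> 0) at_top"
    using tendsto_add[OF tendsto_mult[OF tendsto_const mult_std_normal_density_tendsto, of 2]
        tendsto_mult[OF tendsto_const std_normal_density_tendsto, of 3]]
    by (simp add: algebra_simps)
  have limu: "(u \<longlongrightarrow> 0) at_top" "((\<lambda>w. u (- w)) \<longlongrightarrow> 0) at_top"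
  proof -
    have "\<forall>\<^sub>F w in at_top. norm (u w) \<le> (2 * w + 3) * std_normal_density w"
      using eventually_ge_at_top[of 0]
    proof eventually_elim
      case (elim w) with ubd[of w] show ?case by simp
    qed
    from Lim_null_comparison[OF this lim] show "(u \<longlongrightarrow> 0) at_top" .
    have "\<forall>\<^sub>F w in at_top. norm (u (- w)) \<le> (2 * w + 3) * std_normal_density w"
      using eventually_ge_at_top[of 0]
    proof eventually_elim
      case (elim w) with ubd[of "-w"] show ?case by (simp add: std_normal_density_even)
    qed
    from Lim_null_comparison[OF this lim] show "((\<lambda>w. u (- w)) \<longlongrightarrow> 0) at_top" .
  qed
  have fh: "\<bar>f w + h' w\<bar> \<le> 4" for w using fb[of w] h'[of w] by linarith
  have "\<bar>u w\<bar> \<le> (2 * 4 / (1 + \<bar>w\<bar>) + 0) * std_normal_density w" for w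
    by (rule gaussian_tail_bound_two_sided[OF du _ _ _ limu]) (use fh in simp_all)
  then have ub: "\<bar>u w\<bar> \<le> 8 / (1 + \<bar>w\<bar>) * std_normal_density w" for w by simp
  define k where "k w = w * f w + r w" for w
  have ku: "k w = u w / std_normal_density w" for w
    using std_normal_density_pos[of w] by (simp add: k_def u_def f_def field_simps)
  have kb: "\<bar>k w\<bar> \<le> 8 / (1 + \<bar>w\<bar>)" for w
    using ub[of w] std_normal_density_pos[of w] by (simp add: ku abs_divide divide_le_eq)
  have kb8: "\<bar>k w\<bar> \<le> 8" for w
  proof -
    have "8 / (1 + \<bar>w\<bar>) \<le> 8" by (simp add: divide_le_eq)
    with kb[of w] show ?thesis by linarith
  qed
  have wk: "\<bar>w * k w\<bar> \<le> 8" for w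
  proof -
    have "\<bar>w * k w\<bar> \<le> \<bar>w\<bar> * (8 / (1 + \<bar>w\<bar>))"
      unfolding abs_mult using kb[of w] by (intro mult_left_mono) auto
    also have "\<dots> \<le> 8" by (simp add: divide_le_eq)
    finally show ?thesis .
  qed
  have df: "(f has_real_derivative k w) (at w)" for w
    unfolding f_def[abs_def] k_def using std_normal_density_pos[of w]
    by (auto intro!: derivative_eq_intros dF std_normal_density_deriv simp: field_simps f_def power2_eq_square)
  have dk: "(k has_real_derivative f w + w * k w + h' w) (at w)" for w
    unfolding k_def[abs_def] using df
    by (auto intro!: derivative_eq_intros dr simp: k_def)
  have kl: "\<bar>k x - k y\<bar> \<le> 12 * \<bar>x - y\<bar>" for x y
  proof -
    have "\<bar>f w + w * k w + h' w\<bar> \<le> 12" for w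
      using fb[of w] wk[of w] h'[of w] by linarith
    then show ?thesis
      using field_differentiable_bound[of UNIV k "\<lambda>w. f w + w * k w + h' w" 12 x y] dk
      by (simp add: DERIV_subset)
  qed
  have "stein_triple f k (\<lambda>w. 12 * w)"
    unfolding stein_triple_def
  proof (intro allI impI ballI)
    fix a b c :: real assume ab: "a \<le> b" and c: "c \<in> {a, b}"
    show "\<bar>f b - f a - (b - a) * k c\<bar> \<le> (b - a) * (12 * b - 12 * a)"
    proof (cases "a = b")
      case False
      with ab have "a < b" by simp
      from MVT2[OF this, of f k] df obtain z where z: "a < z" "z < b" "f b - f a = (b - a) * k z" by auto
      then have "\<bar>f b - f a - (b - a) * k c\<bar> = (b - a) * \<bar>k z - k c\<bar>"
        using ab by (simp add: abs_mult flip: right_diff_distrib)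
      also have "\<dots> \<le> (b - a) * (12 * \<bar>z - c\<bar>)"
        using kl ab by (intro mult_left_mono) auto
      also have "\<dots> \<le> (b - a) * (12 * b - 12 * a)"
        using z c ab by (intro mult_left_mono) auto
      finally show ?thesis .
    qed simp
  qed
  moreover have "k w - w * f w = h w - c" for w by (simp add: k_def r_def)
  ultimately show ?thesis using that kb8 by blast
qed

section \<open>Functionals of independent Bernoulli variables\<close>

lemma discriminant_of_nonneg_form:
  fixes a b c :: real
  assumes q: "\<And>s t. 0 \<le> s\<^sup>2 * a - 2 * s * t * b + t\<^sup>2 * c"
  shows "b\<^sup>2 \<le> a * c"
proof -
  have a: "0 \<le> a" and c: "0 \<le> c" using q[of 1 0] q[of 0 1] by simp_all
  show ?thesis
  proof (cases "c = 0")
    case True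
    have "b = 0"
    proof (rule ccontr)
      assume "b \<noteq> 0"
      with True q[of 1 "(a + 1) / b"] have "0 \<le> a - 2 * (a + 1)" by simp
      with a show False by simp
    qed
    with True show ?thesis by simp
  next
    case False
    with c have "c > 0" by simp
    have "0 \<le> c * (a * c - b\<^sup>2)"
      using q[of c b] by (simp add: power2_eq_square algebra_simps)
    then show ?thesis using \<open>c > 0\<close> by (simp add: zero_le_mult_iff)
  qed
qed

locale bernoulli_field =
  fixes B :: "'b set" and p :: "'b \<Rightarrow> real"
  assumes finite_sites: "finite B"
    and p_pos: "e \<in> B \<Longrightarrow> 0 < p e" and p_less_1: "e \<in> B \<Longrightarrow> p e < 1"
begin

definition field_pmf :: "('b \<Rightarrow> bool) pmf" where
  "field_pmf = Pi_pmf B False (\<lambda>e. bernoulli_pmf (p e))"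

abbreviation E :: "(('b \<Rightarrow> bool) \<Rightarrow> real) \<Rightarrow> real" where
  "E f \<equiv> measure_pmf.expectation field_pmf f"

definition centred :: "'b \<Rightarrow> ('b \<Rightarrow> bool) \<Rightarrow> real" where
  "centred e \<omega> = of_bool (\<omega> e) - p e"

definition all_on :: "'b set \<Rightarrow> ('b \<Rightarrow> bool) \<Rightarrow> real" where
  "all_on A \<omega> = of_bool (\<forall>a\<in>A. \<omega> a)"

abbreviation P :: "'b set \<Rightarrow> real" where
  "P A \<equiv> prod p A"

lemma finite_support: "finite (set_pmf field_pmf)"
proof -
  have "set_pmf field_pmf \<subseteq> PiE_dflt B False (\<lambda>_. UNIV)"
    unfolding field_pmf_def using set_Pi_pmf_subset'[OF finite_sites]
    by (rule order.trans) (auto simp: PiE_dflt_def)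
  then show ?thesis by (rule finite_subset) (auto intro!: finite_PiE_dflt finite_sites)
qed

lemma integrable_field [simp, intro]: "integrable (measure_pmf field_pmf) (f :: _ \<Rightarrow> real)"
  by (rule integrable_measure_pmf_finite[OF finite_support])

lemma E_mono: "(\<And>\<omega>. f \<omega> \<le> g \<omega>) \<Longrightarrow> E f \<le> E g"
  by (intro integral_mono) auto

lemma E_nonneg: "(\<And>\<omega>. 0 \<le> f \<omega>) \<Longrightarrow> 0 \<le> E f"
  by (intro integral_nonneg_AE) auto

lemma E_sum: "E (\<lambda>\<omega>. \<Sum>i\<in>I. f i \<omega>) = (\<Sum>i\<in>I. E (f i))"
  by (rule Bochner_Integration.integral_sum) auto

lemma abs_E_le: "\<bar>E f\<bar> \<le> E (\<lambda>\<omega>. \<bar>f \<omega>\<bar>)"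
  by (rule integral_abs_bound)

lemma E_Cauchy_Schwarz: "(E (\<lambda>\<omega>. f \<omega> * g \<omega>))\<^sup>2 \<le> E (\<lambda>\<omega>. (f \<omega>)\<^sup>2) * E (\<lambda>\<omega>. (g \<omega>)\<^sup>2)"
proof -
  let ?a = "E (\<lambda>\<omega>. (f \<omega>)\<^sup>2)" and ?b = "E (\<lambda>\<omega>. f \<omega> * g \<omega>)" and ?c = "E (\<lambda>\<omega>. (g \<omega>)\<^sup>2)"
  have q: "0 \<le> s\<^sup>2 * ?a - 2 * s * t * ?b + t\<^sup>2 * ?c" for s t
  proof -
    have "0 \<le> E (\<lambda>\<omega>. (s * f \<omega> - t * g \<omega>)\<^sup>2)" by (rule E_nonneg) simp
    also have "\<dots> = E (\<lambda>\<omega>. s\<^sup>2 * (f \<omega>)\<^sup>2 - 2 * s * t * (f \<omega> * g \<omega>) + t\<^sup>2 * (g \<omega>)\<^sup>2)"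
      by (intro Bochner_Integration.integral_cong) (auto simp: power2_eq_square algebra_simps)
    also have "\<dots> = s\<^sup>2 * ?a - 2 * s * t * ?b + t\<^sup>2 * ?c" by simp
    finally show ?thesis .
  qed
  show ?thesis by (rule discriminant_of_nonneg_form[OF q])
qed

lemma E_abs_mult_le: "\<bar>E (\<lambda>\<omega>. f \<omega> * g \<omega>)\<bar> \<le> sqrt (E (\<lambda>\<omega>. (f \<omega>)\<^sup>2)) * sqrt (E (\<lambda>\<omega>. (g \<omega>)\<^sup>2))"
  using real_sqrt_le_mono[OF E_Cauchy_Schwarz[of f g]] by (simp add: real_sqrt_mult)

lemma E_abs_le_sqrt: "E (\<lambda>\<omega>. \<bar>f \<omega>\<bar>) \<le> sqrt (E (\<lambda>\<omega>. (f \<omega>)\<^sup>2))"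
  using E_abs_mult_le[of "\<lambda>\<omega>. \<bar>f \<omega>\<bar>" "\<lambda>_. 1"] by simp

lemma E_split:
  assumes e: "e \<in> B"
  shows "E f = p e * E (\<lambda>\<omega>. f (fun_upd \<omega> e True)) + (1 - p e) * E (\<lambda>\<omega>. f (fun_upd \<omega> e False))"
proof -
  define R where "R = Pi_pmf (B - {e}) False (\<lambda>e. bernoulli_pmf (p e))"
  have pe: "0 \<le> p e" "p e \<le> 1" using p_pos[OF e] p_less_1[OF e] by auto
  have fin: "finite (set_pmf R)"
  proof -
    have "set_pmf R \<subseteq> PiE_dflt (B - {e}) False (\<lambda>_. UNIV)"
      unfolding R_def using set_Pi_pmf_subset'[of "B - {e}"] finite_sites
      by (intro order.trans[OF set_Pi_pmf_subset']) (auto simp: PiE_dflt_def)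
    then show ?thesis by (rule finite_subset) (auto intro!: finite_PiE_dflt finite_sites)
  qed
  have split: "E g = p e * measure_pmf.expectation R (\<lambda>\<omega>. g (fun_upd \<omega> e True))
      + (1 - p e) * measure_pmf.expectation R (\<lambda>\<omega>. g (fun_upd \<omega> e False))" for g :: "_ \<Rightarrow> real"
  proof -
    have "field_pmf = do {y \<leftarrow> bernoulli_pmf (p e); \<omega> \<leftarrow> R; return_pmf (fun_upd \<omega> e y)}"
      unfolding field_pmf_def R_def using Pi_pmf_insert'[of "B - {e}" e] finite_sites e
      by (simp add: insert_absorb)
    also have "\<dots> = bernoulli_pmf (p e) \<bind> (\<lambda>y. map_pmf (\<lambda>\<omega>. fun_upd \<omega> e y) R)"
      by (simp add: map_pmf_def)
    finally have "E g = measure_pmf.expectation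
        (bernoulli_pmf (p e) \<bind> (\<lambda>y. map_pmf (\<lambda>\<omega>. fun_upd \<omega> e y) R)) g" by simp
    also have "\<dots> = (\<Sum>y\<in>UNIV. pmf (bernoulli_pmf (p e)) y *\<^sub>R
        measure_pmf.expectation (map_pmf (\<lambda>\<omega>. fun_upd \<omega> e y) R) g)"
      by (rule pmf_expectation_bind) (use fin in auto)
    finally show ?thesis using pe by (simp add: UNIV_bool)
  qed
  show ?thesis using pe
    by (subst (1 2 3) split) (simp add: algebra_simps)
qed

text \<open>
  Integration by parts with respect to one Bernoulli variable. It is used in both directions: to
  produce differences of \<open>f\<close>, and to reassemble differences into an expectation.
\<close>

lemma E_centred_mult:
  assumes e: "e \<in> B" and G: "\<And>\<omega> b. G (fun_upd \<omega> e b) = G \<omega>"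
  shows "E (\<lambda>\<omega>. centred e \<omega> * G \<omega> * f \<omega>)
    = p e * (1 - p e) * E (\<lambda>\<omega>. G \<omega> * (f (fun_upd \<omega> e True) - f (fun_upd \<omega> e False)))"
proof -
  have split: "E (\<lambda>\<omega>. centred e \<omega> * G \<omega> * f \<omega>)
    = p e * E (\<lambda>\<omega>. (1 - p e) * (G \<omega> * f (fun_upd \<omega> e True)))
      + (1 - p e) * E (\<lambda>\<omega>. - p e * (G \<omega> * f (fun_upd \<omega> e False)))"
    by (subst E_split[OF e]) (simp add: centred_def G mult.assoc)
  have *: "E (\<lambda>\<omega>. G \<omega> * (f (fun_upd \<omega> e True) - f (fun_upd \<omega> e False)))
    = E (\<lambda>\<omega>. G \<omega> * f (fun_upd \<omega> e True)) - E (\<lambda>\<omega>. G \<omega> * f (fun_upd \<omega> e False))"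
    by (simp add: right_diff_distrib)
  show ?thesis
    unfolding split * integral_mult_right_zero by (simp add: algebra_simps)
qed

lemma E_centred_mult_0:
  assumes e: "e \<in> B" and G: "\<And>\<omega> b. G (fun_upd \<omega> e b) = G \<omega>"
  shows "E (\<lambda>\<omega>. centred e \<omega> * G \<omega>) = 0"
  using E_centred_mult[of e G "\<lambda>_. 1", OF assms] by simp

lemma E_prod:
  assumes "A \<subseteq> B"
  shows "E (\<lambda>\<omega>. \<Prod>a\<in>A. g a (\<omega> a)) = (\<Prod>a\<in>A. p a * g a True + (1 - p a) * g a False)"
proof -
  have "finite A" using assms finite_sites finite_subset by blast
  then show ?thesis using assms
  proof (induction A rule: finite_induct)
    case (insert e A)
    have *: "(\<Prod>a\<in>insert e A. g a (fun_upd \<omega> e b a)) = g e b * (\<Prod>a\<in>A. g a (\<omega> a))" for \<omega> b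
    proof -
      have "(\<Prod>a\<in>A. g a (fun_upd \<omega> e b a)) = (\<Prod>a\<in>A. g a (\<omega> a))"
        using insert.hyps by (intro prod.cong) auto
      then show ?thesis using insert.hyps by simp
    qed
    have e: "e \<in> B" using insert.prems by simp
    have "E (\<lambda>\<omega>. \<Prod>a\<in>insert e A. g a (\<omega> a)) =
        (p e * g e True + (1 - p e) * g e False) * E (\<lambda>\<omega>. \<Prod>a\<in>A. g a (\<omega> a))"
      unfolding E_split[OF e, of "\<lambda>\<omega>. \<Prod>a\<in>insert e A. g a (\<omega> a)"] *
      by (simp add: algebra_simps)
    with insert show ?case by simp
  qed simp
qed

lemma all_on_eq_prod: "finite A \<Longrightarrow> all_on A \<omega> = (\<Prod>a\<in>A. of_bool (\<omega> a))"
  by (induction A rule: finite_induct) (auto simp: all_on_def)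

lemma E_all_on: "A \<subseteq> B \<Longrightarrow> E (all_on A) = P A"
  using E_prod[of A "\<lambda>_ b. of_bool b"] all_on_eq_prod[OF finite_subset[OF _ finite_sites, of A]]
  by (simp cong: Bochner_Integration.integral_cong)

lemma all_on_Un: "all_on (A \<union> A') \<omega> = all_on A \<omega> * all_on A' \<omega>"
  by (auto simp: all_on_def)

lemma all_on_upd: "e \<notin> A \<Longrightarrow> all_on A (fun_upd \<omega> e b) = all_on A \<omega>"
  by (auto simp: all_on_def)

lemma all_on_nonneg: "0 \<le> all_on A \<omega>"
  by (simp add: all_on_def)

end

text \<open>
  A representation of \<open>W\<close> as a sum of centred variables with coefficients \<open>U e\<close> that ignore the
  variable at \<open>e\<close>. Nonnegativity of \<open>U\<close> and monotonicity of \<open>W\<close> keep all weights \<open>U e * V e\<close> in the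
  error estimates nonnegative.
\<close>

locale clark_ocone = bernoulli_field B p for B :: "'b set" and p :: "'b \<Rightarrow> real" +
  fixes W :: "('b \<Rightarrow> bool) \<Rightarrow> real" and U :: "'b \<Rightarrow> ('b \<Rightarrow> bool) \<Rightarrow> real"
  assumes W_eq: "W \<omega> = (\<Sum>e\<in>B. centred e \<omega> * U e \<omega>)"
    and U_upd: "e \<in> B \<Longrightarrow> U e (fun_upd \<omega> e b) = U e \<omega>"
    and U_nonneg: "e \<in> B \<Longrightarrow> 0 \<le> U e \<omega>"
    and W_mono: "e \<in> B \<Longrightarrow> W (fun_upd \<omega> e False) \<le> W (fun_upd \<omega> e True)"
begin

definition V :: "'b \<Rightarrow> ('b \<Rightarrow> bool) \<Rightarrow> real" where
  "V e \<omega> = W (fun_upd \<omega> e True) - W (fun_upd \<omega> e False)"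

definition T :: "('b \<Rightarrow> bool) \<Rightarrow> real" where
  "T \<omega> = (\<Sum>e\<in>B. p e * (1 - p e) * (U e \<omega> * V e \<omega>))"

definition S :: "('b \<Rightarrow> bool) \<Rightarrow> real" where
  "S \<omega> = (\<Sum>e\<in>B. centred e \<omega> * (U e \<omega> * V e \<omega>))"

lemma V_upd: "V e (fun_upd \<omega> e b) = V e \<omega>"
  by (simp add: V_def)

lemma E_W_mult:
  "E (\<lambda>\<omega>. W \<omega> * f \<omega>) =
     (\<Sum>e\<in>B. p e * (1 - p e) * E (\<lambda>\<omega>. U e \<omega> * (f (fun_upd \<omega> e True) - f (fun_upd \<omega> e False))))"
proof -
  have "E (\<lambda>\<omega>. W \<omega> * f \<omega>) = E (\<lambda>\<omega>. \<Sum>e\<in>B. centred e \<omega> * U e \<omega> * f \<omega>)"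
    by (simp add: W_eq sum_distrib_right)
  also have "\<dots> = (\<Sum>e\<in>B. E (\<lambda>\<omega>. centred e \<omega> * U e \<omega> * f \<omega>))" by (rule E_sum)
  also have "\<dots> = (\<Sum>e\<in>B. p e * (1 - p e) * E (\<lambda>\<omega>. U e \<omega> * (f (fun_upd \<omega> e True) - f (fun_upd \<omega> e False))))"
    by (intro sum.cong refl E_centred_mult U_upd)
  finally show ?thesis .
qed

lemma E_S_mult:
  "E (\<lambda>\<omega>. S \<omega> * f \<omega>) =
     (\<Sum>e\<in>B. p e * (1 - p e) * E (\<lambda>\<omega>. U e \<omega> * V e \<omega> * (f (fun_upd \<omega> e True) - f (fun_upd \<omega> e False))))"
proof -
  have "E (\<lambda>\<omega>. S \<omega> * f \<omega>) = E (\<lambda>\<omega>. \<Sum>e\<in>B. centred e \<omega> * (U e \<omega> * V e \<omega>) * f \<omega>)"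
    by (simp add: S_def sum_distrib_right)
  also have "\<dots> = (\<Sum>e\<in>B. E (\<lambda>\<omega>. centred e \<omega> * (U e \<omega> * V e \<omega>) * f \<omega>))" by (rule E_sum)
  also have "\<dots> = (\<Sum>e\<in>B. p e * (1 - p e) * E (\<lambda>\<omega>. U e \<omega> * V e \<omega> * (f (fun_upd \<omega> e True) - f (fun_upd \<omega> e False))))"
    by (intro sum.cong refl E_centred_mult) (simp_all only: U_upd V_upd)
  finally show ?thesis .
qed

lemma E_T_mult: "E (\<lambda>\<omega>. T \<omega> * f \<omega>) = (\<Sum>e\<in>B. p e * (1 - p e) * E (\<lambda>\<omega>. U e \<omega> * V e \<omega> * f \<omega>))"
proof -
  have "E (\<lambda>\<omega>. T \<omega> * f \<omega>) = E (\<lambda>\<omega>. \<Sum>e\<in>B. p e * (1 - p e) * (U e \<omega> * V e \<omega> * f \<omega>))"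
    by (simp add: T_def sum_distrib_right mult.assoc)
  also have "\<dots> = (\<Sum>e\<in>B. E (\<lambda>\<omega>. p e * (1 - p e) * (U e \<omega> * V e \<omega> * f \<omega>)))" by (rule E_sum)
  finally show ?thesis by simp
qed

lemma E_T: "E T = E (\<lambda>\<omega>. (W \<omega>)\<^sup>2)"
  using E_T_mult[of "\<lambda>_. 1"] E_W_mult[of W] by (simp add: V_def power2_eq_square)

text \<open>
  Integration by parts turns \<open>E (W * f W)\<close> into \<open>E (T * k W)\<close> with an error bounded by increments of \<open>l\<close>
  weighted with \<open>p e * (1 - p e) * U e * V e\<close>. Since these weights are nonnegative, integrating by
  parts backwards turns the error into \<open>E (S * l W)\<close>.
\<close>

lemma stein_error_bound:
  assumes st: "stein_triple f k l" and k: "\<And>w. \<bar>k w\<bar> \<le> C"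
  shows "\<bar>E (\<lambda>\<omega>. k (W \<omega>) - W \<omega> * f (W \<omega>))\<bar>
    \<le> C * E (\<lambda>\<omega>. \<bar>1 - T \<omega>\<bar>) + \<bar>E (\<lambda>\<omega>. S \<omega> * l (W \<omega>))\<bar>"
proof -
  have loc: "\<bar>f (W (fun_upd \<omega> e True)) - f (W (fun_upd \<omega> e False)) - V e \<omega> * k (W \<omega>)\<bar>
      \<le> V e \<omega> * (l (W (fun_upd \<omega> e True)) - l (W (fun_upd \<omega> e False)))" if "e \<in> B" for e \<omega>
  proof -
    have "\<omega> = fun_upd \<omega> e True \<or> \<omega> = fun_upd \<omega> e False" by (cases "\<omega> e") (auto simp: fun_eq_iff)
    then have "W \<omega> \<in> {W (fun_upd \<omega> e False), W (fun_upd \<omega> e True)}" by auto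
    with st W_mono[OF that, of \<omega>] show ?thesis unfolding stein_triple_def V_def by blast
  qed
  have "\<bar>E (\<lambda>\<omega>. W \<omega> * f (W \<omega>)) - E (\<lambda>\<omega>. T \<omega> * k (W \<omega>))\<bar>
    = \<bar>\<Sum>e\<in>B. p e * (1 - p e) * E (\<lambda>\<omega>. U e \<omega> *
        (f (W (fun_upd \<omega> e True)) - f (W (fun_upd \<omega> e False)) - V e \<omega> * k (W \<omega>)))\<bar>"
    unfolding E_W_mult E_T_mult sum_subtractf[symmetric]
    by (intro arg_cong[where f = abs] sum.cong refl) (simp add: algebra_simps)
  also have "\<dots> \<le> (\<Sum>e\<in>B. p e * (1 - p e) * E (\<lambda>\<omega>. U e \<omega> * V e \<omega> *
        (l (W (fun_upd \<omega> e True)) - l (W (fun_upd \<omega> e False)))))"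
  proof (rule order.trans[OF sum_abs], intro sum_mono)
    fix e assume e: "e \<in> B"
    let ?D = "\<lambda>\<omega>. f (W (fun_upd \<omega> e True)) - f (W (fun_upd \<omega> e False)) - V e \<omega> * k (W \<omega>)"
    have "\<bar>E (\<lambda>\<omega>. U e \<omega> * ?D \<omega>)\<bar> \<le> E (\<lambda>\<omega>. \<bar>U e \<omega> * ?D \<omega>\<bar>)" by (rule abs_E_le)
    also have "\<dots> \<le> E (\<lambda>\<omega>. U e \<omega> * V e \<omega> * (l (W (fun_upd \<omega> e True)) - l (W (fun_upd \<omega> e False))))"
      using loc[OF e] U_nonneg[OF e]
      by (intro E_mono) (auto simp: abs_mult mult.assoc intro!: mult_left_mono)
    finally show "\<bar>p e * (1 - p e) * E (\<lambda>\<omega>. U e \<omega> * ?D \<omega>)\<bar> \<le> p e * (1 - p e) *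
        E (\<lambda>\<omega>. U e \<omega> * V e \<omega> * (l (W (fun_upd \<omega> e True)) - l (W (fun_upd \<omega> e False))))"
      using p_pos[OF e] p_less_1[OF e] by (simp add: abs_mult)
  qed
  also have "\<dots> = E (\<lambda>\<omega>. S \<omega> * l (W \<omega>))" by (rule E_S_mult[symmetric])
  finally have A: "\<bar>E (\<lambda>\<omega>. W \<omega> * f (W \<omega>)) - E (\<lambda>\<omega>. T \<omega> * k (W \<omega>))\<bar> \<le> \<bar>E (\<lambda>\<omega>. S \<omega> * l (W \<omega>))\<bar>"
    by simp
  have "\<bar>E (\<lambda>\<omega>. (1 - T \<omega>) * k (W \<omega>))\<bar> \<le> E (\<lambda>\<omega>. \<bar>(1 - T \<omega>) * k (W \<omega>)\<bar>)" by (rule abs_E_le)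
  also have "\<dots> \<le> E (\<lambda>\<omega>. C * \<bar>1 - T \<omega>\<bar>)"
    using k by (intro E_mono) (simp add: abs_mult mult.commute[of C] mult_left_mono)
  finally have "\<bar>E (\<lambda>\<omega>. (1 - T \<omega>) * k (W \<omega>))\<bar> \<le> C * E (\<lambda>\<omega>. \<bar>1 - T \<omega>\<bar>)" by simp
  moreover have "E (\<lambda>\<omega>. k (W \<omega>) - W \<omega> * f (W \<omega>)) = E (\<lambda>\<omega>. (1 - T \<omega>) * k (W \<omega>))
      - (E (\<lambda>\<omega>. W \<omega> * f (W \<omega>)) - E (\<lambda>\<omega>. T \<omega> * k (W \<omega>)))"
    by (simp add: algebra_simps)
  ultimately show ?thesis using A by linarith
qed

lemma E_abs_1_minus_T:
  "E (\<lambda>\<omega>. \<bar>1 - T \<omega>\<bar>) \<le> \<bar>1 - E (\<lambda>\<omega>. (W \<omega>)\<^sup>2)\<bar> + sqrt (E (\<lambda>\<omega>. (T \<omega> - E T)\<^sup>2))"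
proof -
  have "E (\<lambda>\<omega>. \<bar>1 - T \<omega>\<bar>) \<le> E (\<lambda>\<omega>. \<bar>1 - E T\<bar> + \<bar>T \<omega> - E T\<bar>)"
    by (intro E_mono) linarith
  also have "\<dots> = \<bar>1 - E T\<bar> + E (\<lambda>\<omega>. \<bar>T \<omega> - E T\<bar>)" by simp
  finally show ?thesis using E_abs_le_sqrt[of "\<lambda>\<omega>. T \<omega> - E T"] E_T by simp
qed

lemma kolmogorov_bound:
  "\<bar>measure_pmf.prob field_pmf {\<omega>. W \<omega> \<le> x} - normal_cdf x\<bar> \<le>
     3 * (\<bar>1 - E (\<lambda>\<omega>. (W \<omega>)\<^sup>2)\<bar> + sqrt (E (\<lambda>\<omega>. (T \<omega> - E T)\<^sup>2)) + sqrt (E (\<lambda>\<omega>. (S \<omega>)\<^sup>2)))"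
proof -
  obtain f k l where st: "\<And>w. k w - w * f w = of_bool (w \<le> x) - normal_cdf x"
    "\<And>w. \<bar>k w\<bar> \<le> 3" "\<And>w. \<bar>l w\<bar> \<le> 3" "stein_triple f k l"
    using stein_solution_halfline[of x] by metis
  have "E (\<lambda>\<omega>. of_bool (W \<omega> \<le> x)) = E (indicator {\<omega>. W \<omega> \<le> x})"
    by (intro Bochner_Integration.integral_cong) (auto simp: indicator_def)
  then have "E (\<lambda>\<omega>. k (W \<omega>) - W \<omega> * f (W \<omega>)) = measure_pmf.prob field_pmf {\<omega>. W \<omega> \<le> x} - normal_cdf x"
    unfolding st(1) by simp
  moreover have "\<bar>E (\<lambda>\<omega>. S \<omega> * l (W \<omega>))\<bar> \<le> 3 * sqrt (E (\<lambda>\<omega>. (S \<omega>)\<^sup>2))"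
  proof -
    have "\<bar>E (\<lambda>\<omega>. S \<omega> * l (W \<omega>))\<bar> \<le> E (\<lambda>\<omega>. \<bar>S \<omega> * l (W \<omega>)\<bar>)" by (rule abs_E_le)
    also have "\<dots> \<le> E (\<lambda>\<omega>. 3 * \<bar>S \<omega>\<bar>)"
      using st(3) by (intro E_mono) (simp add: abs_mult mult.commute[of 3] mult_left_mono)
    finally show ?thesis using E_abs_le_sqrt[of S] by simp
  qed
  ultimately show ?thesis
    using stein_error_bound[OF st(4,2)] E_abs_1_minus_T by simp
qed

text \<open>
  Here \<open>l w = 12 * w\<close>, so the error term is \<open>12 * E (S * W)\<close>, which Cauchy-Schwarz bounds in terms of
  the second moment of \<open>S\<close>.
\<close>

lemma wasserstein_bound:
  assumes h: "1-lipschitz_on UNIV h" and W2: "E (\<lambda>\<omega>. (W \<omega>)\<^sup>2) \<le> 1"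
  shows "\<bar>E (\<lambda>\<omega>. h (W \<omega>)) - (\<integral>x. h x \<partial>std_normal_distribution)\<bar> \<le>
     12 * (\<bar>1 - E (\<lambda>\<omega>. (W \<omega>)\<^sup>2)\<bar> + sqrt (E (\<lambda>\<omega>. (T \<omega> - E T)\<^sup>2)) + sqrt (E (\<lambda>\<omega>. (S \<omega>)\<^sup>2)))"
    (is "_ \<le> ?R")
proof (rule field_le_epsilon)
  fix e :: real assume "e > 0"
  then obtain s s' where s: "\<And>x. (s has_real_derivative s' x) (at x)" "\<And>x. \<bar>s' x\<bar> \<le> 1"
    "\<And>x. \<bar>s x - h x\<bar> \<le> e / 2" using smooth_lipschitz_approximation[OF h, of "e / 2"] by auto
  interpret N: real_distribution std_normal_distribution by (rule real_dist_normal_dist)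
  have slip: "1-lipschitz_on UNIV s"
    using field_differentiable_bound[of UNIV s s' 1] s
    by (intro lipschitz_onI) (auto simp: dist_real_def DERIV_subset)
  note i_s = integrable_std_normal_lipschitz(1)[OF slip]
  note ih = integrable_std_normal_lipschitz(1)[OF h]
  obtain f k where st: "\<And>w. k w - w * f w = s w - (\<integral>x. s x \<partial>std_normal_distribution)"
    "\<And>w. \<bar>k w\<bar> \<le> 8" "stein_triple f k (\<lambda>w. 12 * w)"
    using stein_solution_smooth_lipschitz[OF s(1,2)] by metis
  have "E (\<lambda>\<omega>. k (W \<omega>) - W \<omega> * f (W \<omega>)) = E (\<lambda>\<omega>. s (W \<omega>)) - (\<integral>x. s x \<partial>std_normal_distribution)"
    unfolding st(1) by simp
  moreover have "\<bar>E (\<lambda>\<omega>. S \<omega> * (12 * W \<omega>))\<bar> \<le> 12 * sqrt (E (\<lambda>\<omega>. (S \<omega>)\<^sup>2))"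
  proof -
    have "E (\<lambda>\<omega>. S \<omega> * (12 * W \<omega>)) = 12 * E (\<lambda>\<omega>. S \<omega> * W \<omega>)"
      by (simp flip: Bochner_Integration.integral_mult_right_zero add: mult_ac)
    moreover have "\<bar>E (\<lambda>\<omega>. S \<omega> * W \<omega>)\<bar> \<le> sqrt (E (\<lambda>\<omega>. (S \<omega>)\<^sup>2)) * sqrt (E (\<lambda>\<omega>. (W \<omega>)\<^sup>2))"
      by (rule E_abs_mult_le)
    moreover have "\<dots> \<le> sqrt (E (\<lambda>\<omega>. (S \<omega>)\<^sup>2)) * 1"
      using W2 by (intro mult_left_mono) (auto intro!: E_nonneg)
    ultimately show ?thesis by (simp add: abs_mult)
  qed
  ultimately have "\<bar>E (\<lambda>\<omega>. s (W \<omega>)) - (\<integral>x. s x \<partial>std_normal_distribution)\<bar>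
      \<le> 8 * E (\<lambda>\<omega>. \<bar>1 - T \<omega>\<bar>) + 12 * sqrt (E (\<lambda>\<omega>. (S \<omega>)\<^sup>2))"
    using stein_error_bound[OF st(3,2)] by simp
  also have "\<dots> \<le> 12 * E (\<lambda>\<omega>. \<bar>1 - T \<omega>\<bar>) + 12 * sqrt (E (\<lambda>\<omega>. (S \<omega>)\<^sup>2))"
    by (intro add_right_mono mult_right_mono E_nonneg) auto
  also have "\<dots> \<le> ?R"
    using E_abs_1_minus_T by simp
  finally have 1: "\<bar>E (\<lambda>\<omega>. s (W \<omega>)) - (\<integral>x. s x \<partial>std_normal_distribution)\<bar> \<le> ?R" .
  have "\<bar>E (\<lambda>\<omega>. h (W \<omega>)) - E (\<lambda>\<omega>. s (W \<omega>))\<bar> = \<bar>E (\<lambda>\<omega>. h (W \<omega>) - s (W \<omega>))\<bar>" by simp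
  also have "\<dots> \<le> E (\<lambda>\<omega>. \<bar>h (W \<omega>) - s (W \<omega>)\<bar>)" by (rule abs_E_le)
  also have "\<dots> \<le> E (\<lambda>\<omega>. e / 2)" using s(3) by (intro E_mono) (simp add: abs_minus_commute)
  finally have 2: "\<bar>E (\<lambda>\<omega>. h (W \<omega>)) - E (\<lambda>\<omega>. s (W \<omega>))\<bar> \<le> e / 2" by simp
  have "\<bar>(\<integral>x. s x \<partial>std_normal_distribution) - (\<integral>x. h x \<partial>std_normal_distribution)\<bar> =
      \<bar>\<integral>x. s x - h x \<partial>std_normal_distribution\<bar>"
    using i_s ih by simp
  also have "\<dots> \<le> (\<integral>x. e / 2 \<partial>std_normal_distribution)"
    using i_s ih s(3) by (intro integral_abs_bound_integral) auto
  also have "\<dots> = e / 2" using N.prob_space by simp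
  finally show "\<bar>E (\<lambda>\<omega>. h (W \<omega>)) - (\<integral>x. h x \<partial>std_normal_distribution)\<bar> \<le> ?R + e"
    using 1 2 by linarith
qed

end

section \<open>Sums of products of Bernoulli variables\<close>

context bernoulli_field
begin

lemma P_nonneg: "A \<subseteq> B \<Longrightarrow> 0 \<le> P A"
  by (intro prod_nonneg) (use p_pos less_imp_le in blast)

lemma P_pos: "A \<subseteq> B \<Longrightarrow> 0 < P A"
  by (intro prod_pos) (use p_pos in blast)

lemma P_le_1: "A \<subseteq> B \<Longrightarrow> P A \<le> 1"
  by (intro prod_le_1) (use p_pos p_less_1 less_imp_le in blast)

lemma P_Un_Int:
  assumes "X \<subseteq> B" "Y \<subseteq> B"
  shows "P X * P Y = P (X \<union> Y) * P (X \<inter> Y)"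
  by (rule prod.union_inter[symmetric]) (use assms finite_sites finite_subset in auto)

text \<open>
  The inequality that lets every product of monomials be bounded by the probability that all the
  sites involved are on, even when some factors were replaced by their probabilities.
\<close>

lemma P_mult_le:
  assumes "X \<subseteq> B" "Y \<subseteq> B"
  shows "P X * P Y \<le> P (X \<union> Y)"
  unfolding P_Un_Int[OF assms]
  using mult_left_mono[OF P_le_1[of "X \<inter> Y"] P_nonneg[of "X \<union> Y"]] assms by auto

lemma E_all_on_mult: "A \<subseteq> B \<Longrightarrow> A' \<subseteq> B \<Longrightarrow> E (\<lambda>\<omega>. all_on A \<omega> * all_on A' \<omega>) = P (A \<union> A')"
  using E_all_on[of "A \<union> A'"] by (simp add: all_on_Un[abs_def])

lemma E_cov_all_on:
  assumes "A \<subseteq> B" "A' \<subseteq> B"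
  shows "E (\<lambda>\<omega>. (all_on A \<omega> - P A) * (all_on A' \<omega> - P A')) = P (A \<union> A') - P A * P A'"
proof -
  have "(\<lambda>\<omega>. (all_on A \<omega> - P A) * (all_on A' \<omega> - P A')) =
      (\<lambda>\<omega>. all_on A \<omega> * all_on A' \<omega> - P A' * all_on A \<omega> - P A * all_on A' \<omega> + P A * P A')"
    by (simp add: algebra_simps)
  then show ?thesis using assms by (simp add: E_all_on_mult E_all_on)
qed

lemma centred_upd: "e \<noteq> e' \<Longrightarrow> centred e' (fun_upd \<omega> e b) = centred e' \<omega>"
  by (simp add: centred_def)

text \<open>
  For \<open>e \<noteq> e'\<close> the expectation vanishes unless each of the two products contains the centred site of
  the other, because otherwise one centred variable is independent of everything else.
\<close>

lemma E_centred_all_on_pair: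
  assumes e: "e \<in> B" "e \<notin> A" and e': "e' \<in> B" "e' \<notin> A'" and A: "A \<subseteq> B" "A' \<subseteq> B"
  shows "E (\<lambda>\<omega>. centred e \<omega> * all_on A \<omega> * (centred e' \<omega> * all_on A' \<omega>)) =
    (if e = e' then p e * (1 - p e) * P (A \<union> A')
     else if e \<in> A' \<and> e' \<in> A then (1 - p e) * (1 - p e') * P (A \<union> A') else 0)"
proof -
  consider "e = e'" | "e \<noteq> e'" "e \<notin> A'" | "e \<noteq> e'" "e' \<notin> A" | "e \<noteq> e'" "e \<in> A'" "e' \<in> A" by blast
  then show ?thesis
  proof cases
    case 1
    have "E (\<lambda>\<omega>. centred e \<omega> * all_on (A \<union> A') \<omega> * centred e \<omega>) = p e * (1 - p e) * P (A \<union> A')"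
      using 1 e e' A
      by (subst E_centred_mult) (auto simp: all_on_upd centred_def E_all_on)
    then show ?thesis using 1 by (simp add: all_on_Un mult_ac)
  next
    case 2
    have "E (\<lambda>\<omega>. centred e \<omega> * (all_on A \<omega> * centred e' \<omega> * all_on A' \<omega>)) = 0"
      using 2 e by (intro E_centred_mult_0) (auto simp: all_on_upd centred_upd)
    then show ?thesis using 2 by (simp add: mult_ac)
  next
    case 3
    have "E (\<lambda>\<omega>. centred e' \<omega> * (all_on A \<omega> * centred e \<omega> * all_on A' \<omega>)) = 0"
      using 3 e' by (intro E_centred_mult_0) (auto simp: all_on_upd centred_upd)
    then show ?thesis using 3 by (simp add: mult_ac)
  next
    case 4
    have "centred e \<omega> * all_on A \<omega> * (centred e' \<omega> * all_on A' \<omega>) =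
        (1 - p e) * (1 - p e') * all_on (A \<union> A') \<omega>" for \<omega>
      using 4 by (auto simp: all_on_def centred_def)
    then show ?thesis using 4 A by (simp add: E_all_on)
  qed
qed

text \<open>
  The variables of the product are replaced by their probabilities one at a time. The set \<open>L e\<close>
  consists of the sites that have not been replaced when it is the turn of \<open>e\<close>, and \<open>A - {e} - L e\<close> of
  those that have.
\<close>

lemma all_on_telescope:
  assumes "finite A"
  shows "\<exists>L. (\<forall>e\<in>A. L e \<subseteq> A - {e}) \<and>
    (\<forall>\<omega>. all_on A \<omega> - P A = (\<Sum>e\<in>A. centred e \<omega> * (P (A - {e} - L e) * all_on (L e) \<omega>)))"
  using assms
proof (induction A rule: finite_induct)
  case empty
  show ?case by (simp add: all_on_def)
next
  case (insert a A)
  then obtain L where L: "\<And>e. e \<in> A \<Longrightarrow> L e \<subseteq> A - {e}"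
    "\<And>\<omega>. all_on A \<omega> - P A = (\<Sum>e\<in>A. centred e \<omega> * (P (A - {e} - L e) * all_on (L e) \<omega>))" by blast
  define L' where "L' = L(a := A)"
  have eq: "P (insert a A - {e} - L' e) * all_on (L' e) \<omega> = p a * (P (A - {e} - L e) * all_on (L e) \<omega>)"
    if "e \<in> A" for e \<omega>
  proof -
    have "insert a A - {e} - L' e = insert a (A - {e} - L e)" "L' e = L e"
      using that L(1)[OF that] insert.hyps by (auto simp: L'_def)
    then show ?thesis using insert.hyps by simp
  qed
  have "all_on (insert a A) \<omega> - P (insert a A) =
      (\<Sum>e\<in>insert a A. centred e \<omega> * (P (insert a A - {e} - L' e) * all_on (L' e) \<omega>))" for \<omega>
  proof -
    have "insert a A - {a} - L' a = {}" "L' a = A" using insert.hyps by (auto simp: L'_def)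
    then have "(\<Sum>e\<in>insert a A. centred e \<omega> * (P (insert a A - {e} - L' e) * all_on (L' e) \<omega>))
      = centred a \<omega> * all_on A \<omega> +
        (\<Sum>e\<in>A. centred e \<omega> * (P (insert a A - {e} - L' e) * all_on (L' e) \<omega>))"
      using insert.hyps by simp
    also have "(\<Sum>e\<in>A. centred e \<omega> * (P (insert a A - {e} - L' e) * all_on (L' e) \<omega>))
      = p a * (\<Sum>e\<in>A. centred e \<omega> * (P (A - {e} - L e) * all_on (L e) \<omega>))"
      unfolding sum_distrib_left by (intro sum.cong refl) (simp only: eq, simp only: mult_ac)
    also have "\<dots> = p a * (all_on A \<omega> - P A)" by (simp only: L(2))
    also have "centred a \<omega> * all_on A \<omega> + p a * (all_on A \<omega> - P A) = all_on (insert a A) \<omega> - P (insert a A)"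
      using insert.hyps by (simp add: all_on_def centred_def algebra_simps)
    finally show ?thesis by simp
  qed
  moreover have "\<forall>e\<in>insert a A. L' e \<subseteq> insert a A - {e}"
    using L(1) insert.hyps by (auto simp: L'_def)
  ultimately show ?case by blast
qed

text \<open>
  The term indexed by \<open>j\<close> is the site \<open>s j\<close> together with the monomial on \<open>A j\<close>; the set \<open>D j\<close> collects
  the sites whose variables have been replaced by probabilities and contribute to \<open>c j\<close>. Covariances
  of disjoint monomials vanish, which leaves the linked pairs; the second moment of \<open>S\<close> has in addition
  the pairs with the same site.
\<close>

lemma second_moment_bounds:
  fixes J :: "'j set" and c :: "'j \<Rightarrow> real" and s :: "'j \<Rightarrow> 'b" and A D :: "'j \<Rightarrow> 'b set"
  assumes s: "\<And>j. j \<in> J \<Longrightarrow> s j \<in> B" "\<And>j. j \<in> J \<Longrightarrow> s j \<notin> A j"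
    and AD: "\<And>j. j \<in> J \<Longrightarrow> A j \<subseteq> B" "\<And>j. j \<in> J \<Longrightarrow> D j \<subseteq> B"
    and c: "\<And>j. j \<in> J \<Longrightarrow> 0 \<le> c j" "\<And>j X. j \<in> J \<Longrightarrow> X \<subseteq> B \<Longrightarrow> c j * P X \<le> P (X \<union> D j)"
  defines "F \<equiv> \<lambda>j. insert (s j) (A j \<union> D j)"
    and "T \<equiv> \<lambda>\<omega>. \<Sum>j\<in>J. p (s j) * (1 - p (s j)) * (c j * all_on (A j) \<omega>)"
    and "S \<equiv> \<lambda>\<omega>. \<Sum>j\<in>J. centred (s j) \<omega> * (c j * all_on (A j) \<omega>)"
  defines "linked \<equiv> \<Sum>j\<in>J. \<Sum>j'\<in>J. of_bool (F j \<inter> F j' \<noteq> {}) *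
      ((1 - p (s j)) * (1 - p (s j')) * P (F j \<union> F j'))"
    and "diagonal \<equiv> \<Sum>j\<in>J. \<Sum>j'\<in>J. of_bool (s j = s j') * ((1 - p (s j)) * P (F j \<union> F j'))"
  shows "E (\<lambda>\<omega>. (T \<omega> - E T)\<^sup>2) \<le> linked"
    and "E (\<lambda>\<omega>. (S \<omega>)\<^sup>2) \<le> diagonal + linked"
proof -
  have F: "F j \<subseteq> B" if "j \<in> J" for j using s AD that by (auto simp: F_def)
  have q: "0 \<le> 1 - p (s j)" "0 \<le> p (s j)" "p (s j) \<le> 1" if "j \<in> J" for j
    using p_less_1[OF s(1)[OF that]] p_pos[OF s(1)[OF that]] by auto
  have cc: "c j * (c j' * P X) \<le> P (X \<union> D j \<union> D j')" if "j \<in> J" "j' \<in> J" "X \<subseteq> B" for j j' X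
  proof -
    have "c j * (c j' * P X) \<le> c j * P (X \<union> D j')"
      using c that by (intro mult_left_mono) auto
    also have "\<dots> \<le> P (X \<union> D j' \<union> D j)" using c(2)[of j "X \<union> D j'"] AD that by auto
    finally show ?thesis by (simp add: Un_ac)
  qed
  have pp: "p (s j) * P X \<le> P (insert (s j) X)" if "j \<in> J" "X \<subseteq> B" for j X
    using P_mult_le[of "{s j}" X] s(1) that by simp
  have T: "E T = (\<Sum>j\<in>J. p (s j) * (1 - p (s j)) * (c j * P (A j)))"
    unfolding T_def E_sum using AD by (intro sum.cong refl) (simp add: E_all_on)
  have "E (\<lambda>\<omega>. (T \<omega> - E T)\<^sup>2) = E (\<lambda>\<omega>. \<Sum>j\<in>J. \<Sum>j'\<in>J.
      (p (s j) * (1 - p (s j)) * c j) * (p (s j') * (1 - p (s j')) * c j') *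
      ((all_on (A j) \<omega> - P (A j)) * (all_on (A j') \<omega> - P (A j'))))"
  proof (intro Bochner_Integration.integral_cong refl)
    fix \<omega>
    have "T \<omega> - E T = (\<Sum>j\<in>J. p (s j) * (1 - p (s j)) * c j * (all_on (A j) \<omega> - P (A j)))"
      unfolding T by (simp add: T_def sum_subtractf[symmetric] algebra_simps)
    then show "(T \<omega> - E T)\<^sup>2 = (\<Sum>j\<in>J. \<Sum>j'\<in>J.
      (p (s j) * (1 - p (s j)) * c j) * (p (s j') * (1 - p (s j')) * c j') *
      ((all_on (A j) \<omega> - P (A j)) * (all_on (A j') \<omega> - P (A j'))))"
      by (simp add: power2_eq_square sum_product mult_ac)
  qed
  also have "\<dots> = (\<Sum>j\<in>J. \<Sum>j'\<in>J.
      (p (s j) * (1 - p (s j)) * c j) * (p (s j') * (1 - p (s j')) * c j') *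
      (P (A j \<union> A j') - P (A j) * P (A j')))"
    unfolding E_sum using AD by (intro sum.cong refl) (simp add: E_cov_all_on)
  also have "\<dots> \<le> linked"
    unfolding linked_def
  proof (intro sum_mono)
    fix j j' assume j: "j \<in> J" "j' \<in> J"
    show "(p (s j) * (1 - p (s j)) * c j) * (p (s j') * (1 - p (s j')) * c j') *
        (P (A j \<union> A j') - P (A j) * P (A j'))
      \<le> of_bool (F j \<inter> F j' \<noteq> {}) * ((1 - p (s j)) * (1 - p (s j')) * P (F j \<union> F j'))"
    proof (cases "A j \<inter> A j' = {}")
      case True
      then have "P (A j \<union> A j') - P (A j) * P (A j') = 0"
        using P_Un_Int[of "A j" "A j'"] AD j by simp
      then show ?thesis using q j P_nonneg[of "F j \<union> F j'"] F by simp
    next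
      case False
      then have "F j \<inter> F j' \<noteq> {}" by (auto simp: F_def)
      have "p (s j) * (p (s j') * (c j * (c j' * P (A j \<union> A j')))) \<le>
          p (s j) * (p (s j') * P (A j \<union> A j' \<union> D j \<union> D j'))"
        using q j cc[OF j, of "A j \<union> A j'"] AD by (intro mult_left_mono) auto
      also have "\<dots> \<le> p (s j) * P (insert (s j') (A j \<union> A j' \<union> D j \<union> D j'))"
        using q j AD by (intro mult_left_mono pp) auto
      also have "\<dots> \<le> P (insert (s j) (insert (s j') (A j \<union> A j' \<union> D j \<union> D j')))"
        using q j AD s by (intro pp) auto
      also have "insert (s j) (insert (s j') (A j \<union> A j' \<union> D j \<union> D j')) = F j \<union> F j'"
        by (auto simp: F_def)
      finally have *: "p (s j) * (p (s j') * (c j * (c j' * P (A j \<union> A j')))) \<le> P (F j \<union> F j')" .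
      have "(p (s j) * (1 - p (s j)) * c j) * (p (s j') * (1 - p (s j')) * c j') *
          (P (A j \<union> A j') - P (A j) * P (A j')) \<le>
        (p (s j) * (1 - p (s j)) * c j) * (p (s j') * (1 - p (s j')) * c j') * P (A j \<union> A j')"
        using q j c AD P_nonneg[of "A j"] P_nonneg[of "A j'"]
        by (intro mult_left_mono mult_nonneg_nonneg) auto
      also have "\<dots> = (1 - p (s j)) * (1 - p (s j')) *
          (p (s j) * (p (s j') * (c j * (c j' * P (A j \<union> A j')))))" by (simp only: mult_ac)
      also have "\<dots> \<le> (1 - p (s j)) * (1 - p (s j')) * P (F j \<union> F j')"
        using q j * by (intro mult_left_mono) auto
      finally show ?thesis using \<open>F j \<inter> F j' \<noteq> {}\<close> by simp
    qed
  qed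
  finally show "E (\<lambda>\<omega>. (T \<omega> - E T)\<^sup>2) \<le> linked" .
  have "E (\<lambda>\<omega>. (S \<omega>)\<^sup>2) = E (\<lambda>\<omega>. \<Sum>j\<in>J. \<Sum>j'\<in>J. (c j * c j') *
      (centred (s j) \<omega> * all_on (A j) \<omega> * (centred (s j') \<omega> * all_on (A j') \<omega>)))"
    unfolding S_def by (intro Bochner_Integration.integral_cong refl)
      (simp add: power2_eq_square sum_product mult_ac)
  also have "\<dots> = (\<Sum>j\<in>J. \<Sum>j'\<in>J. (c j * c j') *
      E (\<lambda>\<omega>. centred (s j) \<omega> * all_on (A j) \<omega> * (centred (s j') \<omega> * all_on (A j') \<omega>)))"
    unfolding E_sum by simp
  also have "\<dots> \<le> (\<Sum>j\<in>J. \<Sum>j'\<in>J. of_bool (s j = s j') * ((1 - p (s j)) * P (F j \<union> F j')) +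
      of_bool (F j \<inter> F j' \<noteq> {}) * ((1 - p (s j)) * (1 - p (s j')) * P (F j \<union> F j')))"
  proof (intro sum_mono)
    fix j j' assume j: "j \<in> J" "j' \<in> J"
    note E_eq = E_centred_all_on_pair[OF s(1)[OF j(1)] s(2)[OF j(1)] s(1)[OF j(2)] s(2)[OF j(2)]
        AD(1)[OF j(1)] AD(1)[OF j(2)]]
    have nn: "0 \<le> P (F j \<union> F j')" using F j by (intro P_nonneg) auto
    have cA: "c j * (c j' * P (A j \<union> A j')) \<le> P (A j \<union> A j' \<union> D j \<union> D j')"
      using cc[OF j, of "A j \<union> A j'"] AD j by auto
    consider "s j = s j'" | "s j \<noteq> s j'" "s j \<in> A j'" "s j' \<in> A j" |
      "s j \<noteq> s j'" "\<not> (s j \<in> A j' \<and> s j' \<in> A j)" by blast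
    then show "(c j * c j') *
        E (\<lambda>\<omega>. centred (s j) \<omega> * all_on (A j) \<omega> * (centred (s j') \<omega> * all_on (A j') \<omega>))
      \<le> of_bool (s j = s j') * ((1 - p (s j)) * P (F j \<union> F j')) +
        of_bool (F j \<inter> F j' \<noteq> {}) * ((1 - p (s j)) * (1 - p (s j')) * P (F j \<union> F j'))"
    proof cases
      case 1
      have "p (s j) * (c j * (c j' * P (A j \<union> A j'))) \<le> p (s j) * P (A j \<union> A j' \<union> D j \<union> D j')"
        using q j cA by (intro mult_left_mono) auto
      also have "\<dots> \<le> P (insert (s j) (A j \<union> A j' \<union> D j \<union> D j'))"
        using q j AD s by (intro pp) auto
      also have "insert (s j) (A j \<union> A j' \<union> D j \<union> D j') = F j \<union> F j'"
        using 1 by (auto simp: F_def)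
      finally have "(1 - p (s j)) * (p (s j) * (c j * (c j' * P (A j \<union> A j')))) \<le> (1 - p (s j)) * P (F j \<union> F j')"
        using q j by (intro mult_left_mono) auto
      moreover have "0 \<le> of_bool (F j \<inter> F j' \<noteq> {}) * ((1 - p (s j)) * (1 - p (s j')) * P (F j \<union> F j'))"
        using q j nn by simp
      ultimately show ?thesis using 1 unfolding E_eq by (simp add: mult_ac)
    next
      case 2
      have "A j \<union> A j' \<union> D j \<union> D j' = F j \<union> F j'" "F j \<inter> F j' \<noteq> {}"
        using 2 by (auto simp: F_def)
      moreover from cA have "(1 - p (s j)) * (1 - p (s j')) * (c j * (c j' * P (A j \<union> A j')))
          \<le> (1 - p (s j)) * (1 - p (s j')) * P (A j \<union> A j' \<union> D j \<union> D j')"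
        using q j by (intro mult_left_mono) auto
      ultimately show ?thesis using 2 unfolding E_eq by (simp add: mult_ac)
    next
      case 3
      then show ?thesis unfolding E_eq using q j nn by auto
    qed
  qed
  also have "\<dots> = diagonal + linked" by (simp add: diagonal_def linked_def sum.distrib)
  finally show "E (\<lambda>\<omega>. (S \<omega>)\<^sup>2) \<le> diagonal + linked" .
qed

end

text \<open>
  Sums of products over the sets \<open>Ed \<alpha>\<close>, in which only the sites in \<open>K\<close> remain random and the
  other variables are replaced by their probabilities.
\<close>

locale monomial_sum = bernoulli_field B p for B :: "'b set" and p :: "'b \<Rightarrow> real" +
  fixes I :: "'c set" and Ed :: "'c \<Rightarrow> 'b set" and K :: "'b set" and \<sigma> :: real
  assumes finite_index: "finite I" and Ed_sub: "\<alpha> \<in> I \<Longrightarrow> Ed \<alpha> \<subseteq> B"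
    and K_sub: "K \<subseteq> B" and sigma_pos: "0 < \<sigma>"
begin

definition Z :: "('b \<Rightarrow> bool) \<Rightarrow> real" where
  "Z \<omega> = (\<Sum>\<alpha>\<in>I. P (Ed \<alpha> - K) * all_on (Ed \<alpha> \<inter> K) \<omega>)"

definition W :: "('b \<Rightarrow> bool) \<Rightarrow> real" where
  "W \<omega> = (Z \<omega> - (\<Sum>\<alpha>\<in>I. P (Ed \<alpha>))) / \<sigma>"

text \<open>
  A choice of the sets from \<open>all_on_telescope\<close> for the random part of \<open>Ed \<alpha>\<close>.
\<close>

definition later :: "'c \<Rightarrow> 'b \<Rightarrow> 'b set" where
  "later \<alpha> = (SOME L. (\<forall>e\<in>Ed \<alpha> \<inter> K. L e \<subseteq> Ed \<alpha> \<inter> K - {e}) \<and>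
    (\<forall>\<omega>. all_on (Ed \<alpha> \<inter> K) \<omega> - P (Ed \<alpha> \<inter> K) =
      (\<Sum>e\<in>Ed \<alpha> \<inter> K. centred e \<omega> * (P (Ed \<alpha> \<inter> K - {e} - L e) * all_on (L e) \<omega>))))"

definition through :: "'b \<Rightarrow> 'c set" where
  "through e = {\<alpha> \<in> I. e \<in> Ed \<alpha> \<inter> K}"

definition ucoeff :: "'b \<Rightarrow> 'c \<Rightarrow> real" where
  "ucoeff e \<alpha> = P (Ed \<alpha> - K) * P (Ed \<alpha> \<inter> K - {e} - later \<alpha> e)"

definition U :: "'b \<Rightarrow> ('b \<Rightarrow> bool) \<Rightarrow> real" where
  "U e \<omega> = (\<Sum>\<alpha>\<in>through e. ucoeff e \<alpha> * all_on (later \<alpha> e) \<omega>) / \<sigma>"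

lemma finite_Ed: "\<alpha> \<in> I \<Longrightarrow> finite (Ed \<alpha>)"
  using Ed_sub finite_sites finite_subset by blast

lemma finite_through [simp]: "finite (through e)"
  by (simp add: through_def finite_index)

lemma later_telescopes:
  assumes "\<alpha> \<in> I"
  shows "e \<in> Ed \<alpha> \<inter> K \<Longrightarrow> later \<alpha> e \<subseteq> Ed \<alpha> \<inter> K - {e}"
    and "all_on (Ed \<alpha> \<inter> K) \<omega> - P (Ed \<alpha> \<inter> K) =
      (\<Sum>e\<in>Ed \<alpha> \<inter> K. centred e \<omega> * (P (Ed \<alpha> \<inter> K - {e} - later \<alpha> e) * all_on (later \<alpha> e) \<omega>))"
proof -
  have "finite (Ed \<alpha> \<inter> K)" using finite_Ed[OF assms] by simp
  from someI_ex[OF all_on_telescope[OF this], folded later_def]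
  show "e \<in> Ed \<alpha> \<inter> K \<Longrightarrow> later \<alpha> e \<subseteq> Ed \<alpha> \<inter> K - {e}"
    "all_on (Ed \<alpha> \<inter> K) \<omega> - P (Ed \<alpha> \<inter> K) =
      (\<Sum>e\<in>Ed \<alpha> \<inter> K. centred e \<omega> * (P (Ed \<alpha> \<inter> K - {e} - later \<alpha> e) * all_on (later \<alpha> e) \<omega>))"
    by blast+
qed

lemma P_split: "\<alpha> \<in> I \<Longrightarrow> P (Ed \<alpha>) = P (Ed \<alpha> - K) * P (Ed \<alpha> \<inter> K)"
  using prod.subset_diff[of "Ed \<alpha> \<inter> K" "Ed \<alpha>" p] finite_Ed[of \<alpha>]
  by (simp add: Diff_Int_distrib Diff_Int)

lemma W_eq_sum: "W \<omega> = (\<Sum>e\<in>B. centred e \<omega> * U e \<omega>)"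
proof -
  have "Z \<omega> - (\<Sum>\<alpha>\<in>I. P (Ed \<alpha>)) =
      (\<Sum>\<alpha>\<in>I. P (Ed \<alpha> - K) * (all_on (Ed \<alpha> \<inter> K) \<omega> - P (Ed \<alpha> \<inter> K)))"
    unfolding Z_def sum_subtractf[symmetric]
    by (intro sum.cong refl) (simp add: P_split right_diff_distrib)
  also have "\<dots> = (\<Sum>\<alpha>\<in>I. \<Sum>e\<in>{e\<in>B. e \<in> Ed \<alpha> \<inter> K}. centred e \<omega> * (ucoeff e \<alpha> * all_on (later \<alpha> e) \<omega>))"
  proof (intro sum.cong refl)
    fix \<alpha> assume \<alpha>: "\<alpha> \<in> I"
    then have "{e\<in>B. e \<in> Ed \<alpha> \<inter> K} = Ed \<alpha> \<inter> K" using Ed_sub by auto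
    then show "P (Ed \<alpha> - K) * (all_on (Ed \<alpha> \<inter> K) \<omega> - P (Ed \<alpha> \<inter> K)) =
        (\<Sum>e\<in>{e\<in>B. e \<in> Ed \<alpha> \<inter> K}. centred e \<omega> * (ucoeff e \<alpha> * all_on (later \<alpha> e) \<omega>))"
      unfolding later_telescopes(2)[OF \<alpha>] sum_distrib_left ucoeff_def by (simp only: mult_ac)
  qed
  also have "\<dots> = (\<Sum>e\<in>B. \<Sum>\<alpha>\<in>through e. centred e \<omega> * (ucoeff e \<alpha> * all_on (later \<alpha> e) \<omega>))"
    unfolding through_def by (rule sum.swap_restrict) (use finite_index finite_sites in auto)
  finally show ?thesis
    unfolding W_def U_def by (simp add: sum_distrib_left sum_divide_distrib)
qed

lemma U_nonneg: "e \<in> B \<Longrightarrow> 0 \<le> U e \<omega>"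
  unfolding U_def ucoeff_def through_def
  using sigma_pos Ed_sub
  by (intro divide_nonneg_pos sum_nonneg mult_nonneg_nonneg P_nonneg all_on_nonneg) auto

lemma U_upd: "U e (fun_upd \<omega> e b) = U e \<omega>"
proof -
  have "all_on (later \<alpha> e) (fun_upd \<omega> e b) = all_on (later \<alpha> e) \<omega>" if "\<alpha> \<in> through e" for \<alpha>
    using later_telescopes(1)[of \<alpha> e] that by (intro all_on_upd) (auto simp: through_def)
  then show ?thesis unfolding U_def by simp
qed

lemma W_diff:
  "W (fun_upd \<omega> e True) - W (fun_upd \<omega> e False) =
    (\<Sum>\<beta>\<in>through e. P (Ed \<beta> - K) * all_on (Ed \<beta> \<inter> K - {e}) \<omega>) / \<sigma>"
proof -
  have *: "all_on A (fun_upd \<omega> e True) - all_on A (fun_upd \<omega> e False) = (if e \<in> A then all_on (A - {e}) \<omega> else 0)"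
    for A by (auto simp: all_on_def)
  have "Z (fun_upd \<omega> e True) - Z (fun_upd \<omega> e False) =
      (\<Sum>\<beta>\<in>I. if e \<in> Ed \<beta> \<inter> K then P (Ed \<beta> - K) * all_on (Ed \<beta> \<inter> K - {e}) \<omega> else 0)"
    unfolding Z_def sum_subtractf[symmetric] right_diff_distrib[symmetric] *
    by (intro sum.cong) auto
  also have "\<dots> = (\<Sum>\<beta>\<in>through e. P (Ed \<beta> - K) * all_on (Ed \<beta> \<inter> K - {e}) \<omega>)"
    unfolding through_def by (rule sum.inter_filter[symmetric]) (rule finite_index)
  finally show ?thesis unfolding W_def by (simp add: diff_divide_distrib[symmetric])
qed

sublocale clark_ocone B p W U
proof
  fix e :: 'b and \<omega> :: "'b \<Rightarrow> bool" assume "e \<in> B"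
  have "0 \<le> W (fun_upd \<omega> e True) - W (fun_upd \<omega> e False)"
    unfolding W_diff using sigma_pos Ed_sub
    by (intro divide_nonneg_pos sum_nonneg mult_nonneg_nonneg P_nonneg all_on_nonneg)
      (auto simp: through_def)
  then show "W (fun_upd \<omega> e False) \<le> W (fun_upd \<omega> e True)" by simp
qed (auto simp: W_eq_sum U_upd U_nonneg)

text \<open>
  The index set of the expansion of \<open>T\<close> and \<open>S\<close>: a random site and two products through it, one
  coming from \<open>U\<close> and one from \<open>V\<close>.
\<close>

definition pairs :: "('b \<times> 'c \<times> 'c) set" where
  "pairs = (SIGMA e:K. through e \<times> through e)"

definition joint_edges :: "'b \<times> 'c \<times> 'c \<Rightarrow> 'b set" where
  "joint_edges j = Ed (fst (snd j)) \<union> Ed (snd (snd j))"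

definition linked_sum :: real where
  "linked_sum = (\<Sum>j\<in>pairs. \<Sum>j'\<in>pairs. of_bool (joint_edges j \<inter> joint_edges j' \<noteq> {}) *
     ((1 - p (fst j)) * (1 - p (fst j')) * P (joint_edges j \<union> joint_edges j')))"

definition diagonal_sum :: real where
  "diagonal_sum = (\<Sum>j\<in>pairs. \<Sum>j'\<in>pairs.
     of_bool (fst j = fst j') * ((1 - p (fst j)) * P (joint_edges j \<union> joint_edges j')))"

lemma moment_bounds:
  "E (\<lambda>\<omega>. (T \<omega> - E T)\<^sup>2) \<le> linked_sum / \<sigma> ^ 4"
  "E (\<lambda>\<omega>. (S \<omega>)\<^sup>2) \<le> (diagonal_sum + linked_sum) / \<sigma> ^ 4"
proof -
  define s :: "'b \<times> 'c \<times> 'c \<Rightarrow> 'b" where "s = fst"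
  define A where "A = (\<lambda>(e, \<alpha>, \<beta>). later \<alpha> e \<union> (Ed \<beta> \<inter> K - {e}))"
  define D where "D = (\<lambda>(e, \<alpha>, \<beta>). (Ed \<alpha> - K) \<union> (Ed \<alpha> \<inter> K - {e} - later \<alpha> e) \<union> (Ed \<beta> - K))"
  define c where "c = (\<lambda>(e, \<alpha>, \<beta>). ucoeff e \<alpha> * P (Ed \<beta> - K))"
  have pairsD: "e \<in> K" "\<alpha> \<in> I" "\<beta> \<in> I" "e \<in> Ed \<alpha>" "e \<in> Ed \<beta>" "Ed \<alpha> \<subseteq> B" "Ed \<beta> \<subseteq> B"
      "later \<alpha> e \<subseteq> Ed \<alpha> \<inter> K - {e}" "e \<in> B" if "(e, \<alpha>, \<beta>) \<in> pairs" for e \<alpha> \<beta>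
    using that later_telescopes(1)[of \<alpha> e] Ed_sub K_sub by (auto simp: pairs_def through_def)
  have J: "s j \<in> B" "s j \<notin> A j" "A j \<subseteq> B" "D j \<subseteq> B" "0 \<le> c j" if "j \<in> pairs" for j
  proof -
    obtain e \<alpha> \<beta> where j: "j = (e, \<alpha>, \<beta>)" by (cases j)
    note jD = pairsD[OF that[unfolded j]]
    show "s j \<in> B" "s j \<notin> A j" "A j \<subseteq> B" "D j \<subseteq> B"
      using jD by (auto simp: j s_def A_def D_def)
    show "0 \<le> c j" using jD unfolding c_def ucoeff_def j prod.case
      by (intro mult_nonneg_nonneg P_nonneg) auto
  qed
  have cX: "c j * P X \<le> P (X \<union> D j)" if "j \<in> pairs" "X \<subseteq> B" for j X
  proof -
    obtain e \<alpha> \<beta> where j: "j = (e, \<alpha>, \<beta>)" by (cases j)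
    note jD = pairsD[OF that(1)[unfolded j]]
    have "c j * P X = P (Ed \<alpha> - K) * (P (Ed \<alpha> \<inter> K - {e} - later \<alpha> e) * (P (Ed \<beta> - K) * P X))"
      by (simp add: c_def ucoeff_def j)
    also have "\<dots> \<le> P (Ed \<alpha> - K) * (P (Ed \<alpha> \<inter> K - {e} - later \<alpha> e) * P ((Ed \<beta> - K) \<union> X))"
      using jD that by (intro mult_left_mono P_mult_le P_nonneg) auto
    also have "\<dots> \<le> P (Ed \<alpha> - K) * P ((Ed \<alpha> \<inter> K - {e} - later \<alpha> e) \<union> ((Ed \<beta> - K) \<union> X))"
      using jD that by (intro mult_left_mono P_mult_le P_nonneg) auto
    also have "\<dots> \<le> P ((Ed \<alpha> - K) \<union> ((Ed \<alpha> \<inter> K - {e} - later \<alpha> e) \<union> ((Ed \<beta> - K) \<union> X)))"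
      using jD that by (intro P_mult_le) auto
    also have "(Ed \<alpha> - K) \<union> ((Ed \<alpha> \<inter> K - {e} - later \<alpha> e) \<union> ((Ed \<beta> - K) \<union> X)) = X \<union> D j"
      by (auto simp: D_def j)
    finally show ?thesis .
  qed
  have F: "insert (s j) (A j \<union> D j) = joint_edges j" if "j \<in> pairs" for j
  proof -
    obtain e \<alpha> \<beta> where j: "j = (e, \<alpha>, \<beta>)" by (cases j)
    note jD = pairsD[OF that[unfolded j]]
    show ?thesis using jD by (auto simp: j s_def A_def D_def joint_edges_def)
  qed
  have UV: "U e \<omega> * V e \<omega> = (\<Sum>(\<alpha>, \<beta>)\<in>through e \<times> through e. c (e, \<alpha>, \<beta>) * all_on (A (e, \<alpha>, \<beta>)) \<omega>) / \<sigma>\<^sup>2"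
    for e \<omega>
    unfolding V_def W_diff unfolding U_def
    by (simp add: sum_product sum.cartesian_product c_def A_def all_on_Un power2_eq_square mult_ac)
  have U0: "U e \<omega> * V e \<omega> = 0" if "e \<notin> K" for e \<omega>
  proof -
    have "through e = {}" using that by (auto simp: through_def)
    then show ?thesis by (simp add: U_def)
  qed
  have sumB: "(\<Sum>e\<in>B. g e * (U e \<omega> * V e \<omega>)) =
      (\<Sum>j\<in>pairs. g (s j) * (c j * all_on (A j) \<omega>)) / \<sigma>\<^sup>2" for g \<omega>
  proof -
    have "(\<Sum>e\<in>B. g e * (U e \<omega> * V e \<omega>)) = (\<Sum>e\<in>K. g e * (U e \<omega> * V e \<omega>))"
      using K_sub finite_sites by (intro sum.mono_neutral_right) (auto simp: U0)
    also have "\<dots> = (\<Sum>e\<in>K. \<Sum>\<alpha>\<beta>\<in>through e \<times> through e.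
        g (s (e, \<alpha>\<beta>)) * (c (e, \<alpha>\<beta>) * all_on (A (e, \<alpha>\<beta>)) \<omega>)) / \<sigma>\<^sup>2"
      unfolding UV by (simp add: sum_distrib_left sum_divide_distrib s_def split_def)
    also have "(\<Sum>e\<in>K. \<Sum>\<alpha>\<beta>\<in>through e \<times> through e.
        g (s (e, \<alpha>\<beta>)) * (c (e, \<alpha>\<beta>) * all_on (A (e, \<alpha>\<beta>)) \<omega>)) =
        (\<Sum>j\<in>pairs. g (s j) * (c j * all_on (A j) \<omega>))"
      unfolding pairs_def using K_sub finite_sites
      by (subst sum.Sigma) (auto simp: split_def intro: finite_subset)
    finally show ?thesis .
  qed
  define T' where "T' \<omega> = (\<Sum>j\<in>pairs. p (s j) * (1 - p (s j)) * (c j * all_on (A j) \<omega>))" for \<omega>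
  define S' where "S' \<omega> = (\<Sum>j\<in>pairs. centred (s j) \<omega> * (c j * all_on (A j) \<omega>))" for \<omega>
  have T': "T \<omega> = T' \<omega> / \<sigma>\<^sup>2" for \<omega>
    unfolding T_def T'_def by (rule sumB)
  have S': "S \<omega> = S' \<omega> / \<sigma>\<^sup>2" for \<omega>
    unfolding S_def S'_def using sumB[of "\<lambda>e. centred e \<omega>"] by simp
  note smb = second_moment_bounds[of pairs s A D c, OF J(1) J(2) J(3) J(4) J(5) cX]
  have link: "linked_sum = (\<Sum>j\<in>pairs. \<Sum>j'\<in>pairs.
      of_bool (insert (s j) (A j \<union> D j) \<inter> insert (s j') (A j' \<union> D j') \<noteq> {}) *
      ((1 - p (s j)) * (1 - p (s j')) * P (insert (s j) (A j \<union> D j) \<union> insert (s j') (A j' \<union> D j'))))"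
    unfolding linked_sum_def by (intro sum.cong refl) (simp only: F[unfolded s_def] s_def)
  have diag: "diagonal_sum = (\<Sum>j\<in>pairs. \<Sum>j'\<in>pairs. of_bool (s j = s j') *
      ((1 - p (s j)) * P (insert (s j) (A j \<union> D j) \<union> insert (s j') (A j' \<union> D j'))))"
    unfolding diagonal_sum_def by (intro sum.cong refl) (simp only: F[unfolded s_def] s_def)
  have "E (\<lambda>\<omega>. (T' \<omega> - E T')\<^sup>2) \<le> linked_sum"
    using smb(1) unfolding link T'_def[abs_def] .
  moreover have "E (\<lambda>\<omega>. (T \<omega> - E T)\<^sup>2) = E (\<lambda>\<omega>. (T' \<omega> - E T')\<^sup>2) / \<sigma> ^ 4"
    by (simp add: T'[abs_def] diff_divide_distrib[symmetric] power_divide)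
  ultimately show "E (\<lambda>\<omega>. (T \<omega> - E T)\<^sup>2) \<le> linked_sum / \<sigma> ^ 4"
    using sigma_pos by (simp add: divide_right_mono)
  have "E (\<lambda>\<omega>. (S' \<omega>)\<^sup>2) \<le> diagonal_sum + linked_sum"
    using smb(2) unfolding link diag S'_def[abs_def] .
  moreover have "E (\<lambda>\<omega>. (S \<omega>)\<^sup>2) = E (\<lambda>\<omega>. (S' \<omega>)\<^sup>2) / \<sigma> ^ 4"
    by (simp add: S'[abs_def] power_divide)
  ultimately show "E (\<lambda>\<omega>. (S \<omega>)\<^sup>2) \<le> (diagonal_sum + linked_sum) / \<sigma> ^ 4"
    using sigma_pos by (simp add: divide_right_mono)
qed

lemma E_Z: "E Z = (\<Sum>\<alpha>\<in>I. P (Ed \<alpha>))"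
proof -
  have "E Z = (\<Sum>\<alpha>\<in>I. P (Ed \<alpha> - K) * P (Ed \<alpha> \<inter> K))"
    unfolding Z_def[abs_def] E_sum using Ed_sub by (intro sum.cong refl) (auto simp: E_all_on le_infI1)
  then show ?thesis by (simp add: P_split)
qed

definition full :: "('b \<Rightarrow> bool) \<Rightarrow> real" where
  "full \<omega> = (\<Sum>\<alpha>\<in>I. all_on (Ed \<alpha>) \<omega>)"

lemma E_full: "E full = (\<Sum>\<alpha>\<in>I. P (Ed \<alpha>))"
  unfolding full_def[abs_def] E_sum using Ed_sub by (intro sum.cong refl) (auto simp: E_all_on)

lemma P_union_factors:
  assumes "\<alpha> \<in> I" "\<beta> \<in> I"
  shows "P (Ed \<alpha> \<inter> Ed \<beta> - K) * P (Ed \<alpha> \<union> Ed \<beta>) =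
      P (Ed \<alpha> - K) * P (Ed \<beta> - K) * P ((Ed \<alpha> \<inter> K) \<union> (Ed \<beta> \<inter> K))"
    and "P (Ed \<beta> - K) * P (Ed \<alpha> \<union> (Ed \<beta> \<inter> K)) =
      P (Ed \<alpha> - K) * P (Ed \<beta> - K) * P ((Ed \<alpha> \<inter> K) \<union> (Ed \<beta> \<inter> K))"
proof -
  have fin: "finite (Ed \<alpha>)" "finite (Ed \<beta>)" using assms finite_Ed by auto
  have "P (Ed \<alpha> - K) * P (Ed \<beta> - K) = P ((Ed \<alpha> - K) \<union> (Ed \<beta> - K)) * P ((Ed \<alpha> - K) \<inter> (Ed \<beta> - K))"
    using P_Un_Int[of "Ed \<alpha> - K" "Ed \<beta> - K"] Ed_sub assms by blast
  moreover have "(Ed \<alpha> - K) \<inter> (Ed \<beta> - K) = Ed \<alpha> \<inter> Ed \<beta> - K" by auto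
  moreover have "P (Ed \<alpha> \<union> Ed \<beta>) = P ((Ed \<alpha> - K) \<union> (Ed \<beta> - K)) * P ((Ed \<alpha> \<inter> K) \<union> (Ed \<beta> \<inter> K))"
    using fin by (subst prod.union_disjoint[symmetric]) (auto intro!: prod.cong)
  ultimately show "P (Ed \<alpha> \<inter> Ed \<beta> - K) * P (Ed \<alpha> \<union> Ed \<beta>) =
      P (Ed \<alpha> - K) * P (Ed \<beta> - K) * P ((Ed \<alpha> \<inter> K) \<union> (Ed \<beta> \<inter> K))" by simp
  have "P (Ed \<alpha> \<union> (Ed \<beta> \<inter> K)) = P (Ed \<alpha> - K) * P ((Ed \<alpha> \<inter> K) \<union> (Ed \<beta> \<inter> K))"
    using fin by (subst prod.union_disjoint[symmetric]) (auto intro!: prod.cong)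
  then show "P (Ed \<beta> - K) * P (Ed \<alpha> \<union> (Ed \<beta> \<inter> K)) =
      P (Ed \<alpha> - K) * P (Ed \<beta> - K) * P ((Ed \<alpha> \<inter> K) \<union> (Ed \<beta> \<inter> K))" by simp
qed

definition removed :: real where
  "removed = (\<Sum>\<alpha>\<in>I. \<Sum>\<beta>\<in>I. (1 - P (Ed \<alpha> \<inter> Ed \<beta> - K)) * P (Ed \<alpha> \<union> Ed \<beta>))"

text \<open>
  Since \<open>Z\<close> is the conditional expectation of \<open>full\<close> given the variables in \<open>K\<close>, the second moment of
  their difference is the difference of their second moments.
\<close>

lemma
  shows E_full_diff: "E (\<lambda>\<omega>. (full \<omega> - Z \<omega>)\<^sup>2) = removed"
    and E_full_sq: "E (\<lambda>\<omega>. (full \<omega>)\<^sup>2) = E (\<lambda>\<omega>. (Z \<omega>)\<^sup>2) + removed"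
proof -
  define b where "b \<alpha> \<beta> = P (Ed \<alpha> \<inter> Ed \<beta> - K) * P (Ed \<alpha> \<union> Ed \<beta>)" for \<alpha> \<beta>
  have 1: "E (\<lambda>\<omega>. (full \<omega>)\<^sup>2) = (\<Sum>\<alpha>\<in>I. \<Sum>\<beta>\<in>I. P (Ed \<alpha> \<union> Ed \<beta>))"
    unfolding full_def power2_eq_square sum_product E_sum
    using Ed_sub by (intro sum.cong refl E_all_on_mult) auto
  have 2: "E (\<lambda>\<omega>. (Z \<omega>)\<^sup>2) = (\<Sum>\<alpha>\<in>I. \<Sum>\<beta>\<in>I. b \<alpha> \<beta>)"
  proof -
    have "E (\<lambda>\<omega>. (Z \<omega>)\<^sup>2) = E (\<lambda>\<omega>. \<Sum>\<alpha>\<in>I. \<Sum>\<beta>\<in>I. P (Ed \<alpha> - K) * P (Ed \<beta> - K) *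
        (all_on (Ed \<alpha> \<inter> K) \<omega> * all_on (Ed \<beta> \<inter> K) \<omega>))"
      unfolding Z_def power2_eq_square sum_product by (simp only: mult_ac)
    also have "\<dots> = (\<Sum>\<alpha>\<in>I. \<Sum>\<beta>\<in>I. b \<alpha> \<beta>)"
      unfolding E_sum b_def using Ed_sub K_sub
      by (intro sum.cong refl) (simp add: E_all_on_mult le_infI1 P_union_factors(1))
    finally show ?thesis .
  qed
  have 3: "E (\<lambda>\<omega>. full \<omega> * Z \<omega>) = (\<Sum>\<alpha>\<in>I. \<Sum>\<beta>\<in>I. b \<alpha> \<beta>)"
  proof -
    have "E (\<lambda>\<omega>. full \<omega> * Z \<omega>) = E (\<lambda>\<omega>. \<Sum>\<alpha>\<in>I. \<Sum>\<beta>\<in>I. P (Ed \<beta> - K) *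
        (all_on (Ed \<alpha>) \<omega> * all_on (Ed \<beta> \<inter> K) \<omega>))"
      unfolding Z_def full_def sum_product by (simp only: mult_ac)
    also have "\<dots> = (\<Sum>\<alpha>\<in>I. \<Sum>\<beta>\<in>I. b \<alpha> \<beta>)"
      unfolding E_sum b_def using Ed_sub K_sub
      by (intro sum.cong refl) (simp add: E_all_on_mult le_infI1 P_union_factors)
    finally show ?thesis .
  qed
  have "E (\<lambda>\<omega>. (full \<omega> - Z \<omega>)\<^sup>2) = E (\<lambda>\<omega>. (full \<omega>)\<^sup>2 - 2 * (full \<omega> * Z \<omega>) + (Z \<omega>)\<^sup>2)"
    by (simp add: power2_diff mult_ac)
  also have "\<dots> = E (\<lambda>\<omega>. (full \<omega>)\<^sup>2) - 2 * E (\<lambda>\<omega>. full \<omega> * Z \<omega>) + E (\<lambda>\<omega>. (Z \<omega>)\<^sup>2)" by simp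
  also have "\<dots> = removed"
    unfolding 1 2 3 removed_def b_def by (simp add: left_diff_distrib sum_subtractf)
  finally show "E (\<lambda>\<omega>. (full \<omega> - Z \<omega>)\<^sup>2) = removed" .
  show "E (\<lambda>\<omega>. (full \<omega>)\<^sup>2) = E (\<lambda>\<omega>. (Z \<omega>)\<^sup>2) + removed"
    unfolding 1 2 removed_def b_def by (simp add: left_diff_distrib sum_subtractf)
qed

end

section \<open>Summing over chains of overlapping products\<close>

text \<open>
  Extending a set \<open>\<Gamma>\<close> of sites by one more set \<open>Ed \<gamma>\<close> through a site \<open>e \<in> \<Gamma>\<close> multiplies the total
  probability by at most \<open>\<Lambda> * y e\<close>. The size restriction on \<open>\<Gamma>\<close> admits unions of three of the sets,
  so that quadruples are reached by three extensions.
\<close>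

locale extension_bounds = monomial_sum B p I Ed K \<sigma>
  for B :: "'b set" and p :: "'b \<Rightarrow> real" and I :: "'c set" and Ed :: "'c \<Rightarrow> 'b set"
    and K :: "'b set" and \<sigma> :: real +
  fixes s :: nat and \<Lambda> :: real and y :: "'b \<Rightarrow> real"
  assumes card_Ed: "\<alpha> \<in> I \<Longrightarrow> card (Ed \<alpha>) \<le> s"
    and total_le: "(\<Sum>\<alpha>\<in>I. P (Ed \<alpha>)) \<le> \<Lambda>"
    and y_nonneg: "e \<in> \<Union> (Ed ` I) \<Longrightarrow> 0 \<le> y e"
    and extension_le: "\<Gamma> \<subseteq> \<Union> (Ed ` I) \<Longrightarrow> card \<Gamma> \<le> 3 * s \<Longrightarrow> e \<in> \<Gamma> \<Longrightarrow>
      (\<Sum>\<gamma>\<in>{\<gamma> \<in> I. e \<in> Ed \<gamma>}. P (\<Gamma> \<union> Ed \<gamma>)) \<le> \<Lambda> * y e * P \<Gamma>"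
begin

abbreviation R :: "'b set" where "R \<equiv> \<Union> (Ed ` I)"

lemma R_sub: "R \<subseteq> B"
  using Ed_sub by auto

lemma finite_R: "finite R"
  using R_sub finite_sites finite_subset by blast

lemma finite_K: "finite K"
  using K_sub finite_sites by (rule finite_subset)

lemma q_nonneg: "e \<in> R \<Longrightarrow> 0 \<le> 1 - p e"
  using p_less_1[of e] R_sub by (auto intro: less_imp_le)

lemma Lam_nonneg: "0 \<le> \<Lambda>"
  using total_le sum_nonneg[of I "\<lambda>\<alpha>. P (Ed \<alpha>)"] P_nonneg Ed_sub by (meson order.trans)

lemma P_R_nonneg: "\<Gamma> \<subseteq> R \<Longrightarrow> 0 \<le> P \<Gamma>"
  by (rule P_nonneg[OF order.trans[OF _ R_sub]])

lemma step:
  assumes "\<Gamma> \<subseteq> R" "card \<Gamma> \<le> 3 * s" "e \<in> \<Gamma>" "e \<in> K"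
  shows "(\<Sum>\<gamma>\<in>through e. P (\<Gamma> \<union> Ed \<gamma>)) \<le> \<Lambda> * y e * P \<Gamma>"
proof -
  have "through e = {\<gamma> \<in> I. e \<in> Ed \<gamma>}" using assms by (auto simp: through_def)
  with extension_le[OF assms(1-3)] show ?thesis by simp
qed

lemma card_Un_Ed: "card \<Gamma> \<le> k * s \<Longrightarrow> \<alpha> \<in> I \<Longrightarrow> card (\<Gamma> \<union> Ed \<alpha>) \<le> Suc k * s"
  using card_Un_le[of \<Gamma> "Ed \<alpha>"] card_Ed[of \<alpha>] by simp

lemma through_sub: "\<alpha> \<in> through e \<Longrightarrow> \<alpha> \<in> I \<and> e \<in> Ed \<alpha> \<and> e \<in> K \<and> Ed \<alpha> \<subseteq> R \<and> e \<in> R"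
  by (auto simp: through_def)

lemma sum_through:
  "(\<Sum>e\<in>K. \<Sum>\<alpha>\<in>through e. g e \<alpha>) = (\<Sum>\<alpha>\<in>I. \<Sum>e\<in>Ed \<alpha> \<inter> K. g e \<alpha>)"
proof -
  have "(\<Sum>e\<in>K. \<Sum>\<alpha>\<in>through e. g e \<alpha>) = (\<Sum>\<alpha>\<in>I. \<Sum>e\<in>{e \<in> K. e \<in> Ed \<alpha> \<inter> K}. g e \<alpha>)"
    unfolding through_def
    by (rule sum.swap_restrict[OF finite_K finite_index])
  moreover have "{e \<in> K. e \<in> Ed \<alpha> \<inter> K} = Ed \<alpha> \<inter> K" for \<alpha> by auto
  ultimately show ?thesis by simp
qed

lemma sum_through_le:
  assumes "\<And>\<alpha>. \<alpha> \<in> I \<Longrightarrow> 0 \<le> g \<alpha>"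
  shows "(\<Sum>e\<in>K. \<Sum>\<alpha>\<in>through e. g \<alpha>) \<le> real s * (\<Sum>\<alpha>\<in>I. g \<alpha>)"
  unfolding sum_through sum_distrib_left
proof (rule sum_mono)
  fix \<alpha> assume \<alpha>: "\<alpha> \<in> I"
  have "card (Ed \<alpha> \<inter> K) \<le> s"
    using card_Ed[OF \<alpha>] card_mono[of "Ed \<alpha>" "Ed \<alpha> \<inter> K"] finite_Ed[OF \<alpha>] by simp
  then show "(\<Sum>e\<in>Ed \<alpha> \<inter> K. g \<alpha>) \<le> real s * g \<alpha>"
    using assms[OF \<alpha>] by (simp add: mult_right_mono)
qed

lemma sum_pairs: "(\<Sum>j\<in>pairs. g j) = (\<Sum>e\<in>K. \<Sum>\<alpha>\<in>through e. \<Sum>\<beta>\<in>through e. g (e, \<alpha>, \<beta>))"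
proof -
  have "(\<Sum>j\<in>pairs. g j) = (\<Sum>e\<in>K. \<Sum>ab\<in>through e \<times> through e. g (e, ab))"
    unfolding pairs_def
    by (subst sum.Sigma) (auto simp: split_def finite_K)
  then show ?thesis by (simp add: sum.cartesian_product split_def)
qed

lemma diagonal_le:
  assumes \<kappa>: "\<And>e. e \<in> R \<inter> K \<Longrightarrow> (1 - p e) * y e ^ 3 \<le> \<kappa>" "0 \<le> \<kappa>"
  shows "diagonal_sum \<le> real s * \<kappa> * \<Lambda> ^ 4"
proof -
  have "diagonal_sum = (\<Sum>e\<in>K. \<Sum>\<alpha>\<in>through e. \<Sum>\<beta>\<in>through e. \<Sum>\<gamma>\<in>through e. \<Sum>\<delta>\<in>through e.
      (1 - p e) * P (Ed \<alpha> \<union> Ed \<beta> \<union> Ed \<gamma> \<union> Ed \<delta>))"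
    unfolding diagonal_sum_def sum_pairs
  proof (intro sum.cong refl)
    fix e \<alpha> \<beta> assume e: "e \<in> K"
    have "(\<Sum>\<gamma>\<in>through e'. \<Sum>\<delta>\<in>through e'. of_bool (e = e') *
        ((1 - p e) * P (joint_edges (e, \<alpha>, \<beta>) \<union> joint_edges (e', \<gamma>, \<delta>)))) =
      (if e' = e then \<Sum>\<gamma>\<in>through e. \<Sum>\<delta>\<in>through e.
        (1 - p e) * P (Ed \<alpha> \<union> Ed \<beta> \<union> Ed \<gamma> \<union> Ed \<delta>) else 0)" for e'
      by (cases "e' = e") (simp_all add: joint_edges_def Un_assoc)
    then show "(\<Sum>e'\<in>K. \<Sum>\<gamma>\<in>through e'. \<Sum>\<delta>\<in>through e'. of_bool (fst (e, \<alpha>, \<beta>) = fst (e', \<gamma>, \<delta>)) *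
        ((1 - p (fst (e, \<alpha>, \<beta>))) * P (joint_edges (e, \<alpha>, \<beta>) \<union> joint_edges (e', \<gamma>, \<delta>)))) =
      (\<Sum>\<gamma>\<in>through e. \<Sum>\<delta>\<in>through e. (1 - p e) * P (Ed \<alpha> \<union> Ed \<beta> \<union> Ed \<gamma> \<union> Ed \<delta>))"
      using e finite_K by (simp add: sum.delta)
  qed
  also have "\<dots> \<le> (\<Sum>e\<in>K. \<Sum>\<alpha>\<in>through e. \<Lambda> ^ 3 * \<kappa> * P (Ed \<alpha>))"
  proof (intro sum_mono)
    fix e \<alpha> assume "e \<in> K" and \<alpha>: "\<alpha> \<in> through e"
    note a = through_sub[OF \<alpha>]
    have y0: "0 \<le> \<Lambda> * y e" using a y_nonneg Lam_nonneg by auto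
    have ca: "card (Ed \<alpha>) \<le> 1 * s" using a card_Ed by simp
    have "(\<Sum>\<beta>\<in>through e. \<Sum>\<gamma>\<in>through e. \<Sum>\<delta>\<in>through e. P (Ed \<alpha> \<union> Ed \<beta> \<union> Ed \<gamma> \<union> Ed \<delta>))
        \<le> (\<Sum>\<beta>\<in>through e. \<Sum>\<gamma>\<in>through e. \<Lambda> * y e * P (Ed \<alpha> \<union> Ed \<beta> \<union> Ed \<gamma>))"
    proof (intro sum_mono step)
      fix \<beta> \<gamma> assume "\<beta> \<in> through e" "\<gamma> \<in> through e"
      note b = this[THEN through_sub]
      show "card (Ed \<alpha> \<union> Ed \<beta> \<union> Ed \<gamma>) \<le> 3 * s"
        using card_Un_Ed[OF card_Un_Ed[OF ca, of \<beta>], of \<gamma>] b by (simp add: numeral_3_eq_3)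
    qed (use a in \<open>auto dest: through_sub\<close>)
    also have "\<dots> = (\<Sum>\<beta>\<in>through e. \<Lambda> * y e * (\<Sum>\<gamma>\<in>through e. P (Ed \<alpha> \<union> Ed \<beta> \<union> Ed \<gamma>)))"
      by (simp add: sum_distrib_left)
    also have "\<dots> \<le> (\<Sum>\<beta>\<in>through e. \<Lambda> * y e * (\<Lambda> * y e * P (Ed \<alpha> \<union> Ed \<beta>)))"
    proof (intro sum_mono mult_left_mono step y0)
      fix \<beta> assume "\<beta> \<in> through e"
      note b = this[THEN through_sub]
      show "card (Ed \<alpha> \<union> Ed \<beta>) \<le> 3 * s"
        using card_Un_Ed[OF ca, of \<beta>] b by simp
    qed (use a in \<open>auto dest: through_sub\<close>)
    also have "\<dots> = \<Lambda> * y e * (\<Lambda> * y e) * (\<Sum>\<beta>\<in>through e. P (Ed \<alpha> \<union> Ed \<beta>))"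
      by (simp add: sum_distrib_left mult_ac)
    also have "\<dots> \<le> \<Lambda> * y e * (\<Lambda> * y e) * (\<Lambda> * y e * P (Ed \<alpha>))"
      using a y0 ca by (intro mult_left_mono step) auto
    also have "\<dots> = \<Lambda> ^ 3 * y e ^ 3 * P (Ed \<alpha>)" by (simp add: power3_eq_cube)
    finally have "(1 - p e) * (\<Sum>\<beta>\<in>through e. \<Sum>\<gamma>\<in>through e. \<Sum>\<delta>\<in>through e. P (Ed \<alpha> \<union> Ed \<beta> \<union> Ed \<gamma> \<union> Ed \<delta>))
        \<le> (1 - p e) * (\<Lambda> ^ 3 * y e ^ 3 * P (Ed \<alpha>))"
      using a q_nonneg by (intro mult_left_mono) auto
    also have "\<dots> = \<Lambda> ^ 3 * ((1 - p e) * y e ^ 3) * P (Ed \<alpha>)" by (simp add: mult_ac)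
    also have "\<dots> \<le> \<Lambda> ^ 3 * \<kappa> * P (Ed \<alpha>)"
      using a \<kappa>(1)[of e] P_R_nonneg[of "Ed \<alpha>"] Lam_nonneg
      by (intro mult_right_mono mult_left_mono) auto
    finally show "(\<Sum>\<beta>\<in>through e. \<Sum>\<gamma>\<in>through e. \<Sum>\<delta>\<in>through e.
        (1 - p e) * P (Ed \<alpha> \<union> Ed \<beta> \<union> Ed \<gamma> \<union> Ed \<delta>)) \<le> \<Lambda> ^ 3 * \<kappa> * P (Ed \<alpha>)"
      by (simp add: sum_distrib_left)
  qed
  also have "\<dots> \<le> real s * (\<Sum>\<alpha>\<in>I. \<Lambda> ^ 3 * \<kappa> * P (Ed \<alpha>))"
    using Lam_nonneg \<kappa>(2) by (intro sum_through_le mult_nonneg_nonneg P_R_nonneg) auto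
  also have "\<dots> = real s * (\<Lambda> ^ 3 * \<kappa> * (\<Sum>\<alpha>\<in>I. P (Ed \<alpha>)))" by (simp add: sum_distrib_left)
  also have "\<dots> \<le> real s * (\<Lambda> ^ 3 * \<kappa> * \<Lambda>)"
    using Lam_nonneg \<kappa>(2) total_le by (intro mult_left_mono) auto
  finally show ?thesis by (simp add: power_numeral_reduce mult_ac)
qed

text \<open>
  The factor \<open>1 - p e\<close> at a shared site compensates the extension factor \<open>y e\<close>.
\<close>

lemma one_edge_le:
  assumes \<kappa>: "\<And>e. e \<in> R \<Longrightarrow> (1 - p e) * y e \<le> \<kappa>" "0 \<le> \<kappa>"
    and \<Gamma>: "\<Gamma> \<subseteq> R" "card \<Gamma> \<le> 2 * s" and \<gamma>: "\<gamma> \<in> I"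
  shows "(\<Sum>e\<in>Ed \<gamma> \<inter> K. (1 - p e) * (\<Sum>\<delta>\<in>through e. P (\<Gamma> \<union> Ed \<gamma> \<union> Ed \<delta>))) \<le>
      real s * \<kappa> * \<Lambda> * P (\<Gamma> \<union> Ed \<gamma>)"
proof -
  have P0: "0 \<le> P (\<Gamma> \<union> Ed \<gamma>)" using \<Gamma> \<gamma> by (intro P_R_nonneg) auto
  have "(\<Sum>e\<in>Ed \<gamma> \<inter> K. (1 - p e) * (\<Sum>\<delta>\<in>through e. P (\<Gamma> \<union> Ed \<gamma> \<union> Ed \<delta>))) \<le>
      (\<Sum>e\<in>Ed \<gamma> \<inter> K. \<kappa> * \<Lambda> * P (\<Gamma> \<union> Ed \<gamma>))"
  proof (rule sum_mono)
    fix e assume e: "e \<in> Ed \<gamma> \<inter> K"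
    then have eR: "e \<in> R" using \<gamma> by auto
    have "(1 - p e) * (\<Sum>\<delta>\<in>through e. P (\<Gamma> \<union> Ed \<gamma> \<union> Ed \<delta>)) \<le> (1 - p e) * (\<Lambda> * y e * P (\<Gamma> \<union> Ed \<gamma>))"
      using e \<gamma> \<Gamma> card_Un_Ed[OF \<Gamma>(2) \<gamma>] q_nonneg[OF eR]
      by (intro mult_left_mono step) (auto simp: numeral_3_eq_3 numeral_2_eq_2)
    also have "\<dots> = ((1 - p e) * y e) * (\<Lambda> * P (\<Gamma> \<union> Ed \<gamma>))" by (simp add: mult_ac)
    also have "\<dots> \<le> \<kappa> * (\<Lambda> * P (\<Gamma> \<union> Ed \<gamma>))"
      using \<kappa>(1)[OF eR] Lam_nonneg P0 by (intro mult_right_mono) auto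
    finally show "(1 - p e) * (\<Sum>\<delta>\<in>through e. P (\<Gamma> \<union> Ed \<gamma> \<union> Ed \<delta>)) \<le> \<kappa> * \<Lambda> * P (\<Gamma> \<union> Ed \<gamma>)"
      by (simp add: mult_ac)
  qed
  also have "\<dots> \<le> real s * (\<kappa> * \<Lambda> * P (\<Gamma> \<union> Ed \<gamma>))"
  proof -
    have "card (Ed \<gamma> \<inter> K) \<le> s"
      using card_Ed[OF \<gamma>] card_mono[of "Ed \<gamma>" "Ed \<gamma> \<inter> K"] finite_Ed[OF \<gamma>] by simp
    then show ?thesis using \<kappa>(2) Lam_nonneg P0 by (simp add: mult_right_mono)
  qed
  finally show ?thesis by (simp add: mult_ac)
qed

text \<open>
  A linked quadruple is reached from its first set by three extensions: through the site of the first
  pair, through a site \<open>f\<close> common to both pairs, and through the site of the second pair. The first and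
  the last one come with a factor \<open>1 - p\<close>. By symmetry of the second pair, \<open>f\<close> may be taken in its
  first set at the cost of a factor \<open>2\<close>.
\<close>

lemma linked_le:
  assumes \<kappa>: "\<And>e. e \<in> R \<Longrightarrow> (1 - p e) * y e \<le> \<kappa>" "0 \<le> \<kappa>"
    and \<mu>: "\<And>e. e \<in> R \<Longrightarrow> y e \<le> \<mu>" "0 \<le> \<mu>"
  shows "linked_sum \<le> 4 * real s ^ 3 * \<kappa>\<^sup>2 * \<mu> * \<Lambda> ^ 4"
proof -
  define X where "X \<Gamma> = (\<Sum>e\<in>K. \<Sum>\<gamma>\<in>through e. \<Sum>\<delta>\<in>through e.
      of_bool (\<Gamma> \<inter> Ed \<gamma> \<noteq> {}) * ((1 - p e) * P (\<Gamma> \<union> Ed \<gamma> \<union> Ed \<delta>)))" for \<Gamma>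
  have X: "X \<Gamma> \<le> 2 * real s ^ 2 * \<kappa> * \<mu> * \<Lambda>\<^sup>2 * P \<Gamma>" if \<Gamma>: "\<Gamma> \<subseteq> R" "card \<Gamma> \<le> 2 * s" for \<Gamma>
  proof -
    have fin: "finite \<Gamma>" using \<Gamma> finite_R finite_subset by blast
    have "X \<Gamma> = (\<Sum>\<gamma>\<in>I. \<Sum>e\<in>Ed \<gamma> \<inter> K. \<Sum>\<delta>\<in>through e.
      of_bool (\<Gamma> \<inter> Ed \<gamma> \<noteq> {}) * ((1 - p e) * P (\<Gamma> \<union> Ed \<gamma> \<union> Ed \<delta>)))"
      unfolding X_def by (rule sum_through)
    also have "\<dots> = (\<Sum>\<gamma>\<in>I. of_bool (\<Gamma> \<inter> Ed \<gamma> \<noteq> {}) *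
        (\<Sum>e\<in>Ed \<gamma> \<inter> K. (1 - p e) * (\<Sum>\<delta>\<in>through e. P (\<Gamma> \<union> Ed \<gamma> \<union> Ed \<delta>))))"
      by (simp add: sum_distrib_left)
    also have "\<dots> \<le> (\<Sum>\<gamma>\<in>I. of_bool (\<Gamma> \<inter> Ed \<gamma> \<noteq> {}) * (real s * \<kappa> * \<Lambda> * P (\<Gamma> \<union> Ed \<gamma>)))"
      by (intro sum_mono mult_left_mono one_edge_le \<kappa> \<Gamma>) auto
    also have "\<dots> \<le> (\<Sum>\<gamma>\<in>I. (\<Sum>f\<in>{f\<in>\<Gamma>. f \<in> Ed \<gamma>}. real s * \<kappa> * \<Lambda> * P (\<Gamma> \<union> Ed \<gamma>)))"
    proof (intro sum_mono)
      fix \<gamma> assume \<gamma>: "\<gamma> \<in> I"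
      have nn: "0 \<le> real s * \<kappa> * \<Lambda> * P (\<Gamma> \<union> Ed \<gamma>)"
        using \<kappa>(2) Lam_nonneg \<Gamma> \<gamma> by (intro mult_nonneg_nonneg P_R_nonneg) auto
      show "of_bool (\<Gamma> \<inter> Ed \<gamma> \<noteq> {}) * (real s * \<kappa> * \<Lambda> * P (\<Gamma> \<union> Ed \<gamma>)) \<le>
          (\<Sum>f\<in>{f\<in>\<Gamma>. f \<in> Ed \<gamma>}. real s * \<kappa> * \<Lambda> * P (\<Gamma> \<union> Ed \<gamma>))"
      proof (cases "\<Gamma> \<inter> Ed \<gamma> = {}")
        case False
        have "{f\<in>\<Gamma>. f \<in> Ed \<gamma>} = \<Gamma> \<inter> Ed \<gamma>" by auto
        moreover have "1 \<le> card (\<Gamma> \<inter> Ed \<gamma>)"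
          using False fin by (simp add: Suc_le_eq card_gt_0_iff)
        ultimately show ?thesis
          using False mult_right_mono[OF _ nn, of 1 "real (card (\<Gamma> \<inter> Ed \<gamma>))"] by simp
      qed (use nn in \<open>auto intro!: mult_nonneg_nonneg\<close>)
    qed
    also have "\<dots> = (\<Sum>f\<in>\<Gamma>. \<Sum>\<gamma>\<in>{\<gamma>\<in>I. f \<in> Ed \<gamma>}. real s * \<kappa> * \<Lambda> * P (\<Gamma> \<union> Ed \<gamma>))"
      by (rule sum.swap_restrict[OF finite_index fin])
    also have "\<dots> = (\<Sum>f\<in>\<Gamma>. real s * \<kappa> * \<Lambda> * (\<Sum>\<gamma>\<in>{\<gamma>\<in>I. f \<in> Ed \<gamma>}. P (\<Gamma> \<union> Ed \<gamma>)))"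
      by (simp add: sum_distrib_left)
    also have "\<dots> \<le> (\<Sum>f\<in>\<Gamma>. real s * \<kappa> * \<Lambda> * (\<Lambda> * \<mu> * P \<Gamma>))"
    proof (intro sum_mono mult_left_mono)
      fix f assume f: "f \<in> \<Gamma>"
      have "(\<Sum>\<gamma>\<in>{\<gamma>\<in>I. f \<in> Ed \<gamma>}. P (\<Gamma> \<union> Ed \<gamma>)) \<le> \<Lambda> * y f * P \<Gamma>"
        using f \<Gamma> by (intro extension_le) auto
      also have "\<dots> \<le> \<Lambda> * \<mu> * P \<Gamma>"
        using f \<Gamma> \<mu>(1)[of f] Lam_nonneg P_R_nonneg[OF \<Gamma>(1)]
        by (intro mult_right_mono mult_left_mono) auto
      finally show "(\<Sum>\<gamma>\<in>{\<gamma>\<in>I. f \<in> Ed \<gamma>}. P (\<Gamma> \<union> Ed \<gamma>)) \<le> \<Lambda> * \<mu> * P \<Gamma>" .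
    qed (use \<kappa>(2) Lam_nonneg in auto)
    also have "\<dots> = real (card \<Gamma>) * (real s * \<kappa> * \<Lambda> * (\<Lambda> * \<mu> * P \<Gamma>))" by simp
    also have "\<dots> \<le> real (2 * s) * (real s * \<kappa> * \<Lambda> * (\<Lambda> * \<mu> * P \<Gamma>))"
      using \<Gamma> \<kappa>(2) \<mu>(2) Lam_nonneg
      by (intro mult_right_mono mult_nonneg_nonneg P_R_nonneg) (auto simp flip: of_nat_mult)
    finally show ?thesis by (simp add: power2_eq_square mult_ac)
  qed
  have "linked_sum \<le> (\<Sum>j\<in>pairs. (1 - p (fst j)) * (2 * X (joint_edges j)))"
    unfolding linked_sum_def
  proof (rule sum_mono)
    fix j assume j: "j \<in> pairs"
    let ?\<Gamma> = "joint_edges j"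
    have jR: "joint_edges j' \<subseteq> R" if "j' \<in> pairs" for j'
      using that by (auto simp: pairs_def joint_edges_def through_def)
    have q: "0 \<le> 1 - p (fst j')" if "j' \<in> pairs" for j'
      using that by (intro q_nonneg) (auto simp: pairs_def through_def)
    have "(\<Sum>j'\<in>pairs. of_bool (?\<Gamma> \<inter> joint_edges j' \<noteq> {}) *
        ((1 - p (fst j)) * (1 - p (fst j')) * P (?\<Gamma> \<union> joint_edges j'))) =
      (1 - p (fst j)) * (\<Sum>j'\<in>pairs. of_bool (?\<Gamma> \<inter> joint_edges j' \<noteq> {}) *
        ((1 - p (fst j')) * P (?\<Gamma> \<union> joint_edges j')))"
      by (simp add: sum_distrib_left mult_ac)
    also have "\<dots> \<le> (1 - p (fst j)) * (\<Sum>j'\<in>pairs.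
        of_bool (?\<Gamma> \<inter> Ed (fst (snd j')) \<noteq> {}) * ((1 - p (fst j')) * P (?\<Gamma> \<union> joint_edges j')) +
        of_bool (?\<Gamma> \<inter> Ed (snd (snd j')) \<noteq> {}) * ((1 - p (fst j')) * P (?\<Gamma> \<union> joint_edges j')))"
    proof (intro mult_left_mono sum_mono)
      fix j' assume j': "j' \<in> pairs"
      have "0 \<le> (1 - p (fst j')) * P (?\<Gamma> \<union> joint_edges j')"
        using q[OF j'] jR j j' by (intro mult_nonneg_nonneg P_R_nonneg) auto
      then show "of_bool (?\<Gamma> \<inter> joint_edges j' \<noteq> {}) * ((1 - p (fst j')) * P (?\<Gamma> \<union> joint_edges j')) \<le>
        of_bool (?\<Gamma> \<inter> Ed (fst (snd j')) \<noteq> {}) * ((1 - p (fst j')) * P (?\<Gamma> \<union> joint_edges j')) +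
        of_bool (?\<Gamma> \<inter> Ed (snd (snd j')) \<noteq> {}) * ((1 - p (fst j')) * P (?\<Gamma> \<union> joint_edges j'))"
        by (auto simp: joint_edges_def)
    qed (use q[OF j] in auto)
    also have "\<dots> = (1 - p (fst j)) * (X ?\<Gamma> + X ?\<Gamma>)"
    proof -
      have "(\<Sum>j'\<in>pairs. of_bool (?\<Gamma> \<inter> Ed (fst (snd j')) \<noteq> {}) *
          ((1 - p (fst j')) * P (?\<Gamma> \<union> joint_edges j'))) = X ?\<Gamma>"
        unfolding sum_pairs X_def by (simp add: joint_edges_def[of "(_, _)"] Un_assoc)
      moreover have "(\<Sum>j'\<in>pairs. of_bool (?\<Gamma> \<inter> Ed (snd (snd j')) \<noteq> {}) *
          ((1 - p (fst j')) * P (?\<Gamma> \<union> joint_edges j'))) = X ?\<Gamma>"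
      proof -
        have "(\<Sum>j'\<in>pairs. of_bool (?\<Gamma> \<inter> Ed (snd (snd j')) \<noteq> {}) *
          ((1 - p (fst j')) * P (?\<Gamma> \<union> joint_edges j'))) = (\<Sum>e\<in>K. \<Sum>\<gamma>\<in>through e. \<Sum>\<delta>\<in>through e.
          of_bool (?\<Gamma> \<inter> Ed \<delta> \<noteq> {}) * ((1 - p e) * P (?\<Gamma> \<union> Ed \<delta> \<union> Ed \<gamma>)))"
          unfolding sum_pairs by (simp add: joint_edges_def[of "(_, _)"] Un_ac)
        also have "\<dots> = X ?\<Gamma>" unfolding X_def by (rule sum.cong[OF refl], rule sum.swap)
        finally show ?thesis .
      qed
      ultimately show ?thesis by (simp add: sum.distrib)
    qed
    finally show "(\<Sum>j'\<in>pairs. of_bool (?\<Gamma> \<inter> joint_edges j' \<noteq> {}) *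
        ((1 - p (fst j)) * (1 - p (fst j')) * P (?\<Gamma> \<union> joint_edges j'))) \<le>
      (1 - p (fst j)) * (2 * X ?\<Gamma>)" by simp
  qed
  also have "\<dots> \<le> (\<Sum>j\<in>pairs. (1 - p (fst j)) * (2 * (2 * real s ^ 2 * \<kappa> * \<mu> * \<Lambda>\<^sup>2 * P (joint_edges j))))"
  proof (intro sum_mono mult_left_mono X)
    fix j assume j: "j \<in> pairs"
    show "joint_edges j \<subseteq> R" using j by (auto simp: pairs_def joint_edges_def through_def)
    have "fst (snd j) \<in> I" "snd (snd j) \<in> I" using j by (auto simp: pairs_def through_def)
    from card_Un_Ed[of "Ed (fst (snd j))" 1, OF _ this(2)] card_Ed[OF this(1)]
    show "card (joint_edges j) \<le> 2 * s" by (simp add: joint_edges_def)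
    show "0 \<le> 1 - p (fst j)" using j by (intro q_nonneg) (auto simp: pairs_def through_def)
  qed auto
  also have "\<dots> = 4 * real s ^ 2 * \<kappa> * \<mu> * \<Lambda>\<^sup>2 * (\<Sum>j\<in>pairs. (1 - p (fst j)) * P (joint_edges j))"
    by (simp add: sum_distrib_left mult_ac)
  also have "\<dots> \<le> 4 * real s ^ 2 * \<kappa> * \<mu> * \<Lambda>\<^sup>2 * (real s * \<kappa> * \<Lambda> * \<Lambda>)"
  proof (rule mult_left_mono)
    have "(\<Sum>j\<in>pairs. (1 - p (fst j)) * P (joint_edges j)) =
        (\<Sum>e\<in>K. \<Sum>\<alpha>\<in>through e. (1 - p e) * (\<Sum>\<beta>\<in>through e. P ({} \<union> Ed \<alpha> \<union> Ed \<beta>)))"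
      unfolding sum_pairs by (simp add: joint_edges_def[of "(_, _)"] sum_distrib_left)
    also have "\<dots> = (\<Sum>\<alpha>\<in>I. \<Sum>e\<in>Ed \<alpha> \<inter> K. (1 - p e) * (\<Sum>\<beta>\<in>through e. P ({} \<union> Ed \<alpha> \<union> Ed \<beta>)))"
      by (rule sum_through)
    also have "\<dots> \<le> (\<Sum>\<alpha>\<in>I. real s * \<kappa> * \<Lambda> * P ({} \<union> Ed \<alpha>))"
      by (intro sum_mono one_edge_le \<kappa>) auto
    also have "\<dots> = real s * \<kappa> * \<Lambda> * (\<Sum>\<alpha>\<in>I. P (Ed \<alpha>))" by (simp add: sum_distrib_left)
    also have "\<dots> \<le> real s * \<kappa> * \<Lambda> * \<Lambda>"
      using total_le Lam_nonneg \<kappa>(2) by (intro mult_left_mono) auto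
    finally show "(\<Sum>j\<in>pairs. (1 - p (fst j)) * P (joint_edges j)) \<le> real s * \<kappa> * \<Lambda> * \<Lambda>" .
  qed (use \<kappa>(2) \<mu>(2) in auto)
  finally show ?thesis by (simp add: power_numeral_reduce mult_ac)
qed

lemma removed_le:
  assumes \<kappa>: "\<And>e. e \<in> R - K \<Longrightarrow> (1 - p e) * y e \<le> \<kappa>" "0 \<le> \<kappa>"
  shows "removed \<le> real s * \<kappa> * \<Lambda>\<^sup>2"
proof -
  have "removed \<le> (\<Sum>\<alpha>\<in>I. \<Sum>\<beta>\<in>I. \<Sum>e\<in>{e \<in> Ed \<alpha> - K. e \<in> Ed \<beta>}. (1 - p e) * P (Ed \<alpha> \<union> Ed \<beta>))"
    unfolding removed_def
  proof (intro sum_mono)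
    fix \<alpha> \<beta> assume ab: "\<alpha> \<in> I" "\<beta> \<in> I"
    have "1 - (\<Sum>e\<in>Ed \<alpha> \<inter> Ed \<beta> - K. 1 - p e) \<le> (\<Prod>e\<in>Ed \<alpha> \<inter> Ed \<beta> - K. 1 - (1 - p e))"
    proof (rule Weierstrass_prod_ineq)
      fix e assume "e \<in> Ed \<alpha> \<inter> Ed \<beta> - K"
      then have "e \<in> B" using ab Ed_sub by auto
      then show "1 - p e \<in> {0..1}" using p_pos p_less_1 by (simp add: less_imp_le)
    qed
    then have "1 - P (Ed \<alpha> \<inter> Ed \<beta> - K) \<le> (\<Sum>e\<in>Ed \<alpha> \<inter> Ed \<beta> - K. 1 - p e)" by simp
    moreover have "Ed \<alpha> \<inter> Ed \<beta> - K = {e \<in> Ed \<alpha> - K. e \<in> Ed \<beta>}" by auto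
    moreover have "0 \<le> P (Ed \<alpha> \<union> Ed \<beta>)" using ab by (intro P_R_nonneg) auto
    ultimately have "(1 - P (Ed \<alpha> \<inter> Ed \<beta> - K)) * P (Ed \<alpha> \<union> Ed \<beta>) \<le>
        (\<Sum>e\<in>{e \<in> Ed \<alpha> - K. e \<in> Ed \<beta>}. 1 - p e) * P (Ed \<alpha> \<union> Ed \<beta>)"
      by (intro mult_right_mono) auto
    then show "(1 - P (Ed \<alpha> \<inter> Ed \<beta> - K)) * P (Ed \<alpha> \<union> Ed \<beta>) \<le>
        (\<Sum>e\<in>{e \<in> Ed \<alpha> - K. e \<in> Ed \<beta>}. (1 - p e) * P (Ed \<alpha> \<union> Ed \<beta>))"
      by (simp add: sum_distrib_right)
  qed
  also have "\<dots> = (\<Sum>\<alpha>\<in>I. \<Sum>e\<in>Ed \<alpha> - K. \<Sum>\<beta>\<in>{\<beta> \<in> I. e \<in> Ed \<beta>}. (1 - p e) * P (Ed \<alpha> \<union> Ed \<beta>))"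
    by (intro sum.cong refl sum.swap_restrict finite_index) (use finite_Ed in auto)
  also have "\<dots> = (\<Sum>\<alpha>\<in>I. \<Sum>e\<in>Ed \<alpha> - K. (1 - p e) * (\<Sum>\<beta>\<in>{\<beta> \<in> I. e \<in> Ed \<beta>}. P (Ed \<alpha> \<union> Ed \<beta>)))"
    by (simp add: sum_distrib_left)
  also have "\<dots> \<le> (\<Sum>\<alpha>\<in>I. \<Sum>e\<in>Ed \<alpha> - K. \<kappa> * \<Lambda> * P (Ed \<alpha>))"
  proof (intro sum_mono)
    fix \<alpha> e assume \<alpha>: "\<alpha> \<in> I" and e: "e \<in> Ed \<alpha> - K"
    then have eR: "e \<in> R" by auto
    have "(1 - p e) * (\<Sum>\<beta>\<in>{\<beta> \<in> I. e \<in> Ed \<beta>}. P (Ed \<alpha> \<union> Ed \<beta>)) \<le> (1 - p e) * (\<Lambda> * y e * P (Ed \<alpha>))"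
      using e \<alpha> card_Ed[OF \<alpha>] q_nonneg[OF eR] by (intro mult_left_mono extension_le) auto
    also have "\<dots> = ((1 - p e) * y e) * (\<Lambda> * P (Ed \<alpha>))" by (simp add: mult_ac)
    also have "\<dots> \<le> \<kappa> * (\<Lambda> * P (Ed \<alpha>))"
      using \<kappa>(1)[of e] e eR by (intro mult_right_mono mult_nonneg_nonneg Lam_nonneg P_R_nonneg UN_upper \<alpha>) auto
    finally show "(1 - p e) * (\<Sum>\<beta>\<in>{\<beta> \<in> I. e \<in> Ed \<beta>}. P (Ed \<alpha> \<union> Ed \<beta>)) \<le> \<kappa> * \<Lambda> * P (Ed \<alpha>)"
      by (simp add: mult_ac)
  qed
  also have "\<dots> \<le> (\<Sum>\<alpha>\<in>I. real s * (\<kappa> * \<Lambda> * P (Ed \<alpha>)))"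
  proof (rule sum_mono)
    fix \<alpha> assume \<alpha>: "\<alpha> \<in> I"
    have "card (Ed \<alpha> - K) \<le> s"
      using card_Ed[OF \<alpha>] card_mono[of "Ed \<alpha>" "Ed \<alpha> - K"] finite_Ed[OF \<alpha>] by simp
    then show "(\<Sum>e\<in>Ed \<alpha> - K. \<kappa> * \<Lambda> * P (Ed \<alpha>)) \<le> real s * (\<kappa> * \<Lambda> * P (Ed \<alpha>))"
      using \<kappa>(2) Lam_nonneg P_R_nonneg[OF UN_upper[OF \<alpha>]]
      by (simp add: mult_right_mono)
  qed
  also have "\<dots> = real s * \<kappa> * \<Lambda> * (\<Sum>\<alpha>\<in>I. P (Ed \<alpha>))" by (simp add: sum_distrib_left mult_ac)
  also have "\<dots> \<le> real s * \<kappa> * \<Lambda> * \<Lambda>"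
    using total_le Lam_nonneg \<kappa>(2) by (intro mult_left_mono) auto
  finally show ?thesis by (simp add: power2_eq_square mult_ac)
qed

end

section \<open>Copies in the complete hypergraph\<close>

definition copies :: "'a hypergraph \<Rightarrow> nat \<Rightarrow> nat hypergraph set" where
  "copies H n = {H'. subhypergraph H' (complete_hypergraph n) \<and> hypergraph_iso H' H}"

locale random_copies =
  fixes H :: "'a hypergraph" and n :: nat and p :: "nat \<Rightarrow> real"
  assumes H: "hypergraph H" and edges_nonempty: "edges H \<noteq> {}"
    and n_ge: "card (verts H) \<le> n" and p01: "i \<in> {1..n} \<Longrightarrow> 0 < p i \<and> p i < 1"
begin

definition B :: "nat set set" where
  "B = edges (complete_hypergraph n)"

lemma B_eq: "B = Pow {1..n} - {{}}"
  by (simp add: B_def complete_hypergraph_def)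

lemma card_site: "e \<in> B \<Longrightarrow> card e \<in> {1..n}"
  using card_mono[of "{1..n}" e] finite_subset[of e "{1..n}"]
  by (auto simp: B_eq Suc_le_eq card_gt_0_iff)

sublocale bernoulli_field B "\<lambda>e. p (card e)"
  by standard (use p01 card_site in \<open>auto simp: B_eq\<close>)

lemma finite_verts: "finite (verts H)"
  using H by (simp add: hypergraph_def)

lemma finite_edges: "finite (edges H)"
  using H finite_subset[of "edges H" "Pow (verts H)"] by (auto simp: hypergraph_def)

lemma edge_sub: "e \<in> edges H \<Longrightarrow> e \<subseteq> verts H \<and> e \<noteq> {}"
  using H by (auto simp: hypergraph_def)

lemma card_edge: "e \<in> edges H \<Longrightarrow> card e \<in> {1..n}"
  using edge_sub[of e] finite_subset[OF _ finite_verts, of e] card_mono[OF finite_verts, of e] n_ge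
  by (auto simp: Suc_le_eq card_gt_0_iff)

abbreviation v :: nat where "v \<equiv> card (verts H)"
abbreviation s :: nat where "s \<equiv> card (edges H)"

lemma v_pos: "0 < v"
proof -
  obtain e where "e \<in> edges H" using edges_nonempty by blast
  with edge_sub[of e] finite_verts show ?thesis by (auto simp: card_gt_0_iff)
qed

lemma n_pos: "0 < n"
  using v_pos n_ge by simp

lemma copyD:
  assumes "\<alpha> \<in> copies H n"
  shows "verts \<alpha> \<subseteq> {1..n}" "edges \<alpha> \<subseteq> B" "edges \<alpha> \<subseteq> Pow (verts \<alpha>)" "finite (verts \<alpha>)" "card (verts \<alpha>) = v"
    and "\<exists>f. bij_betw f (verts \<alpha>) (verts H) \<and> edges H = (`) f ` edges \<alpha>"
proof -
  from assms obtain f where f: "bij_betw f (verts \<alpha>) (verts H)" "edges H = (`) f ` edges \<alpha>"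
    by (auto simp: copies_def hypergraph_iso_def)
  show "verts \<alpha> \<subseteq> {1..n}" "edges \<alpha> \<subseteq> B" "edges \<alpha> \<subseteq> Pow (verts \<alpha>)" "finite (verts \<alpha>)"
    using assms by (auto simp: copies_def subhypergraph_def complete_hypergraph_def B_eq hypergraph_def)
  show "card (verts \<alpha>) = v" using f(1) by (rule bij_betw_same_card)
  show "\<exists>f. bij_betw f (verts \<alpha>) (verts H) \<and> edges H = (`) f ` edges \<alpha>" using f by blast
qed

lemma sub_of_copy:
  assumes \<alpha>: "\<alpha> \<in> copies H n" and f: "bij_betw f (verts \<alpha>) (verts H)" "edges H = (`) f ` edges \<alpha>"
    and X: "X \<subseteq> edges \<alpha>"
  shows "card (f ` \<Union>X) = card (\<Union>X)" "inj_on ((`) f) X"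
    "(\<Prod>e\<in>(`) f ` X. g (card e)) = (\<Prod>e\<in>X. (g (card e) :: real))"
proof -
  have sub: "edges \<alpha> \<subseteq> Pow (verts \<alpha>)" by (rule copyD[OF \<alpha>])
  have inj: "inj_on f (verts \<alpha>)" using f(1) by (rule bij_betw_imp_inj_on)
  then have "inj_on f (\<Union>X)" using sub X by (auto intro: inj_on_subset)
  then show "card (f ` \<Union>X) = card (\<Union>X)" by (rule card_image)
  have "inj_on ((`) f) (Pow (verts \<alpha>))" using inj by (rule inj_on_image_Pow)
  then show i: "inj_on ((`) f) X" using sub X by (auto intro: inj_on_subset)
  have "card (f ` e) = card e" if "e \<in> X" for e
    using that sub X inj by (intro card_image) (auto intro: inj_on_subset)
  then show "(\<Prod>e\<in>(`) f ` X. g (card e)) = (\<Prod>e\<in>X. (g (card e) :: real))"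
    using i by (simp add: prod.reindex)
qed

lemma sub_of_copy_in_nonempty_subs:
  assumes \<alpha>: "\<alpha> \<in> copies H n" and G: "G \<subseteq> edges \<alpha>" and X: "X \<subseteq> G" "X \<noteq> {}"
  obtains F where "F \<in> nonempty_subs H" "card (verts F) = card (\<Union>G)"
    "\<And>g. (\<Prod>e\<in>edges F. g (card e)) = (\<Prod>e\<in>X. (g (card e) :: real))"
proof -
  obtain f where f: "bij_betw f (verts \<alpha>) (verts H)" "edges H = (`) f ` edges \<alpha>"
    using copyD(6)[OF \<alpha>] by blast
  have XE: "X \<subseteq> edges \<alpha>" using X G by blast
  define F where "F = \<lparr>verts = f ` \<Union>G, edges = (`) f ` X\<rparr>"
  have sub: "edges \<alpha> \<subseteq> Pow (verts \<alpha>)" by (rule copyD[OF \<alpha>])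
  have fV: "f ` verts \<alpha> = verts H" using f(1) by (rule bij_betw_imp_surj_on)
  have fG: "f ` \<Union>G \<subseteq> verts H"
  proof -
    have "\<Union>G \<subseteq> verts \<alpha>" using sub G by blast
    then show ?thesis using fV by blast
  qed
  have "finite (f ` \<Union>G)" using fG finite_verts finite_subset by blast
  moreover have "(`) f ` X \<subseteq> edges H" using XE f(2) by blast
  moreover have "(`) f ` X \<subseteq> Pow (f ` \<Union>G) - {{}}"
    using X \<open>(`) f ` X \<subseteq> edges H\<close> edge_sub by blast
  moreover have "finite ((`) f ` X)"
    using \<open>(`) f ` X \<subseteq> edges H\<close> finite_edges finite_subset by blast
  ultimately have "F \<in> nonempty_subs H"
    using fG X by (simp add: nonempty_subs_def subhypergraph_def hypergraph_def F_def Suc_le_eq card_gt_0_iff)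
  moreover have "card (verts F) = card (\<Union>G)"
    using sub_of_copy(1)[OF \<alpha> f G] by (simp add: F_def)
  moreover have "(\<Prod>e\<in>edges F. g (card e)) = (\<Prod>e\<in>X. (g (card e) :: real))" for g
    using sub_of_copy(3)[OF \<alpha> f XE] by (simp add: F_def)
  ultimately show ?thesis using that by blast
qed

abbreviation PH :: real where "PH \<equiv> edge_prob_prod p H"

lemma edge_p: "e \<in> edges H \<Longrightarrow> 0 < p (card e) \<and> p (card e) < 1"
  using card_edge p01 by blast

lemma PH_pos: "0 < PH"
  unfolding edge_prob_prod_def using edge_p by (intro prod_pos) blast

lemma P_copy:
  assumes \<alpha>: "\<alpha> \<in> copies H n"
  shows "P (edges \<alpha>) = PH" "card (edges \<alpha>) = s"
proof -
  obtain f where f: "bij_betw f (verts \<alpha>) (verts H)" "edges H = (`) f ` edges \<alpha>"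
    using copyD(6)[OF \<alpha>] by blast
  show "P (edges \<alpha>) = PH" "card (edges \<alpha>) = s"
    using sub_of_copy(2)[OF \<alpha> f order_refl] sub_of_copy(3)[OF \<alpha> f order_refl, of p] f(2)
    by (simp_all add: edge_prob_prod_def card_image)
qed

lemma card_edge_of_copy: "\<alpha> \<in> copies H n \<Longrightarrow> e \<in> edges \<alpha> \<Longrightarrow> \<exists>e'\<in>edges H. card e' = card e"
proof -
  assume \<alpha>: "\<alpha> \<in> copies H n" and e: "e \<in> edges \<alpha>"
  obtain f where f: "bij_betw f (verts \<alpha>) (verts H)" "edges H = (`) f ` edges \<alpha>"
    using copyD(6)[OF \<alpha>] by blast
  have "card (f ` e) = card e" using sub_of_copy(1)[OF \<alpha> f, of "{e}"] e by simp
  then show ?thesis using f(2) e by blast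
qed

abbreviation m :: real where "m \<equiv> min_PF H n p"
abbreviation M :: real where "M \<equiv> max_QF_PF H n p"

lemma nonempty_subsD:
  assumes "F \<in> nonempty_subs H"
  shows "0 < edge_prob_prod p F" "0 < nonedge_prob_prod p F" "edges F \<subseteq> edges H"
    "verts F \<subseteq> verts H" "edges F \<noteq> {}" "edges F \<subseteq> Pow (verts F)"
proof -
  show sub: "edges F \<subseteq> edges H" "verts F \<subseteq> verts H" "edges F \<noteq> {}" "edges F \<subseteq> Pow (verts F)"
    using assms by (auto simp: nonempty_subs_def subhypergraph_def hypergraph_def)
  show "0 < edge_prob_prod p F" "0 < nonedge_prob_prod p F"
    unfolding edge_prob_prod_def nonedge_prob_prod_def
    using sub(1) edge_p by (auto intro!: prod_pos)
qed

lemma m_le: "F \<in> nonempty_subs H \<Longrightarrow> m \<le> edge_prob_prod p F * real n ^ card (verts F)"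
  unfolding min_PF_def using finite_nonempty_subs[OF H] by (intro Min_le) auto

lemma m_pos: "0 < m"
  unfolding min_PF_def using finite_nonempty_subs[OF H] self_in_nonempty_subs[OF H edges_nonempty]
    nonempty_subsD(1) n_pos by (subst Min_gr_iff) auto

lemma M_ge: "F \<in> nonempty_subs H \<Longrightarrow>
    nonedge_prob_prod p F / (edge_prob_prod p F * real n ^ card (verts F)) \<le> M"
proof -
  assume F: "F \<in> nonempty_subs H"
  have "real n powi (- int (card (verts F))) * nonedge_prob_prod p F / edge_prob_prod p F \<le> M"
    unfolding max_QF_PF_def using F finite_nonempty_subs[OF H] by (intro Max_ge) auto
  then show ?thesis by (simp add: power_int_minus power_int_of_nat field_simps)
qed

lemma M_attained: "\<exists>F\<in>nonempty_subs H. M = nonedge_prob_prod p F / (edge_prob_prod p F * real n ^ card (verts F))"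
proof -
  have "M \<in> (\<lambda>F. real n powi (- int (card (verts F))) * nonedge_prob_prod p F / edge_prob_prod p F)
            ` nonempty_subs H"
    unfolding max_QF_PF_def using finite_nonempty_subs[OF H] self_in_nonempty_subs[OF H edges_nonempty]
    by (intro Max_in) auto
  then show ?thesis by (auto simp: power_int_minus power_int_of_nat field_simps)
qed

lemma M_pos: "0 < M"
  using M_attained nonempty_subsD n_pos by auto

lemma single_edge:
  assumes "e \<in> edges H"
  shows "m \<le> p (card e) * real n ^ card e"
    and "(1 - p (card e)) / real n ^ card e \<le> M"
proof -
  define F where "F = \<lparr>verts = e, edges = {e}\<rparr>"
  have "F \<in> nonempty_subs H"
    using edge_sub[OF assms] assms finite_subset[OF _ finite_verts]
    by (auto simp: nonempty_subs_def subhypergraph_def hypergraph_def F_def)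
  from m_le[OF this] M_ge[OF this]
  have *: "m \<le> p (card e) * real n ^ card e" "(1 - p (card e)) / (p (card e) * real n ^ card e) \<le> M"
    by (simp_all add: F_def edge_prob_prod_def nonedge_prob_prod_def)
  show "m \<le> p (card e) * real n ^ card e" by (rule *(1))
  have "(1 - p (card e)) / real n ^ card e \<le> (1 - p (card e)) / (p (card e) * real n ^ card e)"
    using edge_p[OF assms] n_pos by (intro divide_left_mono) (auto intro!: mult_pos_pos mult_left_le_one_le)
  with *(2) show "(1 - p (card e)) / real n ^ card e \<le> M" by simp
qed

text \<open>
  Bounds \<open>1 / (P_F * n ^ v_F)\<close> for subhypergraphs \<open>F\<close> of \<open>H\<close> with an edge of size \<open>k\<close>.
\<close>

definition y :: "nat \<Rightarrow> real" where
  "y k = min (1 / m) (1 / real n ^ k + 2 ^ s * M)"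

text \<open>
  For the second bound, \<open>1 / P G\<close> is the product of \<open>1 + (1 - p) / p\<close> over the edges of \<open>G\<close>. Expanding
  it, the empty set contributes \<open>1\<close> and each of the fewer than \<open>2 ^ s\<close> other sets at most \<open>M\<close> times the
  power of \<open>n\<close>.
\<close>

lemma inverse_P_le_y:
  assumes \<alpha>: "\<alpha> \<in> copies H n" and G: "G \<subseteq> edges \<alpha>" and e: "e \<in> G"
  shows "1 / P G \<le> real n ^ card (\<Union>G) * y (card e)"
proof -
  have GB: "G \<subseteq> B" using copyD(2)[OF \<alpha>] G by blast
  have PG: "0 < P G" by (rule P_pos[OF GB])
  have finG: "finite G" using GB finite_sites finite_subset by blast
  let ?N = "real n ^ card (\<Union>G)"
  have N: "0 < ?N" using n_pos by simp
  have "1 / P G \<le> ?N * (1 / m)"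
  proof -
    obtain F where F: "F \<in> nonempty_subs H" "card (verts F) = card (\<Union>G)"
      "\<And>g. (\<Prod>e\<in>edges F. g (card e)) = (\<Prod>e\<in>G. (g (card e) :: real))"
      using sub_of_copy_in_nonempty_subs[OF \<alpha> G order_refl] e by blast
    have "m \<le> P G * ?N" using m_le[OF F(1)] F(2,3) by (simp add: edge_prob_prod_def)
    then show ?thesis using PG m_pos by (simp add: field_simps)
  qed
  moreover have "1 / P G \<le> ?N * (1 / real n ^ card e + 2 ^ s * M)"
  proof -
    \<comment> \<open>The set \<open>X\<close> is viewed as a subhypergraph on all vertices of \<open>G\<close>, so that the power of \<open>n\<close> matches.\<close>
    have summand_le: "(\<Prod>a\<in>X. (1 - p (card a)) / p (card a)) \<le> ?N * M" if X: "X \<subseteq> G" "X \<noteq> {}" for X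
    proof -
      obtain F where F: "F \<in> nonempty_subs H" "card (verts F) = card (\<Union>G)"
        "\<And>g. (\<Prod>e\<in>edges F. g (card e)) = (\<Prod>e\<in>X. (g (card e) :: real))"
        using sub_of_copy_in_nonempty_subs[OF \<alpha> G X] by blast
      have "(\<Prod>a\<in>X. (1 - p (card a)) / p (card a)) = nonedge_prob_prod p F / edge_prob_prod p F"
        using F(3)[of "\<lambda>k. (1 - p k) / p k"]
        by (simp add: nonedge_prob_prod_def edge_prob_prod_def prod_dividef)
      also have "\<dots> = ?N * (nonedge_prob_prod p F / (edge_prob_prod p F * real n ^ card (verts F)))"
        using N F(2) by simp
      also have "\<dots> \<le> ?N * M" using M_ge[OF F(1)] N by (intro mult_left_mono) auto
      finally show ?thesis .
    qed
    have "1 / P G = (\<Prod>a\<in>G. 1 / p (card a))" by (simp add: prod_dividef)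
    also have "\<dots> = (\<Prod>a\<in>G. (1 - p (card a)) / p (card a) + 1)"
    proof (intro prod.cong refl)
      fix a assume "a \<in> G"
      then have "0 < p (card a)" using GB p_pos by auto
      then show "1 / p (card a) = (1 - p (card a)) / p (card a) + 1" by (simp add: field_simps)
    qed
    also have "\<dots> = (\<Sum>X\<in>Pow G. (\<Prod>a\<in>X. (1 - p (card a)) / p (card a)) * (\<Prod>a\<in>G - X. 1))"
      by (rule prod_add[OF finG])
    also have "\<dots> = 1 + (\<Sum>X\<in>Pow G - {{}}. (\<Prod>a\<in>X. (1 - p (card a)) / p (card a)))"
      using finG by (subst sum.remove[of _ "{}"]) auto
    also have "\<dots> \<le> 1 + (\<Sum>X\<in>Pow G - {{}}. ?N * M)"
      by (intro add_left_mono sum_mono summand_le) auto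
    also have "\<dots> = 1 + real (card (Pow G - {{}})) * (?N * M)" by simp
    also have "\<dots> \<le> ?N * (1 / real n ^ card e) + 2 ^ s * (?N * M)"
    proof (rule add_mono)
      have "card e \<le> card (\<Union>G)"
      proof (rule card_mono)
        have "\<Union>G \<subseteq> {1..n}" using GB unfolding B_eq by blast
        then show "finite (\<Union>G)" by (rule finite_subset) simp
      qed (use e in auto)
      then have "real n ^ card e \<le> ?N" using n_pos by (intro power_increasing) auto
      then show "1 \<le> ?N * (1 / real n ^ card e)" using n_pos by simp
      have "card (Pow G - {{}}) \<le> card (Pow G)" using finG by (intro card_mono) auto
      also have "\<dots> = 2 ^ card G" using finG by (rule card_Pow)
      also have "\<dots> \<le> 2 ^ s"
      proof (rule power_increasing)
        have "finite (edges \<alpha>)" using copyD(2)[OF \<alpha>] finite_sites finite_subset by blast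
        then show "card G \<le> s" using card_mono[OF _ G] P_copy(2)[OF \<alpha>] by simp
      qed simp
      finally have "real (card (Pow G - {{}})) \<le> 2 ^ s" by (metis of_nat_le_iff of_nat_numeral of_nat_power)
      then show "real (card (Pow G - {{}})) * (?N * M) \<le> 2 ^ s * (?N * M)"
        using N M_pos by (intro mult_right_mono) auto
    qed
    finally show ?thesis by (simp add: algebra_simps)
  qed
  ultimately show ?thesis using N by (simp add: y_def min_mult_distrib_left)
qed

lemma card_copies_containing:
  assumes T: "T \<subseteq> {1..n}" "card T \<le> v"
  shows "finite {\<gamma> \<in> copies H n. T \<subseteq> verts \<gamma>}"
    "card {\<gamma> \<in> copies H n. T \<subseteq> verts \<gamma>} \<le> 2 ^ 2 ^ v * n ^ (v - card T)"
proof -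
  define S where "S = {S. S \<subseteq> {1..n} \<and> T \<subseteq> S \<and> card S = v}"
  have finS: "finite S" unfolding S_def by (rule finite_subset[of _ "Pow {1..n}"]) auto
  have finT: "finite T" using T finite_subset by blast
  have finX: "finite X" if "X \<in> S" for X
    using that finite_subset[of X "{1..n}"] by (auto simp: S_def)
  have sub: "(\<lambda>\<gamma>. (verts \<gamma>, edges \<gamma>)) ` {\<gamma> \<in> copies H n. T \<subseteq> verts \<gamma>} \<subseteq> (SIGMA X:S. Pow (Pow X))"
    using copyD by (force simp: S_def)
  have inj: "inj_on (\<lambda>\<gamma>. (verts \<gamma>, edges \<gamma>)) {\<gamma> \<in> copies H n. T \<subseteq> verts \<gamma>}"
    by (auto intro!: inj_onI)
  have fin: "finite (SIGMA X:S. Pow (Pow X))"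
    using finS finX by (intro finite_SigmaI) auto
  show "finite {\<gamma> \<in> copies H n. T \<subseteq> verts \<gamma>}"
    using inj_on_finite[OF inj sub fin] .
  have "card {\<gamma> \<in> copies H n. T \<subseteq> verts \<gamma>} \<le> card (SIGMA X:S. Pow (Pow X))"
    by (rule card_inj_on_le[OF inj sub fin])
  also have "\<dots> = (\<Sum>X\<in>S. card (Pow (Pow X)))"
    using finS finX by (intro card_SigmaI) auto
  also have "\<dots> = (\<Sum>X\<in>S. 2 ^ 2 ^ v)"
  proof (intro sum.cong refl)
    fix X assume "X \<in> S"
    then have "card X = v" "finite X" using finX[of X] by (simp_all add: S_def)
    then show "card (Pow (Pow X)) = 2 ^ 2 ^ v" by (simp only: card_Pow finite_Pow_iff)
  qed
  also have "\<dots> = card S * 2 ^ 2 ^ v" by simp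
  also have "card S \<le> n ^ (v - card T)"
  proof -
    have "card S \<le> card {X. X \<subseteq> {1..n} \<and> card X = v - card T}"
    proof (rule card_inj_on_le[of "\<lambda>X. X - T"])
      show "inj_on (\<lambda>X. X - T) S" by (auto intro!: inj_onI simp: S_def)
      show "(\<lambda>X. X - T) ` S \<subseteq> {X. X \<subseteq> {1..n} \<and> card X = v - card T}"
        using finT by (auto simp: S_def card_Diff_subset)
      show "finite {X. X \<subseteq> {1..n} \<and> card X = v - card T}"
        by (rule finite_subset[of _ "Pow {1..n}"]) auto
    qed
    also have "\<dots> = n choose (v - card T)" using n_subsets[of "{1..n}"] by simp
    also have "\<dots> \<le> n ^ (v - card T)" using n_ge by (intro binomial_le_pow) simp
    finally show ?thesis .
  qed
  finally show "card {\<gamma> \<in> copies H n. T \<subseteq> verts \<gamma>} \<le> 2 ^ 2 ^ v * n ^ (v - card T)"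
    by (simp add: mult.commute)
qed

lemma finite_copies: "finite (copies H n)"
  using card_copies_containing(1)[of "{}"] by simp

lemma card_copies_le: "card (copies H n) \<le> 2 ^ 2 ^ v * n ^ v"
  using card_copies_containing(2)[of "{}"] by simp

lemma card_copies_ge: "(real n / real v) ^ v \<le> real (card (copies H n))"
proof -
  have "{S. S \<subseteq> {1..n} \<and> card S = v} \<subseteq> verts ` copies H n"
  proof safe
    fix S assume S: "S \<subseteq> {1..n}" "card S = v"
    then have "finite S" by (auto intro: finite_subset)
    with S finite_verts obtain g where g: "bij_betw g (verts H) S"
      using finite_same_card_bij by metis
    define \<alpha> where "\<alpha> = \<lparr>verts = S, edges = (`) g ` edges H\<rparr>"
    let ?f = "inv_into (verts H) g"
    have inj: "inj_on g (verts H)" and gS: "g ` verts H = S"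
      using g by (auto simp: bij_betw_def)
    have "bij_betw ?f S (verts H)" using g by (rule bij_betw_inv_into)
    moreover have "?f ` g ` e = e" if "e \<in> edges H" for e
      using inj edge_sub[OF that] by (intro inv_into_image_cancel) auto
    then have "edges H = (`) ?f ` (`) g ` edges H" by (force simp: image_image)
    ultimately have "hypergraph_iso \<alpha> H" unfolding hypergraph_iso_def \<alpha>_def by auto
    moreover have "(`) g ` edges H \<subseteq> Pow S - {{}}" using edge_sub gS by blast
    ultimately have "\<alpha> \<in> copies H n"
      using S \<open>finite S\<close>
      by (auto simp: copies_def subhypergraph_def hypergraph_def complete_hypergraph_def \<alpha>_def)
    then show "S \<in> verts ` copies H n" by (rule rev_image_eqI) (simp add: \<alpha>_def)
  qed
  then have "card {S. S \<subseteq> {1..n} \<and> card S = v} \<le> card (copies H n)"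
    by (rule surj_card_le[OF finite_copies])
  then have "n choose v \<le> card (copies H n)"
    using n_subsets[of "{1..n}" v] by simp
  moreover have "(real n / real v) ^ v \<le> real (n choose v)"
    using n_ge by (rule binomial_ge_n_over_k_pow_k)
  ultimately show ?thesis by linarith
qed

definition \<Lambda> :: real where
  "\<Lambda> = 2 ^ (3 * s) * 2 ^ 2 ^ v * real n ^ v * PH"

lemma total_copies_le: "(\<Sum>\<alpha>\<in>copies H n. P (edges \<alpha>)) \<le> \<Lambda>"
proof -
  have "(\<Sum>\<alpha>\<in>copies H n. P (edges \<alpha>)) = real (card (copies H n)) * PH"
    by (simp add: P_copy)
  also have "\<dots> \<le> real (2 ^ 2 ^ v * n ^ v) * PH"
    using card_copies_le PH_pos by (intro mult_right_mono) (auto simp only: of_nat_le_iff less_imp_le)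
  also have "\<dots> = 1 * (2 ^ 2 ^ v * real n ^ v * PH)" by simp
  also have "\<dots> \<le> 2 ^ (3 * s) * (2 ^ 2 ^ v * real n ^ v * PH)"
    using PH_pos by (intro mult_right_mono) auto
  finally show ?thesis by (simp add: \<Lambda>_def mult.assoc)
qed

lemma y_nonneg: "0 \<le> y k"
  using m_pos M_pos by (simp add: y_def)

text \<open>
  The copies \<open>\<gamma>\<close> are classified by their intersection \<open>G\<close> with \<open>\<Gamma>\<close>. Given \<open>G\<close>, at most a constant
  times \<open>n ^ (v - card (\<Union>G))\<close> copies contain it, and each increases the probability by the factor
  \<open>PH / P G\<close>.
\<close>

lemma copies_extension_le:
  assumes \<Gamma>: "\<Gamma> \<subseteq> \<Union> (edges ` copies H n)" "card \<Gamma> \<le> 3 * s" and e: "e \<in> \<Gamma>"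
  shows "(\<Sum>\<gamma>\<in>{\<gamma> \<in> copies H n. e \<in> edges \<gamma>}. P (\<Gamma> \<union> edges \<gamma>)) \<le> \<Lambda> * y (card e) * P \<Gamma>"
proof -
  define S where "S = {\<gamma> \<in> copies H n. e \<in> edges \<gamma>}"
  have finS: "finite S" using finite_copies by (simp add: S_def)
  have \<Gamma>B: "\<Gamma> \<subseteq> B" using \<Gamma>(1) copyD(2) by blast
  have fin\<Gamma>: "finite \<Gamma>" using \<Gamma>B finite_sites finite_subset by blast
  have P\<Gamma>: "0 < P \<Gamma>" by (rule P_pos[OF \<Gamma>B])
  let ?c = "2 ^ 2 ^ v * real n ^ v * PH * y (card e) * P \<Gamma>"
  have c0: "0 \<le> ?c" using PH_pos y_nonneg P\<Gamma> by simp
  have part: "(\<Sum>\<gamma>\<in>{\<gamma> \<in> S. \<Gamma> \<inter> edges \<gamma> = G}. P (\<Gamma> \<union> edges \<gamma>)) \<le> ?c" if "G \<in> Pow \<Gamma>" for G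
  proof (cases "{\<gamma> \<in> S. \<Gamma> \<inter> edges \<gamma> = G} = {}")
    case True
    then show ?thesis using c0 by (simp only: sum.empty)
  next
    case False
    then obtain \<gamma>0 where \<gamma>0: "\<gamma>0 \<in> copies H n" "e \<in> edges \<gamma>0" "\<Gamma> \<inter> edges \<gamma>0 = G" by (auto simp: S_def)
    have G: "G \<subseteq> edges \<gamma>0" "e \<in> G" "G \<subseteq> B" using \<gamma>0 e \<Gamma>B by auto
    have PG: "0 < P G" by (rule P_pos[OF G(3)])
    have T: "\<Union>G \<subseteq> verts \<gamma>0" using copyD(3)[OF \<gamma>0(1)] G by blast
    then have T': "\<Union>G \<subseteq> {1..n}" "card (\<Union>G) \<le> v"
      using copyD[OF \<gamma>0(1)] card_mono[of "verts \<gamma>0" "\<Union>G"] by auto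
    \<comment> \<open>All copies in this class have the same probability given \<open>\<Gamma>\<close>.\<close>
    have eq: "P (\<Gamma> \<union> edges \<gamma>) = P \<Gamma> * PH * (1 / P G)" if "\<gamma> \<in> S" "\<Gamma> \<inter> edges \<gamma> = G" for \<gamma>
    proof -
      have "P \<Gamma> * P (edges \<gamma>) = P (\<Gamma> \<union> edges \<gamma>) * P (\<Gamma> \<inter> edges \<gamma>)"
        using that \<Gamma>B copyD(2)[of \<gamma>] by (intro P_Un_Int) (auto simp: S_def)
      then show ?thesis using that PG P_copy(1)[of \<gamma>] by (simp add: S_def field_simps)
    qed
    have "(\<Sum>\<gamma>\<in>{\<gamma> \<in> S. \<Gamma> \<inter> edges \<gamma> = G}. P (\<Gamma> \<union> edges \<gamma>)) =
        real (card {\<gamma> \<in> S. \<Gamma> \<inter> edges \<gamma> = G}) * (P \<Gamma> * PH * (1 / P G))"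
      by (simp add: eq)
    also have "\<dots> \<le> real (2 ^ 2 ^ v * n ^ (v - card (\<Union>G))) * (P \<Gamma> * PH * (real n ^ card (\<Union>G) * y (card e)))"
    proof (rule mult_mono)
      have "{\<gamma> \<in> S. \<Gamma> \<inter> edges \<gamma> = G} \<subseteq> {\<gamma> \<in> copies H n. \<Union>G \<subseteq> verts \<gamma>}"
        using copyD(3) by (force simp: S_def)
      from card_mono[OF card_copies_containing(1)[OF T'] this] card_copies_containing(2)[OF T']
      show "real (card {\<gamma> \<in> S. \<Gamma> \<inter> edges \<gamma> = G}) \<le> real (2 ^ 2 ^ v * n ^ (v - card (\<Union>G)))"
        by (intro of_nat_mono) linarith
      show "P \<Gamma> * PH * (1 / P G) \<le> P \<Gamma> * PH * (real n ^ card (\<Union>G) * y (card e))"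
        using inverse_P_le_y[OF \<gamma>0(1) G(1,2)] P\<Gamma> PH_pos by (intro mult_left_mono) auto
    qed (use P\<Gamma> PH_pos PG in auto)
    also have "\<dots> = 2 ^ 2 ^ v * (real n ^ (v - card (\<Union>G)) * real n ^ card (\<Union>G)) * PH * y (card e) * P \<Gamma>"
      by simp
    also have "real n ^ (v - card (\<Union>G)) * real n ^ card (\<Union>G) = real n ^ v"
      using T'(2) by (simp flip: power_add)
    finally show ?thesis .
  qed
  have "(\<Sum>\<gamma>\<in>S. P (\<Gamma> \<union> edges \<gamma>)) = (\<Sum>G\<in>Pow \<Gamma>. \<Sum>\<gamma>\<in>{\<gamma> \<in> S. \<Gamma> \<inter> edges \<gamma> = G}. P (\<Gamma> \<union> edges \<gamma>))"
    using finS fin\<Gamma> by (intro sum.group[symmetric]) auto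
  also have "\<dots> \<le> (\<Sum>G\<in>Pow \<Gamma>. ?c)" by (intro sum_mono part)
  also have "\<dots> = 2 ^ card \<Gamma> * ?c" using fin\<Gamma> by (simp add: card_Pow)
  also have "\<dots> \<le> 2 ^ (3 * s) * ?c" using \<Gamma>(2) c0 by (intro mult_right_mono power_increasing) auto
  finally show ?thesis by (simp add: S_def \<Lambda>_def mult_ac)
qed

end

section \<open>A lower bound for the variance\<close>

context bernoulli_field
begin

abbreviation Q :: "'b set \<Rightarrow> real" where
  "Q A \<equiv> (\<Prod>a\<in>A. 1 - p a)"

text \<open>
  The products of centred variables form an orthogonal system; it is used to project the count.
\<close>

definition xi :: "'b set \<Rightarrow> ('b \<Rightarrow> bool) \<Rightarrow> real" where
  "xi G \<omega> = (\<Prod>a\<in>G. centred a \<omega>)"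

lemma E_two_products:
  assumes A: "A \<subseteq> B" and G: "G \<subseteq> B"
  shows "E (\<lambda>\<omega>. (\<Prod>a\<in>A. g a (\<omega> a)) * (\<Prod>a\<in>G. h a (\<omega> a))) =
    (\<Prod>a\<in>A \<union> G. p a * ((if a \<in> A then g a True else 1) * (if a \<in> G then h a True else 1)) +
      (1 - p a) * ((if a \<in> A then g a False else 1) * (if a \<in> G then h a False else 1)))"
proof -
  have fin: "finite (A \<union> G)" using A G finite_sites finite_subset by blast
  have "(\<Prod>a\<in>A. g a (\<omega> a)) * (\<Prod>a\<in>G. h a (\<omega> a)) =
      (\<Prod>a\<in>A \<union> G. (if a \<in> A then g a (\<omega> a) else 1) * (if a \<in> G then h a (\<omega> a) else 1))" for \<omega>
  proof -
    have "(\<Prod>a\<in>A. g a (\<omega> a)) = (\<Prod>a\<in>A \<union> G. if a \<in> A then g a (\<omega> a) else 1)"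
      using fin by (intro prod.mono_neutral_cong_left) auto
    moreover have "(\<Prod>a\<in>G. h a (\<omega> a)) = (\<Prod>a\<in>A \<union> G. if a \<in> G then h a (\<omega> a) else 1)"
      using fin by (intro prod.mono_neutral_cong_left) auto
    ultimately show ?thesis by (simp add: prod.distrib)
  qed
  then show ?thesis
    using E_prod[of "A \<union> G" "\<lambda>a b. (if a \<in> A then g a b else 1) * (if a \<in> G then h a b else 1)"] A G
    by simp
qed

lemma E_all_on_xi:
  assumes A: "A \<subseteq> B" and G: "G \<subseteq> B"
  shows "E (\<lambda>\<omega>. all_on A \<omega> * xi G \<omega>) = (if G \<subseteq> A then P A * Q G else 0)"
proof -
  have fin: "finite A" "finite G" using A G finite_sites finite_subset by blast+
  have "E (\<lambda>\<omega>. all_on A \<omega> * xi G \<omega>) =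
      (\<Prod>a\<in>A \<union> G. p a * ((if a \<in> A then of_bool True else 1) * (if a \<in> G then of_bool True - p a else 1)) +
      (1 - p a) * ((if a \<in> A then of_bool False else 1) * (if a \<in> G then of_bool False - p a else 1)))"
    using E_two_products[OF A G, of "\<lambda>_ b. of_bool b" "\<lambda>a b. of_bool b - p a"] fin
    by (simp add: all_on_eq_prod xi_def centred_def)
  also have "\<dots> = (\<Prod>a\<in>A \<union> G. if a \<in> A then p a * (if a \<in> G then 1 - p a else 1) else 0)"
    by (intro prod.cong refl) (auto simp: algebra_simps)
  also have "\<dots> = (if G \<subseteq> A then P A * Q G else 0)"
  proof (cases "G \<subseteq> A")
    case True
    then have "A \<union> G = A" by auto
    moreover have "(\<Prod>a\<in>A. if a \<in> G then 1 - p a else 1) = Q G"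
      using fin True by (intro prod.mono_neutral_cong_right) auto
    ultimately show ?thesis using True by (simp add: prod.distrib)
  next
    case False
    then show ?thesis using fin by (auto intro!: prod_zero)
  qed
  finally show ?thesis .
qed

lemma E_xi_xi:
  assumes G: "G \<subseteq> B" "G' \<subseteq> B"
  shows "E (\<lambda>\<omega>. xi G \<omega> * xi G' \<omega>) = (if G = G' then P G * Q G else 0)"
proof -
  have fin: "finite G" "finite G'" using G finite_sites finite_subset by blast+
  have "E (\<lambda>\<omega>. xi G \<omega> * xi G' \<omega>) =
      (\<Prod>a\<in>G \<union> G'. p a * ((if a \<in> G then of_bool True - p a else 1) * (if a \<in> G' then of_bool True - p a else 1)) +
      (1 - p a) * ((if a \<in> G then of_bool False - p a else 1) * (if a \<in> G' then of_bool False - p a else 1)))"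
    using E_two_products[OF G, of "\<lambda>a b. of_bool b - p a" "\<lambda>a b. of_bool b - p a"]
    by (simp add: xi_def centred_def)
  also have "\<dots> = (\<Prod>a\<in>G \<union> G'. if a \<in> G \<inter> G' then p a * (1 - p a) else 0)"
    by (intro prod.cong refl) (auto simp: algebra_simps)
  also have "\<dots> = (if G = G' then P G * Q G else 0)"
  proof (cases "G = G'")
    case True
    then show ?thesis by (simp add: prod.distrib)
  next
    case False
    then show ?thesis using fin by (auto intro!: prod_zero)
  qed
  finally show ?thesis .
qed

text \<open>
  Cauchy-Schwarz against \<open>Y\<close>, the sum of the orthogonal products over the distinct sets \<open>g \<alpha>\<close>: every
  product over \<open>Ed \<alpha>\<close> correlates with the term of its own \<open>g \<alpha>\<close>, while the second moment of \<open>Y\<close> is only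
  proportional to the number of these sets.
\<close>

lemma variance_lower_bound:
  fixes I :: "'c set" and Ed g :: "'c \<Rightarrow> 'b set"
  assumes I: "finite I" and Ed: "\<And>\<alpha>. \<alpha> \<in> I \<Longrightarrow> Ed \<alpha> \<subseteq> B"
    and g: "\<And>\<alpha>. \<alpha> \<in> I \<Longrightarrow> g \<alpha> \<subseteq> Ed \<alpha>" "\<And>\<alpha>. \<alpha> \<in> I \<Longrightarrow> g \<alpha> \<noteq> {}"
    and a: "\<And>\<alpha>. \<alpha> \<in> I \<Longrightarrow> P (Ed \<alpha>) = a" "0 < a"
    and b: "\<And>\<alpha>. \<alpha> \<in> I \<Longrightarrow> P (g \<alpha>) = b" and c: "\<And>\<alpha>. \<alpha> \<in> I \<Longrightarrow> Q (g \<alpha>) = c" and bc: "0 < b" "0 < c"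
    and N: "real (card (g ` I)) \<le> N" "0 < N"
  shows "(real (card I) * a)\<^sup>2 * c / (b * N) \<le>
    E (\<lambda>\<omega>. ((\<Sum>\<alpha>\<in>I. all_on (Ed \<alpha>) \<omega>) - \<mu>)\<^sup>2)"
proof -
  define Y where "Y \<omega> = (\<Sum>G\<in>g ` I. xi G \<omega>)" for \<omega>
  define Z where "Z \<omega> = (\<Sum>\<alpha>\<in>I. all_on (Ed \<alpha>) \<omega>)" for \<omega>
  have gB: "G \<subseteq> B" "G \<noteq> {}" "P G = b" "Q G = c" if "G \<in> g ` I" for G
    using that Ed g b c by blast+
  have EY: "E Y = 0"
    unfolding Y_def[abs_def] E_sum
  proof (rule sum.neutral, rule ballI)
    fix G assume "G \<in> g ` I"
    then show "E (xi G) = 0"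
      using E_all_on_xi[of "{}" G] gB[of G] by (simp add: all_on_def)
  qed
  have "real (card I) * (a * c) \<le> E (\<lambda>\<omega>. Z \<omega> * Y \<omega>)"
  proof -
    have "E (\<lambda>\<omega>. Z \<omega> * Y \<omega>) = (\<Sum>\<alpha>\<in>I. \<Sum>G\<in>g ` I. E (\<lambda>\<omega>. all_on (Ed \<alpha>) \<omega> * xi G \<omega>))"
      unfolding Z_def Y_def sum_product E_sum ..
    also have "\<dots> = (\<Sum>\<alpha>\<in>I. \<Sum>G\<in>g ` I. if G \<subseteq> Ed \<alpha> then a * c else 0)"
      using gB Ed a by (intro sum.cong refl) (simp add: E_all_on_xi)
    also have "\<dots> \<ge> (\<Sum>\<alpha>\<in>I. a * c)"
    proof (intro sum_mono)
      fix \<alpha> assume \<alpha>: "\<alpha> \<in> I"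
      have "(\<Sum>G\<in>{g \<alpha>}. if G \<subseteq> Ed \<alpha> then a * c else 0) \<le> (\<Sum>G\<in>g ` I. if G \<subseteq> Ed \<alpha> then a * c else 0)"
        using I \<alpha> a bc by (intro sum_mono2) auto
      then show "a * c \<le> (\<Sum>G\<in>g ` I. if G \<subseteq> Ed \<alpha> then a * c else 0)" using g(1)[OF \<alpha>] by simp
    qed
    finally show ?thesis by simp
  qed
  also have "E (\<lambda>\<omega>. Z \<omega> * Y \<omega>) = E (\<lambda>\<omega>. (Z \<omega> - \<mu>) * Y \<omega>)"
    using EY by (simp add: left_diff_distrib)
  finally have "(real (card I) * (a * c))\<^sup>2 \<le> (E (\<lambda>\<omega>. (Z \<omega> - \<mu>) * Y \<omega>))\<^sup>2"
    using a bc by (intro power_mono) auto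
  also have "\<dots> \<le> E (\<lambda>\<omega>. (Z \<omega> - \<mu>)\<^sup>2) * E (\<lambda>\<omega>. (Y \<omega>)\<^sup>2)"
    by (rule E_Cauchy_Schwarz)
  also have "E (\<lambda>\<omega>. (Y \<omega>)\<^sup>2) = real (card (g ` I)) * (b * c)"
  proof -
    have "E (\<lambda>\<omega>. (Y \<omega>)\<^sup>2) = (\<Sum>G\<in>g ` I. \<Sum>G'\<in>g ` I. E (\<lambda>\<omega>. xi G \<omega> * xi G' \<omega>))"
      unfolding Y_def power2_eq_square sum_product E_sum ..
    also have "\<dots> = (\<Sum>G\<in>g ` I. \<Sum>G'\<in>g ` I. if G = G' then b * c else 0)"
      using gB by (intro sum.cong refl) (simp add: E_xi_xi)
    also have "\<dots> = (\<Sum>G\<in>g ` I. b * c)" using I by (intro sum.cong refl) (simp add: sum.delta)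
    finally show ?thesis by simp
  qed
  also have "E (\<lambda>\<omega>. (Z \<omega> - \<mu>)\<^sup>2) * (real (card (g ` I)) * (b * c)) \<le> E (\<lambda>\<omega>. (Z \<omega> - \<mu>)\<^sup>2) * (N * (b * c))"
    using N bc by (intro mult_left_mono mult_right_mono E_nonneg) auto
  finally have "(real (card I) * a)\<^sup>2 * c * c \<le> E (\<lambda>\<omega>. (Z \<omega> - \<mu>)\<^sup>2) * (b * N) * c"
    by (simp add: power2_eq_square mult_ac)
  then have "(real (card I) * a)\<^sup>2 * c \<le> E (\<lambda>\<omega>. (Z \<omega> - \<mu>)\<^sup>2) * (b * N)"
    using bc by simp
  then show ?thesis using bc N by (simp add: Z_def divide_le_eq)
qed

end

context random_copies
begin

text \<open>
  The sets \<open>g \<alpha>\<close> are the images in the copies of a subhypergraph \<open>F\<close> of \<open>H\<close> that attains the maximum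
  \<open>M\<close>. There are at most a constant times \<open>n ^ card (verts F)\<close> of them.
\<close>

lemma variance_ge:
  "(real n ^ v * PH)\<^sup>2 * M / (real v ^ (2 * v) * 2 ^ 2 ^ v) \<le>
    E (\<lambda>\<omega>. ((\<Sum>\<alpha>\<in>copies H n. all_on (edges \<alpha>) \<omega>) - \<mu>)\<^sup>2)"
proof -
  obtain F where F: "F \<in> nonempty_subs H"
    and MF: "M = nonedge_prob_prod p F / (edge_prob_prod p F * real n ^ card (verts F))"
    using M_attained by blast
  note FD = nonempty_subsD[OF F]
  have "\<forall>\<alpha>\<in>copies H n. \<exists>f. bij_betw f (verts \<alpha>) (verts H) \<and> edges H = (`) f ` edges \<alpha>"
    using copyD(6) by blast
  then obtain f where f: "\<And>\<alpha>. \<alpha> \<in> copies H n \<Longrightarrow> bij_betw (f \<alpha>) (verts \<alpha>) (verts H)"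
    "\<And>\<alpha>. \<alpha> \<in> copies H n \<Longrightarrow> edges H = (`) (f \<alpha>) ` edges \<alpha>" by metis
  define g where "g \<alpha> = {e \<in> edges \<alpha>. f \<alpha> ` e \<in> edges F}" for \<alpha>
  \<comment> \<open>Isolated vertices of \<open>F\<close> are not determined by the edge set \<open>g \<alpha>\<close>, so \<open>t\<close> may be smaller than \<open>card (verts F)\<close>.\<close>
  define t where "t = card (\<Union>(edges F))"
  have gsub: "g \<alpha> \<subseteq> edges \<alpha>" for \<alpha> by (auto simp: g_def)
  have fg: "(`) (f \<alpha>) ` g \<alpha> = edges F" if "\<alpha> \<in> copies H n" for \<alpha>
    using f(2)[OF that] FD(3) by (auto simp: g_def)
  have prod_g: "(\<Prod>e\<in>g \<alpha>. h (card e)) = (\<Prod>e\<in>edges F. (h (card e) :: real))" if "\<alpha> \<in> copies H n" for \<alpha> h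
    using sub_of_copy(3)[OF that f[OF that] gsub, of h] fg[OF that] by simp
  have card_g: "card (\<Union>(g \<alpha>)) = t" if "\<alpha> \<in> copies H n" for \<alpha>
  proof -
    have "f \<alpha> ` \<Union>(g \<alpha>) = \<Union>((`) (f \<alpha>) ` g \<alpha>)" by blast
    then show ?thesis using sub_of_copy(1)[OF that f[OF that] gsub] fg[OF that] by (simp add: t_def)
  qed
  have t_le: "t \<le> card (verts F)"
    unfolding t_def using FD(4,6) finite_verts by (intro card_mono) (auto intro: finite_subset)
  have vF: "card (verts F) \<le> v" using FD(4) finite_verts by (intro card_mono) auto
  have Ncard: "real (card (g ` copies H n)) \<le> 2 ^ 2 ^ v * real n ^ card (verts F)"
  proof -
    define S where "S = {X. X \<subseteq> {1..n} \<and> card X = t}"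
    have finS: "finite S" unfolding S_def by (rule finite_subset[of _ "Pow {1..n}"]) auto
    have finX: "finite X" if "X \<in> S" for X
      using that finite_subset[of X "{1..n}"] by (auto simp: S_def)
    have "g ` copies H n \<subseteq> (\<Union>X\<in>S. Pow (Pow X))"
    proof
      fix G assume "G \<in> g ` copies H n"
      then obtain \<alpha> where \<alpha>: "\<alpha> \<in> copies H n" "G = g \<alpha>" by blast
      have "\<Union>G \<subseteq> {1..n}" using copyD(2)[OF \<alpha>(1)] gsub[of \<alpha>] \<alpha>(2) unfolding B_eq by blast
      then have "\<Union>G \<in> S" using card_g[OF \<alpha>(1)] \<alpha>(2) by (simp add: S_def)
      then show "G \<in> (\<Union>X\<in>S. Pow (Pow X))" by blast
    qed
    then have "card (g ` copies H n) \<le> card (\<Union>X\<in>S. Pow (Pow X))"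
      using finS finX by (intro card_mono) auto
    also have "\<dots> \<le> (\<Sum>X\<in>S. card (Pow (Pow X)))" by (rule card_UN_le[OF finS])
    also have "\<dots> = (\<Sum>X\<in>S. 2 ^ 2 ^ t)"
    proof (intro sum.cong refl)
      fix X assume "X \<in> S"
      then have "card X = t" "finite X" using finX[of X] by (simp_all add: S_def)
      then show "card (Pow (Pow X)) = 2 ^ 2 ^ t" by (simp only: card_Pow finite_Pow_iff)
    qed
    also have "\<dots> = 2 ^ 2 ^ t * card S" by (simp only: sum_constant mult.commute of_nat_id)
    also have "card S = n choose t" using n_subsets[of "{1..n}" t] by (simp add: S_def)
    also have "2 ^ 2 ^ t * (n choose t) \<le> 2 ^ 2 ^ v * n ^ card (verts F)"
    proof (rule mult_mono)
      show "(2::nat) ^ 2 ^ t \<le> 2 ^ 2 ^ v" using t_le vF by (intro power_increasing) auto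
      have "n choose t \<le> n ^ t" using t_le vF n_ge by (intro binomial_le_pow) simp
      also have "\<dots> \<le> n ^ card (verts F)" using n_pos t_le by (intro power_increasing) auto
      finally show "n choose t \<le> n ^ card (verts F)" .
    qed auto
    finally have "real (card (g ` copies H n)) \<le> real (2 ^ 2 ^ v * n ^ card (verts F))"
      by (rule of_nat_mono)
    then show ?thesis by simp
  qed
  have lower: "(real (card (copies H n)) * PH)\<^sup>2 * nonedge_prob_prod p F /
      (edge_prob_prod p F * (2 ^ 2 ^ v * real n ^ card (verts F))) \<le>
    E (\<lambda>\<omega>. ((\<Sum>\<alpha>\<in>copies H n. all_on (edges \<alpha>) \<omega>) - \<mu>)\<^sup>2)"
  proof (rule variance_lower_bound[OF finite_copies, where g = g])
    fix \<alpha> assume \<alpha>: "\<alpha> \<in> copies H n"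
    show "edges \<alpha> \<subseteq> B" by (rule copyD(2)[OF \<alpha>])
    show "g \<alpha> \<noteq> {}" using fg[OF \<alpha>] FD(5) by auto
    show "P (g \<alpha>) = edge_prob_prod p F" using prod_g[OF \<alpha>, of p] by (simp add: edge_prob_prod_def)
    show "Q (g \<alpha>) = nonedge_prob_prod p F"
      using prod_g[OF \<alpha>, of "\<lambda>k. 1 - p k"] by (simp add: nonedge_prob_prod_def)
  qed (use gsub P_copy PH_pos FD Ncard n_pos in auto)
  have "(real n ^ v * PH)\<^sup>2 * M / (real v ^ (2 * v) * 2 ^ 2 ^ v) = ((real n / real v) ^ v * PH)\<^sup>2 * nonedge_prob_prod p F /
      (edge_prob_prod p F * (2 ^ 2 ^ v * real n ^ card (verts F)))"
  proof -
    have "((real n / real v) ^ v)\<^sup>2 = (real n ^ v)\<^sup>2 / real v ^ (2 * v)"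
      by (simp only: power_divide power_mult[symmetric] mult.commute[of v 2])
    moreover have "a * h * (q / (c * N)) / (w * d) = a / w * h * q / (c * (d * N))"
      for a h q c N w d :: real
      by (simp add: mult_ac)
    ultimately show ?thesis unfolding MF power_mult_distrib by simp
  qed
  also have "\<dots> \<le> (real (card (copies H n)) * PH)\<^sup>2 * nonedge_prob_prod p F /
      (edge_prob_prod p F * (2 ^ 2 ^ v * real n ^ card (verts F)))"
    using card_copies_ge PH_pos FD n_pos
    by (intro divide_right_mono mult_right_mono power_mono mult_nonneg_nonneg) (auto intro: less_imp_le)
  also note lower
  finally show ?thesis .
qed

end

section \<open>Normal approximation with some edge sizes averaged out\<close>

text \<open>
  The first constant bounds \<open>\<Lambda>\<^sup>2 * M\<close> in terms of the variance of the count, see \<open>Lam_sd\<close>; the second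
  collects all factors that the moment bounds accumulate. Both depend only on the numbers \<open>v\<close> of
  vertices and \<open>s\<close> of edges of \<open>H\<close>, which makes the final rates uniform in \<open>n\<close> and \<open>p\<close>.
\<close>

definition ratio_const :: "nat \<Rightarrow> nat \<Rightarrow> real" where
  "ratio_const v s = (2 ^ (3 * s) * 2 ^ 2 ^ v)\<^sup>2 * (real v ^ (2 * v) * 2 ^ 2 ^ v)"

definition rate_const :: "nat \<Rightarrow> nat \<Rightarrow> real" where
  "rate_const v s = 10 * real s ^ 2 * 2 ^ s * ratio_const v s"

context random_copies
begin

definition count :: "(nat set \<Rightarrow> bool) \<Rightarrow> real" where
  "count \<omega> = (\<Sum>\<alpha>\<in>copies H n. all_on (edges \<alpha>) \<omega>)"

definition sd :: real where
  "sd = sqrt (E (\<lambda>\<omega>. (count \<omega> - E count)\<^sup>2))"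

definition std_count :: "(nat set \<Rightarrow> bool) \<Rightarrow> real" where
  "std_count \<omega> = (count \<omega> - E count) / sd"

lemma s_pos: "1 \<le> s"
  using edges_nonempty finite_edges by (simp add: Suc_le_eq card_gt_0_iff)

lemma sd_sq: "sd\<^sup>2 = E (\<lambda>\<omega>. (count \<omega> - E count)\<^sup>2)"
  unfolding sd_def by (simp add: E_nonneg)

lemma variance_ge': "(real n ^ v * PH)\<^sup>2 * M / (real v ^ (2 * v) * 2 ^ 2 ^ v) \<le> sd\<^sup>2"
  unfolding sd_sq count_def by (rule variance_ge)

lemma sd_pos: "0 < sd"
proof -
  have "0 < (real n ^ v * PH)\<^sup>2 * M / (real v ^ (2 * v) * 2 ^ 2 ^ v)"
    using n_pos PH_pos M_pos v_pos by (intro divide_pos_pos mult_pos_pos) auto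
  with variance_ge' have "0 < sd\<^sup>2" by linarith
  moreover have "0 \<le> sd" unfolding sd_def by (intro real_sqrt_ge_zero E_nonneg) simp
  ultimately show ?thesis by (simp add: less_eq_real_def)
qed

lemma Lam_sd: "\<Lambda>\<^sup>2 * M \<le> ratio_const v s * sd\<^sup>2"
proof -
  have v0: "0 < real v ^ (2 * v) * (2::real) ^ 2 ^ v" using v_pos by simp
  have "\<Lambda>\<^sup>2 * M = (2 ^ (3 * s) * 2 ^ 2 ^ v)\<^sup>2 * ((real n ^ v * PH)\<^sup>2 * M)"
    by (simp add: \<Lambda>_def power_mult_distrib mult_ac)
  also have "\<dots> \<le> (2 ^ (3 * s) * 2 ^ 2 ^ v)\<^sup>2 * (sd\<^sup>2 * (real v ^ (2 * v) * 2 ^ 2 ^ v))"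
    using variance_ge' v0 by (intro mult_left_mono) (auto simp: divide_le_eq)
  finally show ?thesis by (simp add: ratio_const_def mult_ac)
qed

lemma ratio_const_ge_1: "1 \<le> ratio_const v s"
proof -
  have "1 \<le> (2 ^ (3 * s) * 2 ^ 2 ^ v :: real)\<^sup>2"
    by (intro one_le_power) (auto intro!: mult_ge1_I one_le_power)
  moreover have "1 \<le> real v ^ (2 * v) * 2 ^ 2 ^ v"
    using v_pos by (intro mult_ge1_I one_le_power) auto
  ultimately show ?thesis unfolding ratio_const_def by (rule mult_ge1_I)
qed

lemma rate_const_ge_1: "1 \<le> rate_const v s"
proof -
  have "1 \<le> real s ^ 2" using s_pos by (intro one_le_power) auto
  then have "1 \<le> 10 * real s ^ 2" by linarith
  then have "1 \<le> 10 * real s ^ 2 * 2 ^ s" by (rule mult_ge1_I) simp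
  then show ?thesis unfolding rate_const_def by (rule mult_ge1_I[OF _ ratio_const_ge_1])
qed

lemma edge_ratio_eq: "edge_ratio H n p e * M = (1 - p (card e)) / real n ^ card e"
  using M_pos by (simp add: edge_ratio_def power_int_minus inverse_eq_divide)

lemma edge_ratio_nonneg: "e \<in> edges H \<Longrightarrow> 0 \<le> edge_ratio H n p e"
  using M_pos edge_p[of e] by (simp add: edge_ratio_def)

text \<open>
  Up to a constant, the fraction of the variance that is lost when the edges with sizes outside \<open>ks\<close>
  are replaced by their probabilities.
\<close>

definition lost :: "nat set \<Rightarrow> real" where
  "lost ks = (\<Sum>e\<in>{e \<in> edges H. card e \<notin> ks}. edge_ratio H n p e + (1 - p (card e)))"

text \<open>
  Up to a constant, the second-moment error in Stein's method when only the edges with sizes in \<open>ks\<close>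
  are random.
\<close>

definition noise :: "nat set \<Rightarrow> real" where
  "noise ks = 1 / m + (\<Sum>e\<in>{e \<in> edges H. card e \<in> ks}. 1 / ((1 - p (card e)) * real n ^ card e))"

lemma noise_bounds: "0 \<le> noise ks" "1 / m \<le> noise ks"
proof -
  have "0 \<le> (\<Sum>e\<in>{e \<in> edges H. card e \<in> ks}. 1 / ((1 - p (card e)) * real n ^ card e))"
    using edge_p by (intro sum_nonneg divide_nonneg_nonneg mult_nonneg_nonneg) (auto intro: less_imp_le)
  moreover have "0 \<le> 1 / m" using m_pos by simp
  ultimately show "0 \<le> noise ks" "1 / m \<le> noise ks" by (simp_all add: noise_def)
qed

lemma lost_nonneg: "0 \<le> lost ks"
  unfolding lost_def using edge_p edge_ratio_nonneg
  by (intro sum_nonneg add_nonneg_nonneg) (auto intro: less_imp_le)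

text \<open>
  In the last estimate one factor \<open>1 - p\<close> has to pay for three factors \<open>y\<close>. It pays for one of them in
  full; of the other two, \<open>y\<^sup>2 \<le> (n\<^sup>-\<^sup>k + 2\<^sup>s * M) * y\<close>, where the first summand is only controlled after
  dividing by \<open>1 - p\<close>. This is the origin of the term \<open>1 / ((1 - p) * n ^ k)\<close> of \<open>noise\<close>.
\<close>

lemma y_bounds:
  assumes e: "e \<in> edges H"
  shows "y (card e) \<le> 1 / m"
    and "(1 - p (card e)) * y (card e) \<le> 2 * 2 ^ s * M"
    and "(1 - p (card e)) * y (card e) \<le> 2 ^ s * M * (edge_ratio H n p e + (1 - p (card e)))"
    and "(1 - p (card e)) * y (card e) ^ 3 \<le>
      4 * (2 ^ s)\<^sup>2 * M\<^sup>2 * (1 / m + 1 / ((1 - p (card e)) * real n ^ card e))"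
proof -
  define q where "q = 1 - p (card e)"
  define N where "N = real n ^ card e"
  define b :: real where "b = 2 ^ s"
  define Y where "Y = y (card e)"
  have q: "0 < q" "q \<le> 1" using edge_p[OF e] by (auto simp: q_def)
  have N: "0 < N" using n_pos by (simp add: N_def)
  have b: "1 \<le> b" by (simp add: b_def)
  have M0: "0 < M" by (rule M_pos)
  have m0: "0 < m" by (rule m_pos)
  have Y0: "0 \<le> Y" by (simp add: Y_def y_nonneg)
  show 1: "y (card e) \<le> 1 / m" by (simp add: y_def)
  have Y1: "Y \<le> 1 / m" using 1 by (simp add: Y_def)
  have Y2: "Y \<le> 1 / N + b * M" by (simp add: Y_def y_def N_def b_def)
  have qN: "q / N \<le> M" using single_edge(2)[OF e] by (simp add: q_def N_def)
  have qY: "q * Y \<le> q / N + b * M * q"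
    using mult_left_mono[OF Y2, of q] q by (simp add: algebra_simps)
  have bMq: "b * M * q \<le> b * M" using q b M0 by (simp add: mult_left_le)
  have MbM: "M \<le> b * M" using b M0 by simp
  have 2: "q * Y \<le> 2 * b * M" using qY qN bMq MbM by simp
  then show "(1 - p (card e)) * y (card e) \<le> 2 * 2 ^ s * M" by (simp add: q_def Y_def b_def)
  have "q / N = edge_ratio H n p e * M" by (simp add: edge_ratio_eq q_def N_def)
  also have "\<dots> \<le> b * (edge_ratio H n p e * M)"
    using b mult_right_mono[of 1 b "edge_ratio H n p e * M"] edge_ratio_nonneg[OF e] M0 by simp
  finally have "q * Y \<le> b * M * (edge_ratio H n p e + q)"
    using qY by (simp add: algebra_simps)
  then show "(1 - p (card e)) * y (card e) \<le> 2 ^ s * M * (edge_ratio H n p e + (1 - p (card e)))"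
    by (simp add: q_def Y_def b_def)
  have YY: "Y * Y \<le> b * M / m + 2 * b * M / (q * N)"
  proof -
    have "Y * Y \<le> (1 / N + b * M) * Y" using Y2 Y0 by (rule mult_right_mono)
    also have "\<dots> = (q * Y) / (q * N) + b * M * Y" using q by (simp add: algebra_simps)
    also have "\<dots> \<le> (2 * b * M) / (q * N) + b * M * (1 / m)"
      using 2 q N Y1 b M0 by (intro add_mono divide_right_mono mult_left_mono) auto
    finally show ?thesis by simp
  qed
  have "q * Y ^ 3 = (q * Y) * (Y * Y)" by (simp add: power3_eq_cube)
  also have "\<dots> \<le> (2 * b * M) * (b * M / m + 2 * b * M / (q * N))"
    using 2 YY Y0 b M0 by (intro mult_mono[of "q * Y" _ "Y * Y"]) auto
  also have "\<dots> \<le> (2 * b * M) * (2 * b * M / m + 2 * b * M / (q * N))"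
    using b M0 m0 by (intro mult_left_mono add_right_mono divide_right_mono) auto
  also have "\<dots> = 4 * b\<^sup>2 * M\<^sup>2 * (1 / m + 1 / (q * N))"
    by (simp add: algebra_simps power2_eq_square)
  finally show "(1 - p (card e)) * y (card e) ^ 3 \<le>
      4 * (2 ^ s)\<^sup>2 * M\<^sup>2 * (1 / m + 1 / ((1 - p (card e)) * real n ^ card e))"
    by (simp add: q_def Y_def b_def N_def)
qed

text \<open>
  \<open>W\<close> is the conditional expectation of the standardised count given the edges with sizes in \<open>ks\<close>.
  It is scaled by the standard deviation of the full count, so that its own variance is \<open>1 - r\<close>; the
  loss \<open>r\<close> enters the bounds for \<open>W\<close> through \<open>\<bar>1 - E W\<^sup>2\<bar>\<close>.
\<close>

lemma approximating_projection:
  fixes ks :: "nat set"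
  obtains r W where "0 \<le> r" "r \<le> 1" "r \<le> rate_const v s * lost ks"
    "E (\<lambda>\<omega>. (std_count \<omega> - W \<omega>)\<^sup>2) = r"
    "\<And>x. \<bar>measure_pmf.prob field_pmf {\<omega>. W \<omega> \<le> x} - normal_cdf x\<bar> \<le>
       3 * (r + rate_const v s * sqrt (noise ks))"
    "\<And>h. 1-lipschitz_on UNIV h \<Longrightarrow> \<bar>E (\<lambda>\<omega>. h (W \<omega>)) - (\<integral>x. h x \<partial>std_normal_distribution)\<bar> \<le>
       12 * (r + rate_const v s * sqrt (noise ks))"
proof -
  define K where "K = {e \<in> B. card e \<in> ks}"
  interpret X: extension_bounds B "\<lambda>e. p (card e)" "copies H n" edges K sd s \<Lambda> "\<lambda>e. y (card e)"
    by standard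
      (use finite_copies copyD(2) sd_pos P_copy total_copies_le y_nonneg copies_extension_le
        in \<open>auto simp: K_def\<close>)
  have full: "X.full = count" by (simp add: X.full_def[abs_def] count_def[abs_def])
  have EZ: "E X.Z = E count" using X.E_Z X.E_full full by simp
  have W: "X.W \<omega> = (X.Z \<omega> - E count) / sd" for \<omega>
    unfolding X.W_def using X.E_full full by simp
  define r where "r = X.removed / sd\<^sup>2"
  have sd2: "0 < sd\<^sup>2" using sd_pos by simp
  let ?b = "2 ^ s :: real" and ?A = "ratio_const v s" and ?D = "rate_const v s"
  have r_eq: "E (\<lambda>\<omega>. (std_count \<omega> - X.W \<omega>)\<^sup>2) = r"
  proof -
    have "(std_count \<omega> - X.W \<omega>)\<^sup>2 = (X.full \<omega> - X.Z \<omega>)\<^sup>2 / sd\<^sup>2" for \<omega>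
      unfolding W std_count_def full by (simp add: diff_divide_distrib[symmetric] power_divide)
    then show ?thesis using X.E_full_diff by (simp add: r_def)
  qed
  have r0: "0 \<le> r" using r_eq E_nonneg[of "\<lambda>\<omega>. (std_count \<omega> - X.W \<omega>)\<^sup>2"] by simp
  have var: "E (\<lambda>\<omega>. (f \<omega> - c)\<^sup>2) = E (\<lambda>\<omega>. (f \<omega>)\<^sup>2) - c\<^sup>2" if "E f = c" for f c
  proof -
    have "E (\<lambda>\<omega>. (f \<omega> - c)\<^sup>2) = E (\<lambda>\<omega>. (f \<omega>)\<^sup>2 - 2 * c * f \<omega> + c\<^sup>2)"
      by (simp add: power2_diff mult_ac)
    also have "\<dots> = E (\<lambda>\<omega>. (f \<omega>)\<^sup>2) - 2 * c * E f + c\<^sup>2" by simp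
    finally show ?thesis using that by (simp add: power2_eq_square)
  qed
  have EW2: "E (\<lambda>\<omega>. (X.W \<omega>)\<^sup>2) = 1 - r"
  proof -
    have "E (\<lambda>\<omega>. (X.W \<omega>)\<^sup>2) = E (\<lambda>\<omega>. (X.Z \<omega> - E count)\<^sup>2) / sd\<^sup>2"
      unfolding W by (simp add: power_divide)
    also have "E (\<lambda>\<omega>. (X.Z \<omega> - E count)\<^sup>2) = sd\<^sup>2 - X.removed"
      unfolding sd_sq var[OF EZ] var[OF refl] using X.E_full_sq full by simp
    finally show ?thesis using sd2 by (simp add: r_def diff_divide_distrib)
  qed
  have r1: "r \<le> 1" using EW2 E_nonneg[of "\<lambda>\<omega>. (X.W \<omega>)\<^sup>2"] by simp
  have lost_summand: "0 \<le> edge_ratio H n p e + (1 - p (card e))" if "e \<in> edges H" for e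
    using edge_p[OF that] edge_ratio_nonneg[OF that] by simp
  have noise_summand: "0 \<le> 1 / ((1 - p (card e)) * real n ^ card e)" if "e \<in> edges H" for e
    using edge_p[OF that] by simp
  have Lam_ratio: "\<Lambda>\<^sup>2 / sd\<^sup>2 \<le> ?A / M"
    using Lam_sd sd2 M_pos by (simp add: field_simps)
  have R: "\<exists>e'\<in>edges H. card e' = card e" if "e \<in> X.R" for e
    using that card_edge_of_copy by blast
  have bigA: "0 \<le> ?A" using ratio_const_ge_1 by linarith
  have s1: "1 \<le> real s" using s_pos by simp
  have rD: "r \<le> ?D * lost ks"
  proof -
    have "X.removed \<le> real s * (?b * M * lost ks) * \<Lambda>\<^sup>2"
    proof (rule X.removed_le)
      fix e assume e: "e \<in> X.R - K"
      then obtain e' where e': "e' \<in> edges H" "card e' = card e" using R by blast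
      have "e \<in> B" using e X.R_sub by blast
      with e e' have k: "e' \<in> {e \<in> edges H. card e \<notin> ks}" by (auto simp: K_def)
      have "edge_ratio H n p e' + (1 - p (card e')) \<le> lost ks"
        unfolding lost_def
        by (rule member_le_sum[OF k, where f = "\<lambda>e. edge_ratio H n p e + (1 - p (card e))"])
          (use lost_summand finite_edges in auto)
      then have "?b * M * (edge_ratio H n p e' + (1 - p (card e'))) \<le> ?b * M * lost ks"
        using M_pos by (intro mult_left_mono) auto
      from order.trans[OF y_bounds(3)[OF e'(1)] this]
      show "(1 - p (card e)) * y (card e) \<le> ?b * M * lost ks" unfolding e'(2) .
    qed (use M_pos lost_nonneg in simp)
    then have "r \<le> real s * (?b * M * lost ks) * (\<Lambda>\<^sup>2 / sd\<^sup>2)"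
      unfolding r_def using sd2 by (simp add: divide_right_mono)
    also have "\<dots> \<le> real s * (?b * M * lost ks) * (?A / M)"
      using Lam_ratio M_pos lost_nonneg[of ks] by (intro mult_left_mono) auto
    also have "\<dots> = real s * (?b * ?A * lost ks)" using M_pos by simp
    also have "\<dots> \<le> (10 * real s ^ 2) * (?b * ?A * lost ks)"
    proof (rule mult_right_mono)
      have "real s * 1 \<le> real s * (10 * real s)" using s1 by (intro mult_left_mono) auto
      then show "real s \<le> 10 * real s ^ 2" by (simp add: power2_eq_square)
    qed (use bigA lost_nonneg[of ks] in auto)
    finally show ?thesis by (simp add: rate_const_def mult_ac)
  qed
  have Lam4: "\<Lambda> ^ 4 / sd ^ 4 \<le> ?A\<^sup>2 / M\<^sup>2"
  proof -
    have "(\<Lambda>\<^sup>2 / sd\<^sup>2)\<^sup>2 \<le> (?A / M)\<^sup>2" using Lam_ratio by (intro power_mono) auto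
    then show ?thesis by (simp add: power_divide)
  qed
  have noise0: "0 \<le> noise ks" by (rule noise_bounds)
  have linked: "X.linked_sum / sd ^ 4 \<le> 16 * real s ^ 3 * (?b * ?A)\<^sup>2 * noise ks"
  proof -
    have le: "X.linked_sum \<le> 4 * real s ^ 3 * (2 * ?b * M)\<^sup>2 * (1 / m) * \<Lambda> ^ 4"
    proof (rule X.linked_le)
      fix e assume e: "e \<in> X.R"
      then obtain e' where e': "e' \<in> edges H" "card e' = card e" using R by blast
      show "(1 - p (card e)) * y (card e) \<le> 2 * ?b * M" "y (card e) \<le> 1 / m"
        using y_bounds(1,2)[OF e'(1)] e'(2) by simp_all
    qed (use M_pos m_pos in auto)
    have "X.linked_sum / sd ^ 4 \<le> 4 * real s ^ 3 * (2 * ?b * M)\<^sup>2 * (1 / m) * (\<Lambda> ^ 4 / sd ^ 4)"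
      using divide_right_mono[OF le, of "sd ^ 4"] by simp
    also have "\<dots> \<le> 4 * real s ^ 3 * (2 * ?b * M)\<^sup>2 * (1 / m) * (?A\<^sup>2 / M\<^sup>2)"
      using Lam4 m_pos by (intro mult_left_mono) auto
    also have "\<dots> = 16 * real s ^ 3 * (?b * ?A)\<^sup>2 * (1 / m)"
      using M_pos by (simp add: power_mult_distrib)
    also have "\<dots> \<le> 16 * real s ^ 3 * (?b * ?A)\<^sup>2 * noise ks"
      using noise_bounds by (intro mult_left_mono) auto
    finally show ?thesis .
  qed
  have diagonal: "X.diagonal_sum / sd ^ 4 \<le> 4 * real s * (?b * ?A)\<^sup>2 * noise ks"
  proof -
    have le: "X.diagonal_sum \<le> real s * (4 * ?b\<^sup>2 * M\<^sup>2 * noise ks) * \<Lambda> ^ 4"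
    proof (rule X.diagonal_le)
      fix e assume e: "e \<in> X.R \<inter> K"
      then obtain e' where e': "e' \<in> edges H" "card e' = card e" using R by blast
      with e have k: "e' \<in> {e \<in> edges H. card e \<in> ks}" by (auto simp: K_def)
      have "1 / ((1 - p (card e')) * real n ^ card e') \<le>
          (\<Sum>e\<in>{e \<in> edges H. card e \<in> ks}. 1 / ((1 - p (card e)) * real n ^ card e))"
        by (rule member_le_sum[OF k, where f = "\<lambda>e. 1 / ((1 - p (card e)) * real n ^ card e)"])
          (use noise_summand finite_edges in auto)
      then have "4 * ?b\<^sup>2 * M\<^sup>2 * (1 / m + 1 / ((1 - p (card e')) * real n ^ card e')) \<le> 4 * ?b\<^sup>2 * M\<^sup>2 * noise ks"
        unfolding noise_def by (intro mult_left_mono add_left_mono) auto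
      from order.trans[OF y_bounds(4)[OF e'(1)] this]
      show "(1 - p (card e)) * y (card e) ^ 3 \<le> 4 * ?b\<^sup>2 * M\<^sup>2 * noise ks" unfolding e'(2) .
    qed (use noise0 in simp)
    have "X.diagonal_sum / sd ^ 4 \<le> real s * (4 * ?b\<^sup>2 * M\<^sup>2 * noise ks) * (\<Lambda> ^ 4 / sd ^ 4)"
      using divide_right_mono[OF le, of "sd ^ 4"] by simp
    also have "\<dots> \<le> real s * (4 * ?b\<^sup>2 * M\<^sup>2 * noise ks) * (?A\<^sup>2 / M\<^sup>2)"
      using Lam4 noise0 by (intro mult_left_mono) auto
    also have "\<dots> = 4 * real s * (?b * ?A)\<^sup>2 * noise ks"
      using M_pos by (simp add: power_mult_distrib)
    finally show ?thesis .
  qed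
  have s34: "16 * real s ^ 3 + 4 * real s \<le> 25 * real s ^ 4"
  proof -
    have "real s ^ 3 \<le> real s ^ 4" "real s ^ 1 \<le> real s ^ 4" using s1 by (intro power_increasing; simp)+
    then show ?thesis using s1 unfolding power_one_right by linarith
  qed
  have D2: "25 * real s ^ 4 * (?b * ?A)\<^sup>2 * noise ks = (?D / 2)\<^sup>2 * noise ks"
    by (simp add: rate_const_def power_mult_distrib power2_eq_square power4_eq_xxxx mult_ac)
  have scale: "a * (?b * ?A)\<^sup>2 * noise ks \<le> (?D / 2)\<^sup>2 * noise ks" if "a \<le> 25 * real s ^ 4" for a
    unfolding D2[symmetric] using that noise0 by (intro mult_right_mono) auto
  have D0: "0 \<le> ?D" using rate_const_ge_1 by linarith
  have "E (\<lambda>\<omega>. (X.T \<omega> - E X.T)\<^sup>2) \<le> (?D / 2)\<^sup>2 * noise ks"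
    using X.moment_bounds(1) linked scale[of "16 * real s ^ 3"] s34 s1 by linarith
  from real_sqrt_le_mono[OF this] have sT: "sqrt (E (\<lambda>\<omega>. (X.T \<omega> - E X.T)\<^sup>2)) \<le> ?D / 2 * sqrt (noise ks)"
    using D0 by (simp add: real_sqrt_mult)
  have "E (\<lambda>\<omega>. (X.S \<omega>)\<^sup>2) \<le> (16 * real s ^ 3 + 4 * real s) * (?b * ?A)\<^sup>2 * noise ks"
    using X.moment_bounds(2) linked diagonal by (simp add: add_divide_distrib algebra_simps)
  with scale[OF s34] have "E (\<lambda>\<omega>. (X.S \<omega>)\<^sup>2) \<le> (?D / 2)\<^sup>2 * noise ks" by linarith
  from real_sqrt_le_mono[OF this] have sS: "sqrt (E (\<lambda>\<omega>. (X.S \<omega>)\<^sup>2)) \<le> ?D / 2 * sqrt (noise ks)"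
    using D0 by (simp add: real_sqrt_mult)
  have err: "\<bar>1 - E (\<lambda>\<omega>. (X.W \<omega>)\<^sup>2)\<bar> + sqrt (E (\<lambda>\<omega>. (X.T \<omega> - E X.T)\<^sup>2)) + sqrt (E (\<lambda>\<omega>. (X.S \<omega>)\<^sup>2))
      \<le> r + ?D * sqrt (noise ks)"
    using sT sS r0 unfolding EW2 by simp
  show ?thesis
  proof (rule that[OF r0 r1 rD r_eq])
    show "\<bar>measure_pmf.prob field_pmf {\<omega>. X.W \<omega> \<le> x} - normal_cdf x\<bar> \<le> 3 * (r + ?D * sqrt (noise ks))" for x
      by (rule order.trans[OF X.kolmogorov_bound mult_left_mono[OF err]]) simp
    show "\<bar>E (\<lambda>\<omega>. h (X.W \<omega>)) - (\<integral>x. h x \<partial>std_normal_distribution)\<bar> \<le> 12 * (r + ?D * sqrt (noise ks))"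
      if "1-lipschitz_on UNIV h" for h
      using EW2 r0 by (intro order.trans[OF X.wasserstein_bound[OF that] mult_left_mono[OF err]]) simp_all
  qed
qed

end

section \<open>Transfer to the distances\<close>

lemma powr_add_le:
  fixes a b t :: real
  assumes "0 \<le> a" "0 \<le> b" "0 < t" "t \<le> 1"
  shows "(a + b) powr t \<le> a powr t + b powr t"
proof (cases "a + b = 0")
  case False
  with assms have ab: "0 < a + b" by linarith
  have *: "x / (a + b) \<le> (x / (a + b)) powr t" if "0 \<le> x" "x \<le> a + b" for x
  proof (cases "x = 0")
    case False
    then have "(x / (a + b)) powr 1 \<le> (x / (a + b)) powr t"
      using that ab assms by (intro powr_mono') auto
    then show ?thesis using that ab False by (simp add: powr_one_gt_zero_iff)
  qed simp
  have "1 = a / (a + b) + b / (a + b)" using ab by (simp add: add_divide_distrib[symmetric])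
  also have "\<dots> \<le> (a / (a + b)) powr t + (b / (a + b)) powr t"
    using assms by (intro add_mono *) auto
  also have "\<dots> = (a powr t + b powr t) / (a + b) powr t"
    using assms ab by (simp add: powr_divide add_divide_distrib)
  finally show ?thesis using ab by (simp add: le_divide_eq)
qed (use assms in auto)

lemma powr_sum_le:
  fixes f :: "'i \<Rightarrow> real"
  assumes "0 < t" "t \<le> 1" "\<And>i. i \<in> A \<Longrightarrow> 0 \<le> f i"
  shows "(\<Sum>i\<in>A. f i) powr t \<le> (\<Sum>i\<in>A. f i powr t)"
  using assms(3)
proof (induction A rule: infinite_finite_induct)
  case (insert a A)
  have "(f a + (\<Sum>i\<in>A. f i)) powr t \<le> f a powr t + (\<Sum>i\<in>A. f i) powr t"
    using insert assms by (intro powr_add_le sum_nonneg) auto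
  also have "\<dots> \<le> f a powr t + (\<Sum>i\<in>A. f i powr t)" using insert by simp
  finally show ?case using insert by simp
qed auto

text \<open>
  Index \<open>i\<close> stands for an edge, \<open>q i\<close> for its probability to be missing, \<open>rt i + q i\<close> for the cost of
  replacing it by its probability and \<open>u i\<close> for the cost of keeping it. Below the threshold \<open>\<theta>\<close> the
  term \<open>q i\<close> is absorbed by \<open>L\<close>, above it \<open>u i\<close> is.
\<close>

lemma drop_or_keep:
  fixes rt q u :: "'i \<Rightarrow> real"
  assumes A: "finite A" and t: "0 < t" "t \<le> 1" and L: "0 \<le> L" and th: "\<theta> powr t \<le> L"
    and nn: "\<And>i. i \<in> A \<Longrightarrow> 0 \<le> rt i" "\<And>i. i \<in> A \<Longrightarrow> 0 \<le> q i" "\<And>i. i \<in> A \<Longrightarrow> 0 \<le> u i"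
    and u: "\<And>i. i \<in> A \<Longrightarrow> \<theta> < q i \<Longrightarrow> u i powr (1 / 2) \<le> L"
  defines "dropped \<equiv> \<lambda>i. q i \<le> \<theta> \<and> rt i powr t \<le> u i powr (1 / 2)"
  shows "(\<Sum>i\<in>{i \<in> A. dropped i}. rt i + q i) powr t + (\<Sum>i\<in>{i \<in> A. \<not> dropped i}. u i powr (1 / 2)) \<le>
    real (card A) * L + (\<Sum>i\<in>A. min (rt i powr t) (u i powr (1 / 2)))"
proof -
  let ?m = "\<lambda>i. L + min (rt i powr t) (u i powr (1 / 2))"
  have "(\<Sum>i\<in>{i \<in> A. dropped i}. rt i + q i) powr t \<le> (\<Sum>i\<in>{i \<in> A. dropped i}. (rt i + q i) powr t)"
    using t nn by (intro powr_sum_le add_nonneg_nonneg) auto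
  also have "\<dots> \<le> (\<Sum>i\<in>{i \<in> A. dropped i}. ?m i)"
  proof (rule sum_mono)
    fix i assume i: "i \<in> {i \<in> A. dropped i}"
    have "(rt i + q i) powr t \<le> rt i powr t + q i powr t" using i nn t by (intro powr_add_le) auto
    moreover have "q i powr t \<le> \<theta> powr t" using i nn t by (intro powr_mono2) (auto simp: dropped_def)
    ultimately show "(rt i + q i) powr t \<le> ?m i" using th i by (auto simp: dropped_def)
  qed
  finally have 1: "(\<Sum>i\<in>{i \<in> A. dropped i}. rt i + q i) powr t \<le> (\<Sum>i\<in>{i \<in> A. dropped i}. ?m i)" .
  have 2: "(\<Sum>i\<in>{i \<in> A. \<not> dropped i}. u i powr (1 / 2)) \<le> (\<Sum>i\<in>{i \<in> A. \<not> dropped i}. ?m i)"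
  proof (rule sum_mono)
    fix i assume i: "i \<in> {i \<in> A. \<not> dropped i}"
    show "u i powr (1 / 2) \<le> ?m i"
    proof (cases "\<theta> < q i")
      case True
      then have "u i powr (1 / 2) \<le> L" using u i by auto
      moreover have "0 \<le> min (rt i powr t) (u i powr (1 / 2))" by simp
      ultimately show ?thesis by linarith
    next
      case False
      then have "u i powr (1 / 2) \<le> rt i powr t" using i by (auto simp: dropped_def)
      then show ?thesis using L by simp
    qed
  qed
  have "{i \<in> A. dropped i} \<union> {i \<in> A. \<not> dropped i} = A" by auto
  then have "(\<Sum>i\<in>{i \<in> A. dropped i}. ?m i) + (\<Sum>i\<in>{i \<in> A. \<not> dropped i}. ?m i) = (\<Sum>i\<in>A. ?m i)"
    using A by (subst sum.union_disjoint[symmetric]) auto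
  with 1 2 show ?thesis by (simp add: sum.distrib)
qed

lemma normal_cdf_add_le: "0 \<le> e \<Longrightarrow> normal_cdf (x + e) \<le> normal_cdf x + e"
proof -
  assume e: "0 \<le> e"
  have "normal_cdf (x + e) - (x + e) \<le> normal_cdf x - x"
  proof (rule DERIV_nonpos_imp_nonincreasing[of x "x + e" "\<lambda>w. normal_cdf w - w"])
    fix w :: real
    have "std_normal_density w \<le> 1"
    proof -
      have "1 \<le> sqrt (2 * pi)" using pi_gt3 by (simp add: real_le_rsqrt)
      then have "1 / sqrt (2 * pi) \<le> 1" by simp
      then have "1 / sqrt (2 * pi) * exp (- w\<^sup>2 / 2) \<le> 1 * 1" by (intro mult_mono) auto
      then show ?thesis by (simp add: std_normal_density_def)
    qed
    moreover have "((\<lambda>w. normal_cdf w - w) has_real_derivative std_normal_density w - 1) (at w)"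
      by (intro derivative_intros normal_cdf_deriv)
    ultimately show "\<exists>y. ((\<lambda>w. normal_cdf w - w) has_real_derivative y) (at w) \<and> y \<le> 0"
      by (intro exI[of _ "std_normal_density w - 1"]) simp
  qed (use e in simp)
  then show ?thesis by simp
qed

context bernoulli_field
begin

lemma prob_le_E: "(\<And>\<omega>. \<omega> \<in> A \<Longrightarrow> 1 \<le> f \<omega>) \<Longrightarrow> (\<And>\<omega>. 0 \<le> f \<omega>) \<Longrightarrow> measure_pmf.prob field_pmf A \<le> E f"
proof -
  assume f: "\<And>\<omega>. \<omega> \<in> A \<Longrightarrow> 1 \<le> f \<omega>" "\<And>\<omega>. 0 \<le> f \<omega>"
  have "E (indicator A) \<le> E f" by (rule E_mono) (use f in \<open>auto simp: indicator_def\<close>)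
  then show ?thesis by simp
qed

text \<open>
  On the event \<open>\<bar>V - W\<bar> < e\<close> the distribution functions differ by a shift of at most \<open>e\<close>, and the
  complementary event is controlled by Chebyshev's inequality.
\<close>

lemma cdf_perturbation:
  assumes W: "\<And>x. \<bar>measure_pmf.prob field_pmf {\<omega>. W \<omega> \<le> x} - normal_cdf x\<bar> \<le> d"
    and r: "E (\<lambda>\<omega>. (V \<omega> - W \<omega>)\<^sup>2) \<le> r" and e: "0 < e"
  shows "\<bar>measure_pmf.prob field_pmf {\<omega>. V \<omega> \<le> x} - normal_cdf x\<bar> \<le> d + e + r / e\<^sup>2"
proof -
  let ?pr = "measure_pmf.prob field_pmf"
  have far: "?pr {\<omega>. e \<le> \<bar>V \<omega> - W \<omega>\<bar>} \<le> r / e\<^sup>2"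
  proof -
    have "?pr {\<omega>. e \<le> \<bar>V \<omega> - W \<omega>\<bar>} \<le> E (\<lambda>\<omega>. (V \<omega> - W \<omega>)\<^sup>2 / e\<^sup>2)"
    proof (rule prob_le_E)
      fix \<omega> assume "\<omega> \<in> {\<omega>. e \<le> \<bar>V \<omega> - W \<omega>\<bar>}"
      then have "e\<^sup>2 \<le> (V \<omega> - W \<omega>)\<^sup>2" using e power_mono[of e "\<bar>V \<omega> - W \<omega>\<bar>" 2] by simp
      then show "1 \<le> (V \<omega> - W \<omega>)\<^sup>2 / e\<^sup>2" using e by simp
    qed simp
    also have "\<dots> \<le> r / e\<^sup>2" using divide_right_mono[OF r, of "e\<^sup>2"] by simp
    finally show ?thesis .
  qed
  have sub: "?pr {\<omega>. X \<omega> \<le> x} \<le> ?pr {\<omega>. Y \<omega> \<le> x + e} + ?pr {\<omega>. e \<le> \<bar>V \<omega> - W \<omega>\<bar>}"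
    if "\<And>\<omega>. \<bar>X \<omega> - Y \<omega>\<bar> = \<bar>V \<omega> - W \<omega>\<bar>" for X Y :: "_ \<Rightarrow> real" and x
  proof -
    have "{\<omega>. X \<omega> \<le> x} \<subseteq> {\<omega>. Y \<omega> \<le> x + e} \<union> {\<omega>. e \<le> \<bar>V \<omega> - W \<omega>\<bar>}"
    proof
      fix \<omega> assume "\<omega> \<in> {\<omega>. X \<omega> \<le> x}"
      then show "\<omega> \<in> {\<omega>. Y \<omega> \<le> x + e} \<union> {\<omega>. e \<le> \<bar>V \<omega> - W \<omega>\<bar>}"
        using that[of \<omega>] by (cases "Y \<omega> \<le> x + e") auto
    qed
    then have "?pr {\<omega>. X \<omega> \<le> x} \<le> ?pr ({\<omega>. Y \<omega> \<le> x + e} \<union> {\<omega>. e \<le> \<bar>V \<omega> - W \<omega>\<bar>})"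
      by (intro measure_pmf.finite_measure_mono) auto
    also have "\<dots> \<le> ?pr {\<omega>. Y \<omega> \<le> x + e} + ?pr {\<omega>. e \<le> \<bar>V \<omega> - W \<omega>\<bar>}"
      by (rule measure_Un_le) auto
    finally show ?thesis .
  qed
  have up: "?pr {\<omega>. V \<omega> \<le> x} \<le> normal_cdf x + (d + e + r / e\<^sup>2)"
    using sub[of V W x] far W[of "x + e"] normal_cdf_add_le[of e x] e by linarith
  have "?pr {\<omega>. W \<omega> \<le> x - e} \<le> ?pr {\<omega>. V \<omega> \<le> x} + ?pr {\<omega>. e \<le> \<bar>V \<omega> - W \<omega>\<bar>}"
    using sub[of W V "x - e"] by (simp add: abs_minus_commute)
  moreover have "normal_cdf x \<le> normal_cdf (x - e) + e" using normal_cdf_add_le[of e "x - e"] e by simp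
  ultimately have "normal_cdf x - (d + e + r / e\<^sup>2) \<le> ?pr {\<omega>. V \<omega> \<le> x}"
    using far W[of "x - e"] by linarith
  with up show ?thesis by linarith
qed

end

context random_copies
begin

lemma E_std_count_sq: "E (\<lambda>\<omega>. (std_count \<omega>)\<^sup>2) = 1"
proof -
  have "E (\<lambda>\<omega>. (std_count \<omega>)\<^sup>2) = E (\<lambda>\<omega>. (count \<omega> - E count)\<^sup>2) / sd\<^sup>2"
    unfolding std_count_def by (simp add: power_divide)
  also have "\<dots> = 1" using sd_pos by (simp flip: sd_sq)
  finally show ?thesis .
qed

text \<open>
  The smoothing width \<open>r powr (1 / 3)\<close> balances the two costs \<open>e\<close> and \<open>r / e\<^sup>2\<close> of
  \<open>cdf_perturbation\<close>; for \<open>r = 0\<close> the width tends to \<open>0\<close> instead.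
\<close>

lemma kolmogorov_std_count:
  "\<bar>measure_pmf.prob field_pmf {\<omega>. std_count \<omega> \<le> x} - normal_cdf x\<bar> \<le>
    5 * rate_const v s * (lost ks powr (1 / 3) + sqrt (noise ks))"
proof (rule approximating_projection[of ks])
  let ?D = "rate_const v s"
  fix r W
  assume r: "0 \<le> r" "r \<le> 1" "r \<le> ?D * lost ks" "E (\<lambda>\<omega>. (std_count \<omega> - W \<omega>)\<^sup>2) = r"
    and W: "\<And>x. \<bar>measure_pmf.prob field_pmf {\<omega>. W \<omega> \<le> x} - normal_cdf x\<bar> \<le> 3 * (r + ?D * sqrt (noise ks))"
    and W': "\<And>h. 1-lipschitz_on UNIV h \<Longrightarrow> \<bar>E (\<lambda>\<omega>. h (W \<omega>)) - (\<integral>x. h x \<partial>std_normal_distribution)\<bar> \<le>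
       12 * (r + ?D * sqrt (noise ks))"
  note pert = cdf_perturbation[OF W eq_refl[OF r(4)], of _ x]
  have D1: "1 \<le> ?D" by (rule rate_const_ge_1)
  have main: "\<bar>measure_pmf.prob field_pmf {\<omega>. std_count \<omega> \<le> x} - normal_cdf x\<bar> \<le>
      3 * (r + ?D * sqrt (noise ks)) + 2 * r powr (1 / 3)"
  proof (cases "r = 0")
    case True
    show ?thesis
    proof (rule field_le_epsilon)
      fix e :: real assume "0 < e"
      from pert[OF this] True
      show "\<bar>measure_pmf.prob field_pmf {\<omega>. std_count \<omega> \<le> x} - normal_cdf x\<bar> \<le>
        3 * (r + ?D * sqrt (noise ks)) + 2 * r powr (1 / 3) + e" by simp
    qed
  next
    case False
    with r have r0: "0 < r" by simp
    have "r / (r powr (1 / 3))\<^sup>2 = r powr 1 / r powr (2 / 3)"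
      using r0 by (simp add: powr_power)
    also have "\<dots> = r powr (1 - 2 / 3)" by (rule powr_diff[symmetric])
    finally show ?thesis using pert[of "r powr (1 / 3)"] r0 by simp
  qed
  have r_le: "r \<le> r powr (1 / 3)"
  proof (cases "r = 0")
    case False
    with r have "r powr 1 \<le> r powr (1 / 3)" by (intro powr_mono') auto
    with r False show ?thesis by simp
  qed simp
  have r_powr_le: "r powr (1 / 3) \<le> ?D * lost ks powr (1 / 3)"
  proof -
    have "r powr (1 / 3) \<le> (?D * lost ks) powr (1 / 3)" using r by (intro powr_mono2) auto
    also have "\<dots> = ?D powr (1 / 3) * lost ks powr (1 / 3)" by (rule powr_mult)
    also have "\<dots> \<le> ?D * lost ks powr (1 / 3)"
    proof (rule mult_right_mono)
      show "?D powr (1 / 3) \<le> ?D" using D1 powr_mono[of "1 / 3" 1 ?D] by simp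
    qed simp
    finally show ?thesis .
  qed
  have "0 \<le> ?D * sqrt (noise ks)" using D1 noise_bounds(1) by simp
  with main r_le r_powr_le show ?thesis
    unfolding distrib_left mult.assoc by linarith
qed

lemma wasserstein_std_count:
  assumes h: "1-lipschitz_on UNIV h"
  shows "\<bar>E (\<lambda>\<omega>. h (std_count \<omega>)) - (\<integral>x. h x \<partial>std_normal_distribution)\<bar> \<le>
    13 * rate_const v s * (lost ks powr (1 / 2) + sqrt (noise ks))"
proof (rule approximating_projection[of ks])
  let ?D = "rate_const v s"
  fix r W
  assume r: "0 \<le> r" "r \<le> 1" "r \<le> ?D * lost ks" "E (\<lambda>\<omega>. (std_count \<omega> - W \<omega>)\<^sup>2) = r"
    and W': "\<And>x. \<bar>measure_pmf.prob field_pmf {\<omega>. W \<omega> \<le> x} - normal_cdf x\<bar> \<le> 3 * (r + ?D * sqrt (noise ks))"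
    and W: "\<And>h. 1-lipschitz_on UNIV h \<Longrightarrow> \<bar>E (\<lambda>\<omega>. h (W \<omega>)) - (\<integral>x. h x \<partial>std_normal_distribution)\<bar> \<le>
       12 * (r + ?D * sqrt (noise ks))"
  have D1: "1 \<le> ?D" by (rule rate_const_ge_1)
  have "\<bar>E (\<lambda>\<omega>. h (std_count \<omega>)) - E (\<lambda>\<omega>. h (W \<omega>))\<bar> = \<bar>E (\<lambda>\<omega>. h (std_count \<omega>) - h (W \<omega>))\<bar>" by simp
  also have "\<dots> \<le> E (\<lambda>\<omega>. \<bar>h (std_count \<omega>) - h (W \<omega>)\<bar>)" by (rule abs_E_le)
  also have "\<dots> \<le> E (\<lambda>\<omega>. \<bar>std_count \<omega> - W \<omega>\<bar>)"
    using lipschitz_onD[OF h] by (intro E_mono) (auto simp: dist_real_def)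
  also have "\<dots> \<le> sqrt r" using E_abs_le_sqrt[of "\<lambda>\<omega>. std_count \<omega> - W \<omega>"] r by simp
  finally have 1: "\<bar>E (\<lambda>\<omega>. h (std_count \<omega>)) - E (\<lambda>\<omega>. h (W \<omega>))\<bar> \<le> sqrt r" .
  have rr: "r \<le> sqrt r"
  proof -
    have "sqrt r * sqrt r \<le> sqrt r * 1" using r by (intro mult_left_mono) auto
    then show ?thesis using r by simp
  qed
  have "\<bar>E (\<lambda>\<omega>. h (std_count \<omega>)) - (\<integral>x. h x \<partial>std_normal_distribution)\<bar> \<le>
      sqrt r + 12 * (r + ?D * sqrt (noise ks))"
    using 1 W[OF h] by linarith
  also have "\<dots> \<le> sqrt r + 12 * (sqrt r + ?D * sqrt (noise ks))" using rr by simp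
  also have "\<dots> = 13 * sqrt r + 12 * ?D * sqrt (noise ks)" by simp
  also have "\<dots> \<le> 13 * (?D * lost ks powr (1 / 2)) + 13 * ?D * sqrt (noise ks)"
  proof (intro add_mono mult_right_mono mult_left_mono)
    have "sqrt r \<le> sqrt (?D * lost ks)" using r by simp
    also have "\<dots> = sqrt ?D * lost ks powr (1 / 2)"
      using lost_nonneg[of ks] by (simp add: real_sqrt_mult powr_half_sqrt)
    also have "\<dots> \<le> ?D * lost ks powr (1 / 2)"
    proof (rule mult_right_mono)
      have "sqrt ?D * 1 \<le> sqrt ?D * sqrt ?D" using D1 by (intro mult_left_mono) auto
      then show "sqrt ?D \<le> ?D" using D1 by simp
    qed simp
    finally show "sqrt r \<le> ?D * lost ks powr (1 / 2)" .
  qed (use D1 noise_bounds(1) in auto)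
  also have "\<dots> = 13 * ?D * (lost ks powr (1 / 2) + sqrt (noise ks))" by (simp add: algebra_simps)
  finally show ?thesis .
qed

lemma wasserstein_le_2:
  assumes h: "1-lipschitz_on UNIV h"
  shows "\<bar>E (\<lambda>\<omega>. h (std_count \<omega>)) - (\<integral>x. h x \<partial>std_normal_distribution)\<bar> \<le> 2"
proof -
  have "\<bar>E (\<lambda>\<omega>. h (std_count \<omega>)) - h 0\<bar> = \<bar>E (\<lambda>\<omega>. h (std_count \<omega>) - h 0)\<bar>" by simp
  also have "\<dots> \<le> E (\<lambda>\<omega>. \<bar>h (std_count \<omega>) - h 0\<bar>)" by (rule abs_E_le)
  also have "\<dots> \<le> E (\<lambda>\<omega>. \<bar>std_count \<omega>\<bar>)"
    using lipschitz_onD[OF h, of _ 0] by (intro E_mono) (auto simp: dist_real_def)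
  also have "\<dots> \<le> 1" using E_abs_le_sqrt[of std_count] E_std_count_sq by simp
  finally have "\<bar>E (\<lambda>\<omega>. h (std_count \<omega>)) - h 0\<bar> \<le> 1" .
  with integrable_std_normal_lipschitz(2)[OF h, of 0] show ?thesis by linarith
qed

definition outcome :: "(nat set \<Rightarrow> bool) \<Rightarrow> nat hypergraph" where
  "outcome \<omega> = \<lparr>verts = {1..n}, edges = {e \<in> B. \<omega> e}\<rparr>"

lemma random_hypergraph_eq: "random_hypergraph n p = map_pmf outcome field_pmf"
  unfolding random_hypergraph_def field_pmf_def outcome_def unfolding B_def ..

lemma copy_count_outcome: "copy_count H n (outcome \<omega>) = count \<omega>"
proof -
  have "subhypergraph \<alpha> (outcome \<omega>) \<longleftrightarrow> (\<forall>e\<in>edges \<alpha>. \<omega> e)" if "\<alpha> \<in> copies H n" for \<alpha>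
    using copyD(1,2)[OF that] that
    by (auto simp: copies_def subhypergraph_def outcome_def)
  then have "copy_count H n (outcome \<omega>) = real (card {\<alpha> \<in> copies H n. \<forall>e\<in>edges \<alpha>. \<omega> e})"
    unfolding copy_count_def copies_def by (intro arg_cong[where f = "\<lambda>X. real (card X)"]) auto
  also have "\<dots> = count \<omega>"
    unfolding count_def all_on_def using finite_copies by (simp add: Collect_conj_eq Int_commute)
  finally show ?thesis .
qed

lemma normalised_outcome: "normalised_copy_count H n p (outcome \<omega>) = std_count \<omega>"
  unfolding normalised_copy_count_def std_count_def sd_def random_hypergraph_eq
  by (simp add: copy_count_outcome)

lemma integral_copy_law:
  assumes "h \<in> borel_measurable borel"
  shows "(\<integral>x. h x \<partial>copy_law H n p) = E (\<lambda>\<omega>. h (std_count \<omega>))"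
  unfolding copy_law_def random_hypergraph_eq using assms
  by (subst integral_distr) (auto simp: normalised_outcome)

lemma cdf_copy_law: "cdf (copy_law H n p) x = measure_pmf.prob field_pmf {\<omega>. std_count \<omega> \<le> x}"
proof -
  have "cdf (copy_law H n p) x =
      measure_pmf.prob (map_pmf outcome field_pmf) {G. normalised_copy_count H n p G \<le> x}"
    unfolding cdf_def copy_law_def random_hypergraph_eq
    by (subst measure_distr) (auto intro!: arg_cong2[where f = measure_pmf.prob])
  also have "\<dots> = measure_pmf.prob field_pmf {\<omega>. std_count \<omega> \<le> x}"
    by (simp add: vimage_def normalised_outcome)
  finally show ?thesis .
qed

lemma wasserstein_dist_le:
  assumes "\<And>h. 1-lipschitz_on UNIV h \<Longrightarrow>
    \<bar>E (\<lambda>\<omega>. h (std_count \<omega>)) - (\<integral>x. h x \<partial>std_normal_distribution)\<bar> \<le> d"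
  shows "wasserstein_dist (copy_law H n p) std_normal_distribution \<le> ereal d"
  unfolding wasserstein_dist_def
proof (rule SUP_least)
  fix h :: "real \<Rightarrow> real" assume "h \<in> {h. 1-lipschitz_on UNIV h}"
  then have h: "1-lipschitz_on UNIV h" by simp
  then have "h \<in> borel_measurable borel"
    by (intro borel_measurable_continuous_onI lipschitz_on_continuous_on)
  with assms[OF h]
  show "ereal \<bar>(\<integral>x. h x \<partial>copy_law H n p) - (\<integral>x. h x \<partial>std_normal_distribution)\<bar> \<le> ereal d"
    by (simp add: integral_copy_law)
qed

lemma kolmogorov_dist_le:
  assumes "\<And>x. \<bar>measure_pmf.prob field_pmf {\<omega>. std_count \<omega> \<le> x} - normal_cdf x\<bar> \<le> d"
  shows "kolmogorov_dist (copy_law H n p) std_normal_distribution \<le> ereal d"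
  unfolding kolmogorov_dist_def by (rule SUP_least) (use assms in \<open>simp add: cdf_copy_law\<close>)

lemma kolmogorov_le_1: "\<bar>measure_pmf.prob field_pmf {\<omega>. std_count \<omega> \<le> x} - normal_cdf x\<bar> \<le> 1"
proof -
  have "0 \<le> measure_pmf.prob field_pmf {\<omega>. std_count \<omega> \<le> x}"
    "measure_pmf.prob field_pmf {\<omega>. std_count \<omega> \<le> x} \<le> 1"
    by (auto intro: measure_pmf.prob_le_1)
  with normal_cdf_bounds[of x] show ?thesis by linarith
qed

end

section \<open>The rates\<close>

context random_copies
begin

lemma m_le_n_power: "e \<in> edges H \<Longrightarrow> m \<le> real n ^ card e"
proof -
  assume e: "e \<in> edges H"
  have "p (card e) * real n ^ card e \<le> 1 * real n ^ card e"
    using edge_p[OF e] by (intro mult_right_mono) auto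
  with single_edge(1)[OF e] show ?thesis by simp
qed

lemma kept_sizes:
  assumes t: "0 < t" "t \<le> 1" and \<theta>: "0 < \<theta>" "\<theta> powr t \<le> L"
    and L: "m powr (- 1 / 2) \<le> L" "(\<theta> * m) powr (- 1 / 2) \<le> L"
  shows "\<exists>ks. lost ks powr t + sqrt (noise ks) \<le> (real s + 1) * L +
    (\<Sum>e\<in>edges H. min (edge_ratio H n p e powr t) ((1 / ((1 - p (card e)) * real n ^ card e)) powr (1 / 2)))"
proof -
  define rt where "rt k = real n powi (- int k) * (1 - p k) / M" for k
  define u where "u k = 1 / ((1 - p k) * real n ^ k)" for k
  have rt: "rt (card e) = edge_ratio H n p e" for e :: "'a set" by (simp add: rt_def edge_ratio_def)
  have inv: "(1 / x) powr (1 / 2) = x powr (- 1 / 2)" if "0 < x" for x :: real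
    using that by (simp add: powr_divide powr_minus_divide)
  \<comment> \<open>The decision depends on an edge only through its size, as the kept set must.\<close>
  define ks where "ks = {k. \<not> (1 - p k \<le> \<theta> \<and> rt k powr t \<le> u k powr (1 / 2))}"
  have L0: "0 \<le> L" using order.trans[OF powr_ge_zero L(1)] .
  have u0: "0 \<le> u (card e)" if "e \<in> edges H" for e using edge_p[OF that] by (simp add: u_def)
  have dk: "(\<Sum>e\<in>{e \<in> edges H. 1 - p (card e) \<le> \<theta> \<and> rt (card e) powr t \<le> u (card e) powr (1 / 2)}.
        rt (card e) + (1 - p (card e))) powr t +
      (\<Sum>e\<in>{e \<in> edges H. \<not> (1 - p (card e) \<le> \<theta> \<and> rt (card e) powr t \<le> u (card e) powr (1 / 2))}.
        u (card e) powr (1 / 2))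
    \<le> real (card (edges H)) * L + (\<Sum>e\<in>edges H. min (rt (card e) powr t) (u (card e) powr (1 / 2)))"
  proof (rule drop_or_keep[OF finite_edges t L0 \<theta>(2)])
    fix e assume e: "e \<in> edges H"
    show "0 \<le> rt (card e)" using edge_ratio_nonneg[OF e] by (simp add: rt)
    show "0 \<le> 1 - p (card e)" using edge_p[OF e] by simp
    show "0 \<le> u (card e)" by (rule u0[OF e])
    assume q: "\<theta> < 1 - p (card e)"
    have "\<theta> * m \<le> (1 - p (card e)) * real n ^ card e"
      using q m_le_n_power[OF e] \<theta>(1) m_pos by (intro mult_mono) auto
    then have "u (card e) \<le> 1 / (\<theta> * m)"
      unfolding u_def using \<theta>(1) m_pos n_pos edge_p[OF e] by (intro divide_left_mono mult_pos_pos) auto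
    then have "u (card e) powr (1 / 2) \<le> (1 / (\<theta> * m)) powr (1 / 2)"
      using u0[OF e] by (intro powr_mono2) auto
    with inv[of "\<theta> * m"] \<theta>(1) m_pos L(2) show "u (card e) powr (1 / 2) \<le> L" by simp
  qed
  have lost: "lost ks = (\<Sum>e\<in>{e \<in> edges H. 1 - p (card e) \<le> \<theta> \<and> rt (card e) powr t \<le> u (card e) powr (1 / 2)}.
        rt (card e) + (1 - p (card e)))"
    unfolding lost_def ks_def by (simp add: rt)
  have "sqrt (noise ks) = noise ks powr (1 / 2)" using noise_bounds(1) by (simp add: powr_half_sqrt)
  also have "\<dots> \<le> (1 / m) powr (1 / 2) + (\<Sum>e\<in>{e \<in> edges H. card e \<in> ks}. u (card e)) powr (1 / 2)"
    unfolding noise_def u_def[symmetric] using m_pos u0 by (intro powr_add_le sum_nonneg) auto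
  also have "\<dots> \<le> L + (\<Sum>e\<in>{e \<in> edges H. card e \<in> ks}. u (card e) powr (1 / 2))"
    using L(1) inv[OF m_pos] u0 by (intro add_mono powr_sum_le) auto
  finally have "sqrt (noise ks) \<le> L + (\<Sum>e\<in>{e \<in> edges H.
      \<not> (1 - p (card e) \<le> \<theta> \<and> rt (card e) powr t \<le> u (card e) powr (1 / 2))}. u (card e) powr (1 / 2))"
    unfolding ks_def by simp
  with dk have "lost ks powr t + sqrt (noise ks) \<le> (real s + 1) * L +
      (\<Sum>e\<in>edges H. min (rt (card e) powr t) (u (card e) powr (1 / 2)))"
    unfolding lost by (simp add: algebra_simps)
  then show ?thesis unfolding rt u_def by blast
qed

lemma kept_sizes_wasserstein:
  assumes "1 \<le> m"
  shows "\<exists>ks. lost ks powr (1 / 2) + sqrt (noise ks) \<le> (real s + 1) * m powr (- 1 / 4) +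
    (\<Sum>e\<in>edges H. min (edge_ratio H n p e powr (1 / 2)) ((1 / ((1 - p (card e)) * real n ^ card e)) powr (1 / 2)))"
proof (rule kept_sizes[where \<theta> = "m powr (- 1 / 2)"])
  have "m powr (- 1 / 2) * m = m powr (1 / 2)"
    using m_pos powr_add[of m "- 1 / 2" 1] by simp
  then show "(m powr (- 1 / 2) * m) powr (- 1 / 2) \<le> m powr (- 1 / 4)"
    by (simp add: powr_powr)
  show "m powr (- 1 / 2) \<le> m powr (- 1 / 4)" using assms by (intro powr_mono) auto
qed (use m_pos in \<open>auto simp: powr_powr\<close>)

lemma kept_sizes_kolmogorov:
  assumes "1 \<le> m"
  shows "\<exists>ks. lost ks powr (1 / 3) + sqrt (noise ks) \<le> (real s + 1) * m powr (- 1 / 5) +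
    (\<Sum>e\<in>edges H. min (edge_ratio H n p e powr (1 / 3)) ((1 / ((1 - p (card e)) * real n ^ card e)) powr (1 / 2)))"
proof (rule kept_sizes[where \<theta> = "m powr (- 3 / 5)"])
  have "m powr (- 3 / 5) * m = m powr (2 / 5)"
    using m_pos powr_add[of m "- 3 / 5" 1] by simp
  then show "(m powr (- 3 / 5) * m) powr (- 1 / 2) \<le> m powr (- 1 / 5)"
    by (simp add: powr_powr)
  show "m powr (- 1 / 2) \<le> m powr (- 1 / 5)" using assms by (intro powr_mono) auto
qed (use m_pos in \<open>auto simp: powr_powr\<close>)

definition C :: real where
  "C = 13 * rate_const v s * (real s + 1)"

lemma C_facts: "2 \<le> C" "13 * rate_const v s \<le> C" "5 * rate_const v s \<le> C"
proof -
  have D: "1 \<le> rate_const v s" by (rule rate_const_ge_1)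
  have "13 * rate_const v s * 1 \<le> C" unfolding C_def using D by (intro mult_left_mono) auto
  with D show "2 \<le> C" "13 * rate_const v s \<le> C" "5 * rate_const v s \<le> C" by auto
qed

lemma rate_combine:
  assumes "0 \<le> a" "a \<le> 13" "x \<le> (real s + 1) * L + S" "0 \<le> L" "0 \<le> S"
  shows "a * rate_const v s * x \<le> C * (L + S)"
proof -
  have D: "1 \<le> rate_const v s" by (rule rate_const_ge_1)
  have "x \<le> (real s + 1) * L + (real s + 1) * S"
    using assms mult_right_mono[of 1 "real s + 1" S] by simp
  then have "a * rate_const v s * x \<le> a * rate_const v s * ((real s + 1) * L + (real s + 1) * S)"
    using assms D by (intro mult_left_mono) auto
  also have "\<dots> \<le> 13 * rate_const v s * ((real s + 1) * L + (real s + 1) * S)"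
    using assms D by (intro mult_right_mono) auto
  also have "\<dots> = C * (L + S)" by (simp add: C_def algebra_simps)
  finally show ?thesis .
qed

lemma one_le_powr_minus: "m < 1 \<Longrightarrow> 0 \<le> t \<Longrightarrow> 1 \<le> m powr (- t)"
  using powr_mono'[of "- t" 0 m] m_pos by simp

text \<open>
  For \<open>m < 1\<close> the right-hand side exceeds the a priori bound \<open>2\<close>.
\<close>

lemma wasserstein_rate:
  "wasserstein_dist (copy_law H n p) std_normal_distribution \<le> ereal (C * (m powr (- 1 / 4) +
    (\<Sum>e\<in>edges H. (min (edge_ratio H n p e) (1 / ((1 - p (card e)) * real n ^ card e))) powr (1 / 2))))"
  (is "_ \<le> ereal (C * (_ + ?S))")
proof (rule wasserstein_dist_le)
  fix h :: "real \<Rightarrow> real" assume h: "1-lipschitz_on UNIV h"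
  have S0: "0 \<le> ?S" by (intro sum_nonneg) simp
  have S: "?S = (\<Sum>e\<in>edges H. min (edge_ratio H n p e powr (1 / 2)) ((1 / ((1 - p (card e)) * real n ^ card e)) powr (1 / 2)))"
  proof (rule sum.cong[OF refl])
    fix e assume e: "e \<in> edges H"
    have "(min a b) powr (1 / 2) = min (a powr (1 / 2)) (b powr (1 / 2))" if "0 \<le> a" "0 \<le> b" for a b :: real
      using that powr_mono2[of "1 / 2" a b] powr_mono2[of "1 / 2" b a] by (auto simp: min_def)
    then show "(min (edge_ratio H n p e) (1 / ((1 - p (card e)) * real n ^ card e))) powr (1 / 2) =
      min (edge_ratio H n p e powr (1 / 2)) ((1 / ((1 - p (card e)) * real n ^ card e)) powr (1 / 2))"
      using edge_ratio_nonneg[OF e] edge_p[OF e] by simp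
  qed
  show "\<bar>E (\<lambda>\<omega>. h (std_count \<omega>)) - (\<integral>x. h x \<partial>std_normal_distribution)\<bar> \<le> C * (m powr (- 1 / 4) + ?S)"
  proof (cases "1 \<le> m")
    case True
    obtain ks where "lost ks powr (1 / 2) + sqrt (noise ks) \<le> (real s + 1) * m powr (- 1 / 4) + ?S"
      using kept_sizes_wasserstein[OF True] unfolding S by blast
    from rate_combine[OF _ _ this, of 13] S0 wasserstein_std_count[OF h, of ks] show ?thesis by simp
  next
    case False
    have "2 * 1 \<le> C * (m powr (- 1 / 4) + ?S)"
      using C_facts(1) one_le_powr_minus[of "1 / 4"] False S0 by (intro mult_mono) auto
    with wasserstein_le_2[OF h] show ?thesis by linarith
  qed
qed

lemma kolmogorov_rate:
  "kolmogorov_dist (copy_law H n p) std_normal_distribution \<le> ereal (C * (m powr (- 1 / 5) +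
    (\<Sum>e\<in>edges H. min (edge_ratio H n p e powr (1 / 3)) ((1 / ((1 - p (card e)) * real n ^ card e)) powr (1 / 2)))))"
  (is "_ \<le> ereal (C * (_ + ?S))")
proof (rule kolmogorov_dist_le)
  fix x :: real
  have S0: "0 \<le> ?S" by (intro sum_nonneg) simp
  show "\<bar>measure_pmf.prob field_pmf {\<omega>. std_count \<omega> \<le> x} - normal_cdf x\<bar> \<le> C * (m powr (- 1 / 5) + ?S)"
  proof (cases "1 \<le> m")
    case True
    obtain ks where "lost ks powr (1 / 3) + sqrt (noise ks) \<le> (real s + 1) * m powr (- 1 / 5) + ?S"
      using kept_sizes_kolmogorov[OF True] by blast
    from rate_combine[OF _ _ this, of 5] S0 kolmogorov_std_count[of x ks] show ?thesis by simp
  next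
    case False
    have "1 * 1 \<le> C * (m powr (- 1 / 5) + ?S)"
      using C_facts(1) one_le_powr_minus[of "1 / 5"] False S0 by (intro mult_mono) auto
    with kolmogorov_le_1[of x] show ?thesis by linarith
  qed
qed

lemma wk_rate:
  assumes c: "0 < c" "c < 1" and pc: "\<And>e. e \<in> edges H \<Longrightarrow> p (card e) < c"
  shows "wk_dist (copy_law H n p) std_normal_distribution \<le>
    ereal (13 * rate_const v s * sqrt (1 + real s / (1 - c)) * m powr (- 1 / 2))"
proof -
  let ?a = "1 + real s / (1 - c)"
  have a: "0 \<le> ?a" using c by (intro add_nonneg_nonneg divide_nonneg_nonneg) auto
  have "noise UNIV \<le> 1 / m + (\<Sum>e\<in>edges H. 1 / ((1 - c) * m))"
  proof -
    have "1 / ((1 - p (card e)) * real n ^ card e) \<le> 1 / ((1 - c) * m)" if "e \<in> edges H" for e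
    proof (rule divide_left_mono)
      show "(1 - c) * m \<le> (1 - p (card e)) * real n ^ card e"
        using c pc[OF that] m_le_n_power[OF that] m_pos by (intro mult_mono) auto
      show "0 < (1 - p (card e)) * real n ^ card e * ((1 - c) * m)"
        using c edge_p[OF that] n_pos m_pos by (intro mult_pos_pos) auto
    qed simp
    then have "(\<Sum>e\<in>edges H. 1 / ((1 - p (card e)) * real n ^ card e)) \<le> (\<Sum>e\<in>edges H. 1 / ((1 - c) * m))"
      by (intro sum_mono)
    moreover have all: "{e \<in> edges H. card e \<in> UNIV} = edges H" by simp
    ultimately show ?thesis unfolding noise_def all by linarith
  qed
  also have "\<dots> = ?a / m" using c m_pos by (simp add: field_simps)
  finally have "sqrt (noise UNIV) \<le> sqrt (?a / m)" by simp
  also have "\<dots> = sqrt ?a * m powr (- 1 / 2)"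
    using m_pos by (simp add: real_sqrt_divide powr_minus_divide powr_half_sqrt)
  finally have N: "sqrt (noise UNIV) \<le> sqrt ?a * m powr (- 1 / 2)" .
  have l: "lost UNIV = 0" by (simp add: lost_def)
  have D: "1 \<le> rate_const v s" by (rule rate_const_ge_1)
  have W: "13 * rate_const v s * (lost UNIV powr (1 / 2) + sqrt (noise UNIV)) \<le>
      13 * rate_const v s * sqrt ?a * m powr (- 1 / 2)"
    unfolding l mult.assoc using N D by (intro mult_left_mono) auto
  have K: "5 * rate_const v s * (lost UNIV powr (1 / 3) + sqrt (noise UNIV)) \<le>
      13 * rate_const v s * sqrt ?a * m powr (- 1 / 2)"
  proof -
    have "5 * rate_const v s * (lost UNIV powr (1 / 3) + sqrt (noise UNIV)) \<le>
        13 * rate_const v s * (sqrt ?a * m powr (- 1 / 2))"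
      unfolding l using N D noise_bounds(1) by (intro mult_mono) auto
    then show ?thesis by simp
  qed
  show ?thesis
    unfolding wk_dist_def
  proof (rule max.boundedI)
    show "wasserstein_dist (copy_law H n p) std_normal_distribution \<le>
        ereal (13 * rate_const v s * sqrt ?a * m powr (- 1 / 2))"
      by (rule wasserstein_dist_le) (rule order.trans[OF wasserstein_std_count W])
    show "kolmogorov_dist (copy_law H n p) std_normal_distribution \<le>
        ereal (13 * rate_const v s * sqrt ?a * m powr (- 1 / 2))"
      by (rule kolmogorov_dist_le) (rule order.trans[OF kolmogorov_std_count K])
  qed
qed

end

theorem theorem3p3:
  fixes H :: "'a hypergraph"
  assumes "hypergraph H" and "edges H \<noteq> {}"
  shows
    "(\<exists>C>0. \<exists>n0. \<forall>n\<ge>n0. \<forall>p. (\<forall>i\<in>{1..n}. 0 < p i \<and> p i < 1) \<longrightarrow>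
        wasserstein_dist (copy_law H n p) std_normal_distribution
          \<le> ereal (C * (min_PF H n p powr (- 1 / 4)
              + (\<Sum>e\<in>edges H.
                  (min (edge_ratio H n p e)
                       (1 / ((1 - p (card e)) * real n ^ card e))) powr (1 / 2))))
      \<and> kolmogorov_dist (copy_law H n p) std_normal_distribution
          \<le> ereal (C * (min_PF H n p powr (- 1 / 5)
              + (\<Sum>e\<in>edges H.
                  min (edge_ratio H n p e powr (1 / 3))
                      ((1 / ((1 - p (card e)) * real n ^ card e)) powr (1 / 2))))))
     \<and> (\<forall>c. 0 < c \<and> c < 1 \<longrightarrow>
         (\<exists>C'>0. \<exists>n0'. \<forall>n\<ge>n0'. \<forall>p.
            (\<forall>i\<in>{1..n}. 0 < p i \<and> p i < 1) \<and> (\<forall>e\<in>edges H. p (card e) < c) \<longrightarrow>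
            wk_dist (copy_law H n p) std_normal_distribution
              \<le> ereal (C' * min_PF H n p powr (- 1 / 2))))"
proof (intro conjI allI impI)
  let ?v = "card (verts H)" and ?s = "card (edges H)"
  have rc: "random_copies H n p" if "?v \<le> n" "\<forall>i\<in>{1..n}. 0 < p i \<and> p i < 1" for n p
    using that assms by unfold_locales auto
  have D: "1 \<le> rate_const ?v ?s"
  proof -
    interpret random_copies H ?v "\<lambda>_. 1 / 2" by (rule rc) auto
    show ?thesis by (rule rate_const_ge_1)
  qed
  let ?C = "13 * rate_const ?v ?s * (real ?s + 1)"
  show "\<exists>C>0. \<exists>n0. \<forall>n\<ge>n0. \<forall>p. (\<forall>i\<in>{1..n}. 0 < p i \<and> p i < 1) \<longrightarrow>
        wasserstein_dist (copy_law H n p) std_normal_distribution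
          \<le> ereal (C * (min_PF H n p powr (- 1 / 4)
              + (\<Sum>e\<in>edges H.
                  (min (edge_ratio H n p e)
                       (1 / ((1 - p (card e)) * real n ^ card e))) powr (1 / 2))))
      \<and> kolmogorov_dist (copy_law H n p) std_normal_distribution
          \<le> ereal (C * (min_PF H n p powr (- 1 / 5)
              + (\<Sum>e\<in>edges H.
                  min (edge_ratio H n p e powr (1 / 3))
                      ((1 / ((1 - p (card e)) * real n ^ card e)) powr (1 / 2)))))"
  proof (intro exI[of _ ?C] exI[of _ ?v] conjI[of "0 < ?C"] allI impI)
    show "0 < ?C" using D by simp
    fix n and p :: "nat \<Rightarrow> real" assume "?v \<le> n" "\<forall>i\<in>{1..n}. 0 < p i \<and> p i < 1"
    then interpret random_copies H n p by (rule rc)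
    show "wasserstein_dist (copy_law H n p) std_normal_distribution
          \<le> ereal (?C * (min_PF H n p powr (- 1 / 4)
              + (\<Sum>e\<in>edges H.
                  (min (edge_ratio H n p e)
                       (1 / ((1 - p (card e)) * real n ^ card e))) powr (1 / 2))))
      \<and> kolmogorov_dist (copy_law H n p) std_normal_distribution
          \<le> ereal (?C * (min_PF H n p powr (- 1 / 5)
              + (\<Sum>e\<in>edges H.
                  min (edge_ratio H n p e powr (1 / 3))
                      ((1 / ((1 - p (card e)) * real n ^ card e)) powr (1 / 2)))))"
      using wasserstein_rate kolmogorov_rate unfolding C_def by blast
  qed
  fix c :: real assume c: "0 < c \<and> c < 1"
  let ?C' = "13 * rate_const ?v ?s * sqrt (1 + real ?s / (1 - c))"
  show "\<exists>C'>0. \<exists>n0'. \<forall>n\<ge>n0'. \<forall>p.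
            (\<forall>i\<in>{1..n}. 0 < p i \<and> p i < 1) \<and> (\<forall>e\<in>edges H. p (card e) < c) \<longrightarrow>
            wk_dist (copy_law H n p) std_normal_distribution
              \<le> ereal (C' * min_PF H n p powr (- 1 / 2))"
  proof (intro exI[of _ ?C'] exI[of _ ?v] conjI[of "0 < ?C'"] allI impI)
    have "0 < 1 + real ?s / (1 - c)" using c by (intro add_pos_nonneg divide_nonneg_nonneg) auto
    then show "0 < ?C'" using D by simp
    fix n and p :: "nat \<Rightarrow> real" assume n: "?v \<le> n"
      and p: "(\<forall>i\<in>{1..n}. 0 < p i \<and> p i < 1) \<and> (\<forall>e\<in>edges H. p (card e) < c)"
    interpret random_copies H n p using n p by (intro rc) auto
    show "wk_dist (copy_law H n p) std_normal_distribution \<le> ereal (?C' * min_PF H n p powr (- 1 / 2))"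
      using c p by (intro wk_rate) auto
  qed
qed

end
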